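(* Let $n \ge 7$, let $1 \le k \le n$, and let $x \in S_k$ be a permutation with no fixed points on $\{1,\dots,k\}$. Let $\theta$ be a $1$-dimensional (complex) character of $S_{n-k}$. The induced character $$\psi = \bigl(1_{C_{S_k}(x)} \times \theta\bigr)\big\uparrow_{C_{S_k}(x)\times S_{n-k}}^{S_n}$$ is multiplicity-free if and only if one of the following holds: (1) $k=2$ and $x$ is a $2$-cycle; (2) $k=3$ and $x$ is a $3$-cycle; (3) $x$ is a fixed-point-free involution in $S_k$ and $\theta = \operatorname{sgn}_{S_{n-k}}$.
   Context: $S_n$ is the symmetric group of degree $n$, and $S_k\times S_{n-k}$ is regarded as a subgroup of $S_n$ in the usual way ($S_k$ acting on $\{1,\dots,k\}$, $S_{n-k}$ on the remaining points; $S_0$ and $S_1$ are trivial groups, on which the sign character and the trivial character coincide). $C_{S_k}(x)$ is the centralizer of $x$ in $S_k$, $1_H$ is the trivial character of $H$, $\operatorname{sgn}$ is the sign character, and $\uparrow$ denotes induction of characters. A complex character $\pi$ of $S_n$ is multiplicity-free if $\langle \pi,\chi\rangle\le 1$ for every irreducible character $\chi$ of $S_n$. *)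

theory Defs
  imports
    "HOL-Algebra.Sym_Groups"
    "Jordan_Normal_Form.VS_Connect"
begin

section \<open>Complex representations and characters of finite groups\<close>

abbreviation GL :: "nat \<Rightarrow> complex mat monoid"
  where "GL d \<equiv> units_of (ring_mat TYPE(complex) d ())"

definition representation :: "('g, 'm) monoid_scheme \<Rightarrow> nat \<Rightarrow> ('g \<Rightarrow> complex mat) \<Rightarrow> bool"
  where "representation G d \<rho> \<longleftrightarrow> \<rho> \<in> hom G (GL d)"

definition irreducible_representation ::
    "('g, 'm) monoid_scheme \<Rightarrow> nat \<Rightarrow> ('g \<Rightarrow> complex mat) \<Rightarrow> bool"
  where "irreducible_representation G d \<rho> \<longleftrightarrow>
    representation G d \<rho> \<and> d > 0 \<and>
    (\<forall>W. subspace class_ring W (module_vec TYPE(complex) d) \<longrightarrow>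
         (\<forall>g\<in>carrier G. \<forall>w\<in>W. \<rho> g *\<^sub>v w \<in> W) \<longrightarrow>
         W = {0\<^sub>v d} \<or> W = carrier_vec d)"

definition trace :: "complex mat \<Rightarrow> complex"
  where "trace A = (\<Sum>i<dim_row A. A $$ (i, i))"

text \<open>Characters are total functions of which only the values on the carrier matter.\<close>

definition character :: "('g, 'm) monoid_scheme \<Rightarrow> nat \<Rightarrow> ('g \<Rightarrow> complex) \<Rightarrow> bool"
  where "character G d \<chi> \<longleftrightarrow>
    (\<exists>\<rho>. representation G d \<rho> \<and> (\<forall>g\<in>carrier G. \<chi> g = trace (\<rho> g)))"

definition irreducible_character :: "('g, 'm) monoid_scheme \<Rightarrow> ('g \<Rightarrow> complex) \<Rightarrow> bool"
  where "irreducible_character G \<chi> \<longleftrightarrow>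
    (\<exists>d \<rho>. irreducible_representation G d \<rho> \<and> (\<forall>g\<in>carrier G. \<chi> g = trace (\<rho> g)))"

definition char_inner ::
    "('g, 'm) monoid_scheme \<Rightarrow> ('g \<Rightarrow> complex) \<Rightarrow> ('g \<Rightarrow> complex) \<Rightarrow> complex"
  where "char_inner G \<phi> \<psi> = (\<Sum>g\<in>carrier G. \<phi> g * cnj (\<psi> g)) / of_nat (card (carrier G))"

text \<open>
  The relation \<open>\<le>\<close> below is the partial order of \<^theory>\<open>HOL-Library.Complex_Order\<close>. Inner
  products of two characters are natural numbers, so there it is the usual order of numbers.
\<close>

definition multiplicity_free :: "('g, 'm) monoid_scheme \<Rightarrow> ('g \<Rightarrow> complex) \<Rightarrow> bool"
  where "multiplicity_free G \<pi> \<longleftrightarrow>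
    (\<forall>\<chi>. irreducible_character G \<chi> \<longrightarrow> char_inner G \<pi> \<chi> \<le> 1)"

definition trivial_char :: "'g \<Rightarrow> complex"
  where "trivial_char g = 1"

definition induced_char ::
    "('g, 'm) monoid_scheme \<Rightarrow> 'g set \<Rightarrow> ('g \<Rightarrow> complex) \<Rightarrow> 'g \<Rightarrow> complex"
  where "induced_char G H \<phi> g =
    (\<Sum>t\<in>{t \<in> carrier G. inv\<^bsub>G\<^esub> t \<otimes>\<^bsub>G\<^esub> g \<otimes>\<^bsub>G\<^esub> t \<in> H}.
        \<phi> (inv\<^bsub>G\<^esub> t \<otimes>\<^bsub>G\<^esub> g \<otimes>\<^bsub>G\<^esub> t)) / of_nat (card H)"

text \<open>
  The character \<open>\<alpha> \<times> \<beta>\<close> of an internal direct product \<open>H \<times> K = H <#> K\<close> inside \<open>G\<close>. The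
  description is unique as soon as elements of \<open>H <#> K\<close> factor uniquely.
\<close>

definition product_char ::
    "('g, 'm) monoid_scheme \<Rightarrow> 'g set \<Rightarrow> 'g set \<Rightarrow> ('g \<Rightarrow> complex) \<Rightarrow> ('g \<Rightarrow> complex) \<Rightarrow> 'g \<Rightarrow> complex"
  where "product_char G H K \<alpha> \<beta> g =
    (THE z. \<exists>h\<in>H. \<exists>k\<in>K. g = h \<otimes>\<^bsub>G\<^esub> k \<and> z = \<alpha> h * \<beta> k)"

definition centralizer :: "('g, 'm) monoid_scheme \<Rightarrow> 'g \<Rightarrow> 'g set"
  where "centralizer G x = {g \<in> carrier G. g \<otimes>\<^bsub>G\<^esub> x = x \<otimes>\<^bsub>G\<^esub> g}"


section \<open>Symmetric groups\<close>

text \<open>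
  An element of \<^term>\<open>sym_group k\<close> is a function on all natural numbers that fixes everything
  outside \<open>{1..k}\<close>, so \<^term>\<open>carrier (sym_group k)\<close> is literally a subset of
  \<^term>\<open>carrier (sym_group n)\<close> for \<open>k \<le> n\<close>. The following is the factor \<open>S\<^bsub>n-k\<^esub>\<close> of the
  subgroup \<open>S\<^sub>k \<times> S\<^bsub>n-k\<^esub>\<close> of \<open>S\<^sub>n\<close>.
\<close>

definition sym_group_rest :: "nat \<Rightarrow> nat \<Rightarrow> (nat \<Rightarrow> nat) monoid"
  where "sym_group_rest k n = (sym_group n) \<lparr> carrier := {p. p permutes {k+1..n}} \<rparr>"

definition is_cycle :: "nat \<Rightarrow> ('a \<Rightarrow> 'a) \<Rightarrow> bool"
  where "is_cycle r x \<longleftrightarrow> (\<exists>cs. cycle cs \<and> length cs = r \<and> x = cycle_of_list cs)"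

lemma product_char_sym:
  assumes H: "H \<subseteq> carrier (sym_group k)" and p: "p \<in> H"
    and q: "q \<in> carrier (sym_group_rest k n)"
  shows "product_char (sym_group n) H (carrier (sym_group_rest k n)) \<alpha> \<beta> (p \<circ> q) = \<alpha> p * \<beta> q"
proof -
  have uniq: "p' = p \<and> q' = q"
    if "p' \<in> H" "q' permutes {k+1..n}" "p \<circ> q = p' \<circ> q'" for p' q'
  proof -
    have P: "p permutes {1..k}" "p' permutes {1..k}" "q permutes {k+1..n}"
      using H p q that(1) by (auto simp: sym_group_def sym_group_rest_def)
    have "q i = q' i" for i
    proof (cases "i \<in> {k+1..n}")
      case True
      then have "q i \<in> {k+1..n}" "q' i \<in> {k+1..n}"
        using P(3) that(2) by (meson permutes_in_image)+
      then have "p (q i) = q i" "p' (q' i) = q' i"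
        using P(1,2) by (auto simp: permutes_def)
      then show ?thesis using that(3) by (metis comp_apply)
    next
      case False
      then show ?thesis using P(3) that(2) by (simp add: permutes_def)
    qed
    then have "q' = q" by auto
    moreover from this have "p' = p"
      using that(3) P(3) by (metis comp_assoc comp_id permutes_inv_o(1))
    ultimately show ?thesis by simp
  qed
  show ?thesis
    unfolding product_char_def
  proof (rule the_equality)
    show "\<exists>h\<in>H. \<exists>k\<in>carrier (sym_group_rest k n).
        p \<circ> q = h \<otimes>\<^bsub>sym_group n\<^esub> k \<and> \<alpha> p * \<beta> q = \<alpha> h * \<beta> k"
      using p q by (auto simp: sym_group_mult)
  next
    fix z
    assume "\<exists>h\<in>H. \<exists>k\<in>carrier (sym_group_rest k n).
        p \<circ> q = h \<otimes>\<^bsub>sym_group n\<^esub> k \<and> z = \<alpha> h * \<beta> k"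
    then show "z = \<alpha> p * \<beta> q"
      using uniq by (auto simp: sym_group_mult sym_group_rest_def)
  qed
qed

end

theory Submission
  imports Defs "Jordan_Normal_Form.Spectral_Radius" "HOL-Library.Complex_Order"
begin

text \<open>
  Put \<open>H = C(x)\<close>, the centralizer of \<open>x\<close> in \<open>S\<^sub>n\<close>. The inducing character is \<open>1\<close> or the sign on
  the fixed points of \<open>x\<close>, hence a homomorphism \<open>\<epsilon> : H \<rightarrow> {1, -1}\<close>. Let \<open>e\<close> be the corresponding
  idempotent of the group algebra. The multiplicity of an irreducible character is the trace of \<open>e\<close>
  in the representation, and since every element of \<open>S\<^sub>n\<close> is conjugate to its inverse, the induced
  character is multiplicity-free iff \<open>e g e = e g\<^sup>-\<^sup>1 e\<close> for all \<open>g\<close>. Indeed, in the multiplicity-free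
  case \<open>e g e\<close> acts on the image of \<open>e\<close> as a scalar, its trace, which does not change when \<open>g\<close> is
  inverted; conversely \<open>g \<mapsto> g\<^sup>-\<^sup>1\<close> reverses products, so that the elements \<open>e g e\<close> commute.

  With \<open>y = g x g\<^sup>-\<^sup>1\<close> this becomes a question about pairs of conjugate permutations: either some
  permutation commuting with \<open>x\<close> and \<open>y\<close> has different \<open>\<epsilon>\<close>-signs with respect to \<open>x\<close> and \<open>y\<close>, or
  \<open>x\<close> and \<open>y\<close> are interchanged by a conjugation of the right sign (any involution is). For a
  transposition or a 3-cycle such an involution always exists; for two fixed-point-free involutions of
  subsets and the sign character the orbits of the dihedral group \<open>\<langle>x, y\<rangle>\<close> decide. In all other
  cases an explicit \<open>y\<close> is given that cannot be interchanged with \<open>x\<close>.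
\<close>

text \<open>Passing from commuting compressions \<open>e g e\<close> to multiplicity at most one is
  done by a trace identity: summing a product of two compressions against inverse group elements,
  over all pairs, turns commutativity into t = t^3 for the multiplicity t. For the converse, an
  idempotent of trace at most one has rank at most one, and a combination of group elements killed
  by every irreducible character has coefficient zero at the identity. The sign character is the
  obstacle in the negative cases, since \<open>e g e\<close> may vanish. There \<open>g\<close> is
  chosen so that it takes at most one fixed point of \<open>x\<close> out of the set of fixed points
  and leaves the others in place, which excludes vanishing for both choices of
  \<open>\<theta>\<close>; two fixed points are moved only when \<open>\<theta>\<close> is trivial.
  The bound n >= 7 enters when k = n and \<open>x\<close> has no fixed point to offer: a cycle of
  length at least four requires a point outside a set of up to six points, and cycles of length two
  and three require a 3-cycle with two further cycles, while two 3-cycles already fill six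
  points.\<close>

text \<open>
  A nonzero idempotent is deflated by subtracting the rank-one idempotent
  \<open>P\<^bsub>\<cdot>j\<^esub> P\<^bsub>i\<cdot>\<^esub> / P\<^bsub>ij\<^esub>\<close>, which clears column \<open>j\<close> and lowers the trace by one.
\<close>

lemma idempotent_trace:
  fixes P :: "'i \<Rightarrow> 'i \<Rightarrow> complex"
  assumes "finite I"
    and "\<And>a b. a \<in> I \<Longrightarrow> b \<in> I \<Longrightarrow> (\<Sum>l\<in>I. P a l * P l b) = P a b"
  shows "\<exists>m::nat. (\<Sum>a\<in>I. P a a) = of_nat m
     \<and> (m = 0 \<longrightarrow> (\<forall>a\<in>I. \<forall>b\<in>I. P a b = 0))
     \<and> (m = 1 \<longrightarrow> (\<forall>a\<in>I. \<forall>b\<in>I. \<forall>i\<in>I. \<forall>j\<in>I. P a b * P i j = P a j * P i b))"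
  using assms(2)
proof (induction "card {b\<in>I. \<exists>a\<in>I. P a b \<noteq> 0}" arbitrary: P rule: less_induct)
  case less
  show ?case
  proof (cases "\<forall>a\<in>I. \<forall>b\<in>I. P a b = 0")
    case True
    then show ?thesis by (intro exI[of _ 0]) auto
  next
    case False
    then obtain i j where ij: "i \<in> I" "j \<in> I" "P i j \<noteq> 0" by blast
    define Q where "Q a b = P a b - P a j * P i b / P i j" for a b
    have Qidem: "(\<Sum>l\<in>I. Q a l * Q l b) = Q a b" if ab: "a \<in> I" "b \<in> I" for a b
    proof -
      have "(\<Sum>l\<in>I. Q a l * Q l b) = (\<Sum>l\<in>I. P a l * P l b) - (\<Sum>l\<in>I. P a l * P l j) * P i b / P i j
          - P a j / P i j * (\<Sum>l\<in>I. P i l * P l b)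
          + P a j * P i b / (P i j * P i j) * (\<Sum>l\<in>I. P i l * P l j)"
        unfolding Q_def by (simp add: algebra_simps sum.distrib sum_subtractf sum_distrib_left
            sum_distrib_right sum_divide_distrib)
      also have "\<dots> = Q a b"
        unfolding less.prems[OF ab] less.prems[OF ab(1) ij(2)] less.prems[OF ij(1) ab(2)]
          less.prems[OF ij(1,2)] using ij(3) by (simp add: Q_def field_simps)
      finally show ?thesis .
    qed
    have Qj: "Q a j = 0" for a using ij by (simp add: Q_def)
    have Q0: "Q a b = 0" if "\<forall>a\<in>I. P a b = 0" "a \<in> I" for a b
      using that ij by (simp add: Q_def)
    \<comment> \<open>The induction counts nonzero columns: zero columns of \<open>P\<close> stay
      zero in \<open>Q\<close>, and column \<open>j\<close> becomes zero.\<close>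
    have "{b\<in>I. \<exists>a\<in>I. Q a b \<noteq> 0} \<subset> {b\<in>I. \<exists>a\<in>I. P a b \<noteq> 0}"
      using Qj Q0 ij by blast
    then have "card {b\<in>I. \<exists>a\<in>I. Q a b \<noteq> 0} < card {b\<in>I. \<exists>a\<in>I. P a b \<noteq> 0}"
      using assms(1) by (intro psubset_card_mono) auto
    from less.hyps[OF this Qidem] obtain m :: nat where
      m: "(\<Sum>a\<in>I. Q a a) = of_nat m" "m = 0 \<Longrightarrow> \<forall>a\<in>I. \<forall>b\<in>I. Q a b = 0" by blast
    have "(\<Sum>a\<in>I. P a a) = (\<Sum>a\<in>I. Q a a) + (\<Sum>a\<in>I. P i a * P a j) / P i j"
      by (simp add: Q_def sum_subtractf sum_divide_distrib mult.commute)
    also have "\<dots> = of_nat (Suc m)"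
      using m(1) less.prems ij by simp
    finally have tr: "(\<Sum>a\<in>I. P a a) = of_nat (Suc m)" .
    \<comment> \<open>If the deflated \<open>Q\<close> has trace 0 it vanishes by induction, so
      \<open>P\<close> is an outer product and all its 2 x 2 minors are zero.\<close>
    have "P a b * P c e = P a e * P c b" if "m = 0" "a \<in> I" "b \<in> I" "c \<in> I" "e \<in> I" for a b c e
    proof -
      have *: "P u v = P u j * P i v / P i j" if "u \<in> I" "v \<in> I" for u v
        using m(2)[OF \<open>m = 0\<close>] that by (auto simp: Q_def)
      show ?thesis unfolding *[OF that(2,3)] *[OF that(4,5)] *[OF that(2,5)] *[OF that(4,3)] by simp
    qed
    then show ?thesis using tr by (intro exI[of _ "Suc m"]) auto
  qed
qed

section \<open>Matrices and representations\<close>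

lemma trace_eq_sum: "A \<in> carrier_mat d d \<Longrightarrow> trace A = (\<Sum>i<d. A $$ (i, i))"
  by (simp add: trace_def)

lemma index_mult_mat_sum:
  "A \<in> carrier_mat n m \<Longrightarrow> B \<in> carrier_mat m l \<Longrightarrow> i < n \<Longrightarrow> j < l \<Longrightarrow>
    (A * B) $$ (i, j) = (\<Sum>k<m. A $$ (i, k) * B $$ (k, j))"
  by (simp add: scalar_prod_def atLeast0LessThan)

lemma mat_assoc:
  fixes A :: "complex mat"
  assumes "A \<in> carrier_mat d d" "B \<in> carrier_mat d d" "C \<in> carrier_mat d d"
  shows "A * B * C = A * (B * C)"
  using assms by (rule assoc_mult_mat)

lemma mat_closed:
  fixes A :: "complex mat"
  assumes "A \<in> carrier_mat d d" "B \<in> carrier_mat d d"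
  shows "A * B \<in> carrier_mat d d"
  using assms by (rule mult_carrier_mat)

lemma mat_smult:
  fixes A :: "complex mat"
  assumes "A \<in> carrier_mat d d" "B \<in> carrier_mat d d"
  shows "A * (c \<cdot>\<^sub>m B) = c \<cdot>\<^sub>m (A * B)" "c \<cdot>\<^sub>m A * B = c \<cdot>\<^sub>m (A * B)"
  using assms by (simp_all add: mult_smult_distrib[of _ d d _ d] mult_smult_assoc_mat[of _ d d _ d])

lemma trace_mult_commute:
  assumes A: "A \<in> carrier_mat n m" and B: "B \<in> carrier_mat m n"
  shows "trace (A * B) = trace (B * A)"
proof -
  have "trace (A * B) = (\<Sum>i<n. \<Sum>k<m. A $$ (i, k) * B $$ (k, i))"
    using assms by (subst trace_eq_sum[of _ n]) (auto simp: index_mult_mat_sum simp del: index_mult_mat)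
  also have "\<dots> = (\<Sum>k<m. \<Sum>i<n. B $$ (k, i) * A $$ (i, k))"
    by (subst sum.swap) (simp add: mult.commute)
  also have "\<dots> = trace (B * A)"
    using assms by (subst trace_eq_sum[of _ m]) (auto simp: index_mult_mat_sum simp del: index_mult_mat)
  finally show ?thesis .
qed

definition mat_sum :: "nat \<Rightarrow> ('a \<Rightarrow> complex mat) \<Rightarrow> 'a set \<Rightarrow> complex mat"
  where "mat_sum d F A = mat d d (\<lambda>(i, j). \<Sum>a\<in>A. F a $$ (i, j))"

lemma mat_sum_carrier [simp, intro]: "mat_sum d F A \<in> carrier_mat d d"
  by (simp add: mat_sum_def)

lemma dim_mat_sum [simp]: "dim_row (mat_sum d F A) = d" "dim_col (mat_sum d F A) = d"
  by (simp_all add: mat_sum_def)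

lemma mat_sum_index: "i < d \<Longrightarrow> j < d \<Longrightarrow> mat_sum d F A $$ (i, j) = (\<Sum>a\<in>A. F a $$ (i, j))"
  by (simp add: mat_sum_def)

lemma mat_sum_cong: "(\<And>a. a \<in> A \<Longrightarrow> F a = F' a) \<Longrightarrow> mat_sum d F A = mat_sum d F' A"
  by (simp add: mat_sum_def)

lemma trace_mat_sum:
  "(\<And>a. a \<in> A \<Longrightarrow> F a \<in> carrier_mat d d) \<Longrightarrow> trace (mat_sum d F A) = (\<Sum>a\<in>A. trace (F a))"
  by (simp add: trace_eq_sum[of _ d] mat_sum_index sum.swap[of _ "{..<d}"])

lemma mat_sum_mult_right:
  assumes "\<And>a. a \<in> A \<Longrightarrow> F a \<in> carrier_mat d d" "M \<in> carrier_mat d d"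
  shows "mat_sum d F A * M = mat_sum d (\<lambda>a. F a * M) A"
proof (rule eq_matI)
  fix i j assume "i < dim_row (mat_sum d (\<lambda>a. F a * M) A)" "j < dim_col (mat_sum d (\<lambda>a. F a * M) A)"
  then have ij: "i < d" "j < d" by (simp_all add: mat_sum_def)
  show "(mat_sum d F A * M) $$ (i, j) = mat_sum d (\<lambda>a. F a * M) A $$ (i, j)"
    using assms ij
    by (simp add: index_mult_mat_sum[of _ d d _ d] mat_sum_index sum_distrib_right
        sum.swap[of _ "{..<d}"] del: index_mult_mat)
qed (use assms in \<open>auto simp: mat_sum_def\<close>)

lemma mat_sum_mult_left:
  assumes "\<And>a. a \<in> A \<Longrightarrow> F a \<in> carrier_mat d d" "M \<in> carrier_mat d d"
  shows "M * mat_sum d F A = mat_sum d (\<lambda>a. M * F a) A"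
proof (rule eq_matI)
  fix i j assume "i < dim_row (mat_sum d (\<lambda>a. M * F a) A)" "j < dim_col (mat_sum d (\<lambda>a. M * F a) A)"
  then have ij: "i < d" "j < d" by (simp_all add: mat_sum_def)
  show "(M * mat_sum d F A) $$ (i, j) = mat_sum d (\<lambda>a. M * F a) A $$ (i, j)"
    using assms ij
    by (simp add: index_mult_mat_sum[of _ d d _ d] mat_sum_index sum_distrib_left
        sum.swap[of _ "{..<d}"] del: index_mult_mat)
qed (use assms in \<open>auto simp: mat_sum_def\<close>)

lemma mat_sum_smult:
  "(\<And>a. a \<in> A \<Longrightarrow> F a \<in> carrier_mat d d) \<Longrightarrow> mat_sum d (\<lambda>a. c \<cdot>\<^sub>m F a) A = c \<cdot>\<^sub>m mat_sum d F A"
  by (rule eq_matI) (auto simp: mat_sum_def sum_distrib_left carrier_matD[of _ d d] intro!: sum.cong)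

lemma mat_sum_scalars:
  "M \<in> carrier_mat d d \<Longrightarrow> mat_sum d (\<lambda>a. c a \<cdot>\<^sub>m M) A = (\<Sum>a\<in>A. c a) \<cdot>\<^sub>m M"
  by (rule eq_matI) (auto simp: mat_sum_def sum_distrib_right)

lemma mat_sum_reindex:
  "bij_betw f A B \<Longrightarrow> mat_sum d (\<lambda>a. F (f a)) A = mat_sum d F B"
  by (rule eq_matI) (auto simp: mat_sum_def sum.reindex_bij_betw[where h = f, of A B "\<lambda>b. F b $$ _"])

lemma mat_sum_swap:
  "mat_sum d (\<lambda>a. mat_sum d (F a) B) A = mat_sum d (\<lambda>b. mat_sum d (\<lambda>a. F a b) A) B"
proof (rule eq_matI)
  fix i j assume "i < dim_row (mat_sum d (\<lambda>b. mat_sum d (\<lambda>a. F a b) A) B)"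
    "j < dim_col (mat_sum d (\<lambda>b. mat_sum d (\<lambda>a. F a b) A) B)"
  then show "mat_sum d (\<lambda>a. mat_sum d (F a) B) A $$ (i, j) =
      mat_sum d (\<lambda>b. mat_sum d (\<lambda>a. F a b) A) B $$ (i, j)"
    by (simp add: mat_sum_def sum.swap[of _ B A])
qed (auto simp: mat_sum_def)

lemma trace_smult: "A \<in> carrier_mat d d \<Longrightarrow> trace (c \<cdot>\<^sub>m A) = c * trace A"
  by (simp add: trace_eq_sum[of _ d] sum_distrib_left)

lemma trace_one: "trace (1\<^sub>m d) = of_nat d"
  by (simp add: trace_eq_sum[of _ d])


context
  fixes G :: "('g, 'm) monoid_scheme" (structure)
  assumes G: "group G"
begin

interpretation G: group G by (rule G)

lemma representationD:
  assumes "representation G d \<rho>"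
  shows "g \<in> carrier G \<Longrightarrow> \<rho> g \<in> carrier_mat d d"
    and "g \<in> carrier G \<Longrightarrow> h \<in> carrier G \<Longrightarrow> \<rho> (g \<otimes> h) = \<rho> g * \<rho> h"
    and "\<rho> \<one> = 1\<^sub>m d"
proof -
  interpret M: monoid "ring_mat TYPE(complex) d ()"
    by (rule Ring.ring.is_monoid) (rule ring_mat)
  have h: "\<rho> \<in> hom G (GL d)" using assms by (simp add: representation_def)
  show c: "g \<in> carrier G \<Longrightarrow> \<rho> g \<in> carrier_mat d d" for g
    using h by (auto simp: hom_def units_of_def Units_def ring_mat_def)
  show "g \<in> carrier G \<Longrightarrow> h \<in> carrier G \<Longrightarrow> \<rho> (g \<otimes> h) = \<rho> g * \<rho> h" for g h
    using h by (auto simp: hom_def units_of_def ring_mat_def)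
  interpret GL: group "GL d" by (rule M.units_group)
  interpret group_hom G "GL d" \<rho>
    using h G GL.is_group by (simp add: group_hom_def group_hom_axioms_def)
  show "\<rho> \<one> = 1\<^sub>m d" using hom_one by (simp add: units_of_def ring_mat_def)
qed

lemma representationI:
  assumes c: "\<And>g. g \<in> carrier G \<Longrightarrow> \<rho> g \<in> carrier_mat d d"
    and m: "\<And>g h. g \<in> carrier G \<Longrightarrow> h \<in> carrier G \<Longrightarrow> \<rho> (g \<otimes> h) = \<rho> g * \<rho> h"
    and o: "\<rho> \<one> = 1\<^sub>m d"
  shows "representation G d \<rho>"
proof -
  have "\<exists>B\<in>carrier_mat d d. B * \<rho> g = 1\<^sub>m d \<and> \<rho> g * B = 1\<^sub>m d" if "g \<in> carrier G" for g
    using that c[of "inv g"] m[of g "inv g"] m[of "inv g" g] o by (intro bexI[of _ "\<rho> (inv g)"]) auto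
  then show ?thesis
    using c m by (auto simp: representation_def hom_def units_of_def Units_def ring_mat_def)
qed

lemma representation_inv:
  assumes "representation G d \<rho>" "g \<in> carrier G"
  shows "\<rho> (inv g) * \<rho> g = 1\<^sub>m d" "\<rho> g * \<rho> (inv g) = 1\<^sub>m d"
  using representationD(2,3)[OF assms(1)] assms(2) by (metis G.inv_closed G.l_inv G.r_inv)+

lemma trace_conj:
  assumes r: "representation G d \<rho>" and g: "g \<in> carrier G" and t: "t \<in> carrier G"
  shows "trace (\<rho> (inv t \<otimes> g \<otimes> t)) = trace (\<rho> g)"
proof -
  note c = representationD(1)[OF r]
  have "\<rho> (inv t \<otimes> g \<otimes> t) = \<rho> (inv t) * (\<rho> g * \<rho> t)"
    using g t representationD(2)[OF r] by (simp add: G.m_assoc)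
  also have "trace \<dots> = trace ((\<rho> g * \<rho> t) * \<rho> (inv t))"
    using c[of t] c[of g] c[of "inv t"] g t by (intro trace_mult_commute[of _ d d]) auto
  also have "(\<rho> g * \<rho> t) * \<rho> (inv t) = \<rho> g"
    using c[of t] c[of g] c[of "inv t"] g t representation_inv(2)[OF r t]
    by (simp add: assoc_mult_mat[of _ d d _ d _ d])
  finally show ?thesis .
qed

lemma trace_commute:
  assumes r: "representation G d \<rho>" and "g \<in> carrier G" "h \<in> carrier G"
  shows "trace (\<rho> (g \<otimes> h)) = trace (\<rho> (h \<otimes> g))"
  using assms representationD[OF r] trace_mult_commute[of "\<rho> g" d d "\<rho> h"] by simp

end

section \<open>Schur orthogonality\<close>

lemma subspaceI:
  assumes "W \<subseteq> carrier_vec d" "0\<^sub>v d \<in> W"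
    "\<And>v w. v \<in> W \<Longrightarrow> w \<in> W \<Longrightarrow> v + w \<in> W" "\<And>c v. v \<in> W \<Longrightarrow> c \<cdot>\<^sub>v v \<in> W"
  shows "VectorSpace.subspace class_ring W (module_vec TYPE(complex) d)"
  unfolding VectorSpace.subspace_def submodule_def
  using assms vec_vs vec_module by (auto simp: module_vec_simps)

lemma subspaceD:
  assumes "VectorSpace.subspace class_ring W (module_vec TYPE(complex) d)"
  shows "W \<subseteq> carrier_vec d" "0\<^sub>v d \<in> W"
    "v \<in> W \<Longrightarrow> w \<in> W \<Longrightarrow> v + w \<in> W" "v \<in> W \<Longrightarrow> c \<cdot>\<^sub>v v \<in> W"
proof -
  have s: "submodule class_ring W (module_vec TYPE(complex) d)"
    using assms by (simp add: VectorSpace.subspace_def)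
  show "W \<subseteq> carrier_vec d" "0\<^sub>v d \<in> W"
    "v \<in> W \<Longrightarrow> w \<in> W \<Longrightarrow> v + w \<in> W" "v \<in> W \<Longrightarrow> c \<cdot>\<^sub>v v \<in> W"
    using submodule.subset[OF s] submodule.zero_closed[OF s] submodule.m_closed[OF s, of v w]
      submodule.smult_closed[OF s, of c v]
    by (auto simp: module_vec_simps)
qed

context
  fixes G :: "('g, 'm) monoid_scheme" (structure)
  assumes G: "group G"
begin

interpretation G: group G by (rule G)

text \<open>Over the complex numbers \<open>S\<close> has an eigenvalue; its eigenspace is invariant
  because \<open>S\<close> commutes with the representation, hence it is everything.\<close>

lemma schur_scalar:
  assumes irr: "irreducible_representation G d \<rho>"
    and S: "S \<in> carrier_mat d d"
    and comm: "\<And>g. g \<in> carrier G \<Longrightarrow> S * \<rho> g = \<rho> g * S"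
  shows "\<exists>c. S = c \<cdot>\<^sub>m 1\<^sub>m d"
proof -
  have r: "representation G d \<rho>" and d: "d > 0"
    using irr by (auto simp: irreducible_representation_def)
  note c = representationD(1)[OF G r]
  obtain k where "eigenvalue S k"
    using spectrum_non_empty[OF S] d by (auto simp: spectrum_def)
  then obtain u where u: "u \<in> carrier_vec d" "u \<noteq> 0\<^sub>v d" "S *\<^sub>v u = k \<cdot>\<^sub>v u"
    using S by (auto simp: eigenvalue_def eigenvector_def)
  define W where "W = {v \<in> carrier_vec d. S *\<^sub>v v = k \<cdot>\<^sub>v v}"
  have "VectorSpace.subspace class_ring W (module_vec TYPE(complex) d)"
  proof (rule subspaceI)
    show "W \<subseteq> carrier_vec d" "0\<^sub>v d \<in> W" using S by (auto simp: W_def)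
    show "v + w \<in> W" if "v \<in> W" "w \<in> W" for v w
      using that S by (simp add: W_def mult_add_distrib_mat_vec[of _ d d] smult_add_distrib_vec[of _ d])
    show "c \<cdot>\<^sub>v v \<in> W" if "v \<in> W" for c v
      using that S by (simp add: W_def mult_mat_vec[of _ d d] smult_smult_assoc mult.commute)
  qed
  moreover have "\<rho> g *\<^sub>v w \<in> W" if "g \<in> carrier G" "w \<in> W" for g w
  proof -
    have w: "w \<in> carrier_vec d" "S *\<^sub>v w = k \<cdot>\<^sub>v w" using that by (auto simp: W_def)
    have "S *\<^sub>v (\<rho> g *\<^sub>v w) = (S * \<rho> g) *\<^sub>v w"
      using S c that w by (intro assoc_mult_mat_vec[symmetric]) auto
    also have "\<dots> = \<rho> g *\<^sub>v (S *\<^sub>v w)"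
      unfolding comm[OF that(1)] using S c that w by (intro assoc_mult_mat_vec) auto
    also have "\<dots> = k \<cdot>\<^sub>v (\<rho> g *\<^sub>v w)"
      using c[OF that(1)] w by (simp add: mult_mat_vec[of _ d d])
    finally show ?thesis using c[OF that(1)] w by (auto simp: W_def)
  qed
  moreover have "W \<noteq> {0\<^sub>v d}" using u by (auto simp: W_def)
  ultimately have W: "W = carrier_vec d"
    using irr by (auto simp: irreducible_representation_def)
  have "S = k \<cdot>\<^sub>m 1\<^sub>m d"
  proof (rule eq_matI)
    fix i j assume ij: "i < dim_row (k \<cdot>\<^sub>m 1\<^sub>m d)" "j < dim_col (k \<cdot>\<^sub>m 1\<^sub>m d)"
    have "unit_vec d j \<in> W" unfolding W by simp
    then have "S *\<^sub>v unit_vec d j = k \<cdot>\<^sub>v unit_vec d j" by (simp add: W_def)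
    then have "(S *\<^sub>v unit_vec d j) $ i = (k \<cdot>\<^sub>v unit_vec d j) $ i" by simp
    then show "S $$ (i, j) = (k \<cdot>\<^sub>m 1\<^sub>m d) $$ (i, j)"
      using ij S by simp
  qed (use S in auto)
  then show ?thesis by blast
qed

lemma bij_left_mult: "g \<in> carrier G \<Longrightarrow> bij_betw ((\<otimes>) g) (carrier G) (carrier G)"
  by (rule bij_betw_byWitness[of _ "(\<otimes>) (inv g)"]) (auto simp: G.m_assoc[symmetric])

text \<open>Substituting t g for g shows that the average commutes with every
  \<open>\<rho> t\<close>, so it is a scalar; each summand has the trace of \<open>M\<close>, which
  determines this scalar.\<close>

lemma schur_average:
  assumes fin: "finite (carrier G)" and irr: "irreducible_representation G d \<rho>"
    and M: "M \<in> carrier_mat d d"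
  shows "mat_sum d (\<lambda>g. \<rho> g * M * \<rho> (inv g)) (carrier G) =
    (of_nat (card (carrier G)) * trace M / of_nat d) \<cdot>\<^sub>m 1\<^sub>m d" (is "?S = _")
proof -
  have r: "representation G d \<rho>" and d: "d > 0"
    using irr by (auto simp: irreducible_representation_def)
  note c = representationD(1)[OF G r] and m = representationD(2)[OF G r]
    and mc = mat_closed and as = mat_assoc[of _ d]
  have "?S * \<rho> t = \<rho> t * ?S" if t: "t \<in> carrier G" for t
  proof -
    have "?S * \<rho> t = mat_sum d (\<lambda>g. \<rho> g * M * \<rho> (inv g) * \<rho> t) (carrier G)"
      using c M t by (intro mat_sum_mult_right) (simp_all add: mc)
    also have "\<dots> = mat_sum d (\<lambda>g. \<rho> (t \<otimes> g) * M * \<rho> (inv (t \<otimes> g)) * \<rho> t) (carrier G)"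
      by (rule mat_sum_reindex[OF bij_left_mult[OF t], symmetric])
    also have "\<dots> = mat_sum d (\<lambda>g. \<rho> t * (\<rho> g * M * \<rho> (inv g))) (carrier G)"
    proof (rule mat_sum_cong)
      fix g assume g: "g \<in> carrier G"
      have *: "\<rho> (inv (t \<otimes> g)) * \<rho> t = \<rho> (inv g)"
        using g t by (simp add: m[symmetric] G.inv_mult_group G.m_assoc)
      have "\<rho> (t \<otimes> g) * M * \<rho> (inv (t \<otimes> g)) * \<rho> t = \<rho> (t \<otimes> g) * M * (\<rho> (inv (t \<otimes> g)) * \<rho> t)"
        using g t M c by (simp add: as mc)
      also have "\<dots> = \<rho> t * (\<rho> g * M * \<rho> (inv g))"
        unfolding * using g t M c by (simp add: as mc m)
      finally show "\<rho> (t \<otimes> g) * M * \<rho> (inv (t \<otimes> g)) * \<rho> t = \<rho> t * (\<rho> g * M * \<rho> (inv g))" .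
    qed
    also have "\<dots> = \<rho> t * ?S"
      using c M t by (intro mat_sum_mult_left[symmetric]) (simp_all add: mc)
    finally show ?thesis .
  qed
  then obtain k where k: "?S = k \<cdot>\<^sub>m 1\<^sub>m d"
    using schur_scalar[OF irr, of ?S] by auto
  have "trace ?S = (\<Sum>g\<in>carrier G. trace (\<rho> g * M * \<rho> (inv g)))"
    using c M by (intro trace_mat_sum) (simp_all add: mc)
  also have "\<dots> = (\<Sum>g\<in>carrier G. trace M)"
  proof (rule sum.cong)
    fix g assume g: "g \<in> carrier G"
    have "trace (\<rho> g * M * \<rho> (inv g)) = trace (\<rho> (inv g) * (\<rho> g * M))"
      using c M g by (intro trace_mult_commute[of _ d d]) (simp_all add: mc)
    also have "\<rho> (inv g) * (\<rho> g * M) = (\<rho> (inv g) * \<rho> g) * M"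
      using c M g by (simp add: as)
    also have "\<dots> = M"
      using representation_inv(1)[OF G r g] M by simp
    finally show "trace (\<rho> g * M * \<rho> (inv g)) = trace M" .
  qed simp
  finally have "k * of_nat d = of_nat (card (carrier G)) * trace M"
    by (simp add: k trace_smult[of _ d] trace_one)
  then have "k = of_nat (card (carrier G)) * trace M / of_nat d" using d by (simp add: field_simps)
  then show ?thesis using k by simp
qed

end

section \<open>The projection attached to a sign character of a subgroup\<close>

lemma smult_smult_times: "k \<cdot>\<^sub>m (l \<cdot>\<^sub>m A) = (k * l :: complex) \<cdot>\<^sub>m A"
  by (rule eq_matI) (auto simp: mult.assoc)

text \<open>With values 1 and -1 only, \<open>\<epsilon>\<close> is real and agrees on
  \<open>h\<close> and its inverse, so the idempotent e is fixed by g \<mapsto> g^-1. Values of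
  \<open>\<epsilon>\<close> outside \<open>H\<close> are unconstrained.\<close>

locale sign_character =
  G: group G for G :: "('g, 'm) monoid_scheme" (structure) +
  fixes H :: "'g set" and \<epsilon> :: "'g \<Rightarrow> complex"
  assumes fin: "finite (carrier G)"
    and sub: "subgroup H G"
    and sign_values: "h \<in> H \<Longrightarrow> \<epsilon> h = 1 \<or> \<epsilon> h = -1"
    and mult: "h \<in> H \<Longrightarrow> h' \<in> H \<Longrightarrow> \<epsilon> (h \<otimes> h') = \<epsilon> h * \<epsilon> h'"
begin

lemma H_carrier: "h \<in> H \<Longrightarrow> h \<in> carrier G"
  using subgroup.mem_carrier[OF sub] .

lemma finH: "finite H"
  using fin H_carrier by (meson finite_subset subsetI)

lemma card_H: "card H > 0"
  using finH subgroup.one_closed[OF sub] by (auto simp: card_gt_0_iff)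

lemma sign_square: "h \<in> H \<Longrightarrow> \<epsilon> h * \<epsilon> h = 1"
  using sign_values by force

lemma sign_inverse: "h \<in> H \<Longrightarrow> \<epsilon> (inv h) = \<epsilon> h"
proof -
  assume h: "h \<in> H"
  have "\<epsilon> \<one> * \<epsilon> \<one> = \<epsilon> \<one>" using mult[of \<one> \<one>] subgroup.one_closed[OF sub] by simp
  then have "\<epsilon> \<one> = 1" using sign_values[of \<one>] subgroup.one_closed[OF sub] by auto
  then have "\<epsilon> (inv h) * \<epsilon> h = 1"
    using mult[of "inv h" h] h subgroup.m_inv_closed[OF sub] H_carrier by simp
  then show ?thesis using sign_values[OF h] by (auto simp: minus_equation_iff)
qed

lemma sign_cnj: "h \<in> H \<Longrightarrow> cnj (\<epsilon> h) = \<epsilon> h"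
  using sign_values by force

text \<open>The image of the idempotent e under \<open>\<rho>\<close>. The usual weight
  \<open>\<epsilon> (inv h)\<close> equals \<open>\<epsilon> h\<close> here.\<close>

definition proj :: "nat \<Rightarrow> ('g \<Rightarrow> complex mat) \<Rightarrow> complex mat"
  where "proj d \<rho> = (1 / of_nat (card H)) \<cdot>\<^sub>m mat_sum d (\<lambda>h. \<epsilon> h \<cdot>\<^sub>m \<rho> h) H"

lemma proj_carrier [simp, intro]: "proj d \<rho> \<in> carrier_mat d d"
  by (simp add: proj_def)

lemma bij_left_H: "h \<in> H \<Longrightarrow> bij_betw ((\<otimes>) h) H H"
  by (rule bij_betw_byWitness[of _ "(\<otimes>) (inv h)"])
    (auto simp: G.m_assoc[symmetric] H_carrier subgroup.m_closed[OF sub] subgroup.m_inv_closed[OF sub])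

lemma bij_right_H: "h \<in> H \<Longrightarrow> bij_betw (\<lambda>t. t \<otimes> h) H H"
  by (rule bij_betw_byWitness[of _ "\<lambda>t. t \<otimes> inv h"])
    (auto simp: G.m_assoc H_carrier subgroup.m_closed[OF sub] subgroup.m_inv_closed[OF sub])

lemma bij_inv_H: "bij_betw (m_inv G) H H"
  by (rule bij_betw_byWitness[of _ "m_inv G"])
    (auto simp: H_carrier subgroup.m_inv_closed[OF sub])

context
  fixes d \<rho>
  assumes r: "representation G d \<rho>"
begin

lemmas rep_carrier = representationD(1)[OF G.group_axioms r]
  and rep_mult = representationD(2)[OF G.group_axioms r]

lemma rho_proj: assumes h: "h \<in> H" shows "\<rho> h * proj d \<rho> = \<epsilon> h \<cdot>\<^sub>m proj d \<rho>"
proof -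
  let ?F = "\<lambda>t. \<epsilon> t \<cdot>\<^sub>m \<rho> t"
  have "\<rho> h * mat_sum d ?F H = mat_sum d (\<lambda>t. \<rho> h * ?F t) H"
    using rep_carrier H_carrier h by (intro mat_sum_mult_left) auto
  also have "\<dots> = mat_sum d (\<lambda>t. \<epsilon> h \<cdot>\<^sub>m ?F (h \<otimes> t)) H"
  proof (rule mat_sum_cong)
    fix t assume t: "t \<in> H"
    have "\<epsilon> h * \<epsilon> (h \<otimes> t) = \<epsilon> t" using sign_square[OF h] mult[OF h t] by (simp add: mult.assoc[symmetric])
    then show "\<rho> h * ?F t = \<epsilon> h \<cdot>\<^sub>m ?F (h \<otimes> t)"
      using rep_carrier h t H_carrier rep_mult by (simp add: mat_smult[of _ d] smult_smult_times)
  qed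
  also have "\<dots> = \<epsilon> h \<cdot>\<^sub>m mat_sum d (\<lambda>t. ?F (h \<otimes> t)) H"
    using rep_carrier H_carrier h by (intro mat_sum_smult) auto
  also have "mat_sum d (\<lambda>t. ?F (h \<otimes> t)) H = mat_sum d ?F H"
    by (rule mat_sum_reindex[OF bij_left_H[OF h]])
  finally show ?thesis
    using rep_carrier[OF H_carrier[OF h]]
    by (simp add: proj_def mat_smult[of _ d] smult_smult_times mult.commute)
qed

lemma proj_rho: assumes h: "h \<in> H" shows "proj d \<rho> * \<rho> h = \<epsilon> h \<cdot>\<^sub>m proj d \<rho>"
proof -
  let ?F = "\<lambda>t. \<epsilon> t \<cdot>\<^sub>m \<rho> t"
  have "mat_sum d ?F H * \<rho> h = mat_sum d (\<lambda>t. ?F t * \<rho> h) H"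
    using rep_carrier H_carrier h by (intro mat_sum_mult_right) auto
  also have "\<dots> = mat_sum d (\<lambda>t. \<epsilon> h \<cdot>\<^sub>m ?F (t \<otimes> h)) H"
  proof (rule mat_sum_cong)
    fix t assume t: "t \<in> H"
    have "\<epsilon> h * \<epsilon> (t \<otimes> h) = \<epsilon> t" using sign_square[OF h] mult[OF t h] by (simp add: mult.left_commute)
    then show "?F t * \<rho> h = \<epsilon> h \<cdot>\<^sub>m ?F (t \<otimes> h)"
      using rep_carrier h t H_carrier rep_mult by (simp add: mat_smult[of _ d] smult_smult_times)
  qed
  also have "\<dots> = \<epsilon> h \<cdot>\<^sub>m mat_sum d (\<lambda>t. ?F (t \<otimes> h)) H"
    using rep_carrier H_carrier h subgroup.m_closed[OF sub] by (intro mat_sum_smult) auto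
  also have "mat_sum d (\<lambda>t. ?F (t \<otimes> h)) H = mat_sum d ?F H"
    by (rule mat_sum_reindex[OF bij_right_H[OF h]])
  finally show ?thesis
    using rep_carrier[OF H_carrier[OF h]]
    by (simp add: proj_def mat_smult[of _ d] smult_smult_times mult.commute)
qed

lemma smult_average:
  "M \<in> carrier_mat d d \<Longrightarrow> (1 / of_nat (card H)) \<cdot>\<^sub>m (of_nat (card H) \<cdot>\<^sub>m M) = (M :: complex mat)"
  using card_H by (simp add: smult_smult_times) (rule eq_matI, auto)

lemma proj_mult_average:
  assumes M: "M \<in> carrier_mat d d"
  shows "M * proj d \<rho> = (1 / of_nat (card H)) \<cdot>\<^sub>m mat_sum d (\<lambda>h. \<epsilon> h \<cdot>\<^sub>m (M * \<rho> h)) H"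
proof -
  have "M * mat_sum d (\<lambda>h. \<epsilon> h \<cdot>\<^sub>m \<rho> h) H = mat_sum d (\<lambda>h. M * (\<epsilon> h \<cdot>\<^sub>m \<rho> h)) H"
    using rep_carrier H_carrier M by (intro mat_sum_mult_left) auto
  also have "\<dots> = mat_sum d (\<lambda>h. \<epsilon> h \<cdot>\<^sub>m (M * \<rho> h)) H"
    using rep_carrier H_carrier M by (intro mat_sum_cong) (simp add: mat_smult[of _ d])
  finally show ?thesis using M by (simp add: proj_def mat_smult[of _ d])
qed

lemma proj_idem: "proj d \<rho> * proj d \<rho> = proj d \<rho>"
proof -
  have "mat_sum d (\<lambda>h. \<epsilon> h \<cdot>\<^sub>m (proj d \<rho> * \<rho> h)) H = mat_sum d (\<lambda>h. 1 \<cdot>\<^sub>m proj d \<rho>) H"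
    by (intro mat_sum_cong) (simp add: proj_rho smult_smult_times sign_square)
  also have "\<dots> = of_nat (card H) \<cdot>\<^sub>m proj d \<rho>"
    by (subst mat_sum_scalars[of _ d]) auto
  finally show ?thesis by (simp add: proj_mult_average smult_average)
qed

lemma trace_proj_mult:
  assumes M: "M \<in> carrier_mat d d"
  shows "trace (M * proj d \<rho>) = (\<Sum>h\<in>H. \<epsilon> h * trace (M * \<rho> h)) / of_nat (card H)"
proof -
  have c: "M * \<rho> h \<in> carrier_mat d d" if "h \<in> H" for h
    using M rep_carrier[OF H_carrier[OF that]] by (rule mat_closed)
  show ?thesis
    using M c by (simp add: proj_mult_average trace_smult[of _ d] trace_mat_sum[of _ _ d] mat_closed)
qed

lemma trace_proj: "trace (proj d \<rho>) = (\<Sum>h\<in>H. \<epsilon> h * trace (\<rho> h)) / of_nat (card H)"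
  using rep_carrier H_carrier by (simp add: proj_def trace_smult[of _ d] trace_mat_sum[of _ _ d])

text \<open>Frobenius reciprocity: after exchanging the sums over g and t, conjugation by t matches
  the contributing g with \<open>H\<close>. The conjugate on the right appears because
  \<open>char_inner\<close> conjugates its second argument.\<close>

lemma char_inner_induced:
  assumes \<chi>: "\<And>g. g \<in> carrier G \<Longrightarrow> \<chi> g = trace (\<rho> g)"
    and \<phi>: "\<And>h. h \<in> H \<Longrightarrow> \<phi> h = \<epsilon> h"
  shows "char_inner G (induced_char G H \<phi>) \<chi> = cnj (trace (proj d \<rho>))"
proof -
  let ?n = "of_nat (card (carrier G)) :: complex" and ?m = "of_nat (card H) :: complex"
  have n: "?n \<noteq> 0" using fin by (auto simp: card_eq_0_iff)
  define c where "c t g = (if inv t \<otimes> g \<otimes> t \<in> H then \<epsilon> (inv t \<otimes> g \<otimes> t) else 0)" for t g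
  have ind: "induced_char G H \<phi> g = (\<Sum>t\<in>carrier G. c t g) / ?m" if "g \<in> carrier G" for g
    unfolding induced_char_def c_def using fin \<phi>
    by (subst sum.inter_filter[symmetric]) (auto intro!: arg_cong2[of _ _ _ _ "(/)"] sum.cong)
  have conj: "(\<Sum>g\<in>carrier G. c t g * cnj (\<chi> g)) = (\<Sum>h\<in>H. \<epsilon> h * cnj (trace (\<rho> h)))"
    if t: "t \<in> carrier G" for t
  proof -
    have "(\<Sum>g\<in>carrier G. c t g * cnj (\<chi> g)) = (\<Sum>g\<in>{g\<in>carrier G. inv t \<otimes> g \<otimes> t \<in> H}.
        \<epsilon> (inv t \<otimes> g \<otimes> t) * cnj (trace (\<rho> (inv t \<otimes> g \<otimes> t))))"
      using fin t \<chi>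
      by (subst sum.inter_filter) (auto simp: c_def trace_conj[OF G.group_axioms r] intro!: sum.cong)
    also have "\<dots> = (\<Sum>h\<in>H. \<epsilon> h * cnj (trace (\<rho> h)))"
      by (rule sum.reindex_bij_witness[of _ "\<lambda>h. t \<otimes> h \<otimes> inv t" "\<lambda>g. inv t \<otimes> g \<otimes> t"])
        (use t H_carrier in \<open>auto simp: G.m_assoc\<close>, use t H_carrier in \<open>auto simp: G.m_assoc[symmetric]\<close>)
    finally show ?thesis .
  qed
  have "char_inner G (induced_char G H \<phi>) \<chi> =
      (\<Sum>g\<in>carrier G. \<Sum>t\<in>carrier G. c t g * cnj (\<chi> g)) / ?m / ?n"
    by (simp add: char_inner_def ind sum_distrib_right sum_divide_distrib)
  also have "\<dots> = (\<Sum>h\<in>H. \<epsilon> h * cnj (trace (\<rho> h))) / ?m"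
    using n by (subst sum.swap) (simp add: conj)
  also have "\<dots> = cnj (trace (proj d \<rho>))"
    by (simp add: trace_proj sign_cnj)
  finally show ?thesis .
qed

end
end

context
  fixes G :: "('g, 'm) monoid_scheme" (structure)
  assumes G: "group G"
begin

text \<open>This is \<open>schur_average\<close> for the matrix unit with its 1 at (j, b), read off
  at entry (i, a).\<close>

lemma schur_orthogonality:
  assumes fin: "finite (carrier G)" and irr: "irreducible_representation G d \<rho>"
    and ij: "i < d" "j < d" "a < d" "b < d"
  shows "(\<Sum>g\<in>carrier G. \<rho> g $$ (i, j) * \<rho> (inv g) $$ (b, a)) =
    (if j = b \<and> i = a then of_nat (card (carrier G)) / of_nat d else 0)"
proof -
  interpret G: group G by (rule G)
  have r: "representation G d \<rho>" using irr by (auto simp: irreducible_representation_def)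
  note c = representationD(1)[OF G r]
  define E :: "complex mat" where "E = mat d d (\<lambda>(u, v). if u = j \<and> v = b then 1 else 0)"
  have E: "E \<in> carrier_mat d d" by (simp add: E_def)
  have e: "(\<rho> g * E * \<rho> (inv g)) $$ (i, a) = \<rho> g $$ (i, j) * \<rho> (inv g) $$ (b, a)"
    if g: "g \<in> carrier G" for g
  proof -
    have 1: "(\<rho> g * E) $$ (i, l) = (if l = b then \<rho> g $$ (i, j) else 0)" if "l < d" for l
    proof -
      have "(\<rho> g * E) $$ (i, l) = (\<Sum>u<d. if u = j then (if l = b then \<rho> g $$ (i, j) else 0) else 0)"
        unfolding index_mult_mat_sum[OF c[OF g] E ij(1) that] using that
        by (intro sum.cong) (auto simp: E_def)
      then show ?thesis using ij by (simp add: sum.delta)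
    qed
    have "(\<rho> g * E * \<rho> (inv g)) $$ (i, a) = (\<Sum>l<d. (\<rho> g * E) $$ (i, l) * \<rho> (inv g) $$ (l, a))"
      using c g E ij by (intro index_mult_mat_sum[of _ d d _ d]) (simp_all add: mat_closed)
    also have "\<dots> = (\<Sum>l<d. if l = b then \<rho> g $$ (i, j) * \<rho> (inv g) $$ (b, a) else 0)"
      using 1 by (intro sum.cong) (auto simp del: index_mult_mat)
    finally have "(\<rho> g * E * \<rho> (inv g)) $$ (i, a) =
        (\<Sum>l<d. if l = b then \<rho> g $$ (i, j) * \<rho> (inv g) $$ (b, a) else 0)" .
    then show ?thesis using ij by (simp add: sum.delta)
  qed
  have "trace E = (\<Sum>u<d. if u = j then if j = b then 1 else 0 else 0)"
    unfolding trace_eq_sum[OF E] by (intro sum.cong) (auto simp: E_def)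
  then have tr: "trace E = (if j = b then 1 else 0)" using ij by (simp add: sum.delta)
  have "(\<Sum>g\<in>carrier G. \<rho> g $$ (i, j) * \<rho> (inv g) $$ (b, a)) =
      mat_sum d (\<lambda>g. \<rho> g * E * \<rho> (inv g)) (carrier G) $$ (i, a)"
    using ij by (simp add: mat_sum_index e del: index_mult_mat)
  then show ?thesis
    using ij by (simp add: schur_average[OF G fin irr E] tr)
qed

text \<open>Fourier inversion inside one irreducible block: expanding the trace entrywise,
  orthogonality retains only the entry (i, j) of \<open>M\<close>.\<close>

lemma inverse_fourier:
  assumes fin: "finite (carrier G)" and irr: "irreducible_representation G d \<rho>"
    and M: "M \<in> carrier_mat d d"
  shows "mat_sum d (\<lambda>g. trace (M * \<rho> (inv g)) \<cdot>\<^sub>m \<rho> g) (carrier G) =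
    (of_nat (card (carrier G)) / of_nat d) \<cdot>\<^sub>m M"
proof -
  interpret G: group G by (rule G)
  have r: "representation G d \<rho>" using irr by (auto simp: irreducible_representation_def)
  note c = representationD(1)[OF G r]
  let ?c = "of_nat (card (carrier G)) / of_nat d :: complex"
  show ?thesis
  proof (rule eq_matI)
    fix i j assume "i < dim_row (?c \<cdot>\<^sub>m M)" "j < dim_col (?c \<cdot>\<^sub>m M)"
    then have ij: "i < d" "j < d" using M by auto
    have t: "trace (M * \<rho> (inv g)) = (\<Sum>a<d. \<Sum>b<d. M $$ (a, b) * \<rho> (inv g) $$ (b, a))"
      if "g \<in> carrier G" for g
      using M c[of "inv g"] that
      by (subst trace_eq_sum[of _ d])
        (auto simp: mult_carrier_mat[of _ d d] index_mult_mat_sum[of _ d d _ d] simp del: index_mult_mat)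
    have "mat_sum d (\<lambda>g. trace (M * \<rho> (inv g)) \<cdot>\<^sub>m \<rho> g) (carrier G) $$ (i, j) =
        (\<Sum>g\<in>carrier G. (\<Sum>a<d. \<Sum>b<d. M $$ (a, b) * (\<rho> g $$ (i, j) * \<rho> (inv g) $$ (b, a))))"
      using ij c by (auto simp: mat_sum_index t sum_distrib_right sum_distrib_left carrier_matD[of _ d d]
          mult_ac intro!: sum.cong)
    also have "\<dots> = (\<Sum>a<d. \<Sum>b<d. M $$ (a, b) *
        (\<Sum>g\<in>carrier G. \<rho> g $$ (i, j) * \<rho> (inv g) $$ (b, a)))"
      by (subst sum.swap, rule sum.cong, simp, subst sum.swap) (simp add: sum_distrib_left)
    also have "\<dots> = (\<Sum>a<d. \<Sum>b<d. if b = j then (if a = i then M $$ (i, j) * ?c else 0) else 0)"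
      using ij by (intro sum.cong refl) (auto simp: schur_orthogonality[OF fin irr])
    also have "\<dots> = M $$ (i, j) * ?c"
      using ij by (simp add: sum.delta)
    finally show "mat_sum d (\<lambda>g. trace (M * \<rho> (inv g)) \<cdot>\<^sub>m \<rho> g) (carrier G) $$ (i, j) = (?c \<cdot>\<^sub>m M) $$ (i, j)"
      using ij M by simp
  qed (use M in auto)
qed

end

section \<open>Compressions e g e, and multiplicity-freeness from symmetric double cosets\<close>

context sign_character
begin

text \<open>The combinatorial form of e g e = e g^-1 e: the first alternative makes e g e equal to
  its own negative, hence zero, and the second identifies the two sides with the right sign.\<close>

definition symmetric_double_coset :: "'g \<Rightarrow> bool"
  where "symmetric_double_coset g \<longleftrightarrow>
    (\<exists>h\<in>H. \<exists>h'\<in>H. h \<otimes> g \<otimes> h' = g \<and> \<epsilon> h * \<epsilon> h' = -1) \<or>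
    (\<exists>h\<in>H. \<exists>h'\<in>H. h \<otimes> g \<otimes> h' = inv g \<and> \<epsilon> h * \<epsilon> h' = 1)"

context
  fixes d \<rho>
  assumes r: "representation G d \<rho>"
begin

abbreviation (input) "compression \<equiv> \<lambda>g. proj d \<rho> * \<rho> g * proj d \<rho>"

lemma compression_carrier: "g \<in> carrier G \<Longrightarrow> compression g \<in> carrier_mat d d"
  using rep_carrier[OF r] by (simp add: mat_closed)

lemma compression_double_coset:
  assumes "g \<in> carrier G" "h \<in> H" "h' \<in> H"
  shows "compression (h \<otimes> g \<otimes> h') = (\<epsilon> h * \<epsilon> h') \<cdot>\<^sub>m compression g"
proof -
  note c = rep_carrier[OF r] H_carrier
  have "compression (h \<otimes> g \<otimes> h') = (proj d \<rho> * \<rho> h) * \<rho> g * (\<rho> h' * proj d \<rho>)"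
    using assms c by (simp add: rep_mult[OF r] mat_closed mat_assoc[of _ d])
  also have "\<dots> = (\<epsilon> h * \<epsilon> h') \<cdot>\<^sub>m compression g"
    using assms c by (simp add: rho_proj[OF r] proj_rho[OF r] mat_closed mat_assoc[of _ d] smult_smult_times mult.commute
        mat_smult[of _ d])
  finally show ?thesis .
qed

lemma compression_inv:
  assumes g: "g \<in> carrier G" and "symmetric_double_coset g"
  shows "compression (inv g) = compression g"
  using assms(2) unfolding symmetric_double_coset_def
proof (elim disjE bexE conjE)
  fix h h' assume h: "h \<in> H" "h' \<in> H" "h \<otimes> g \<otimes> h' = inv g" "\<epsilon> h * \<epsilon> h' = 1"
  have "1 \<cdot>\<^sub>m compression g = compression g" by (rule eq_matI) auto
  then show ?thesis using compression_double_coset[OF g h(1,2)] h(3,4) by simp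
next
  fix h h' assume h: "h \<in> H" "h' \<in> H" "h \<otimes> g \<otimes> h' = g" "\<epsilon> h * \<epsilon> h' = -1"
  have zero: "M = 0\<^sub>m d d" if "M = (- 1) \<cdot>\<^sub>m M" "M \<in> carrier_mat d d" for M :: "complex mat"
  proof (rule eq_matI)
    fix i j assume "i < dim_row (0\<^sub>m d d)" "j < dim_col (0\<^sub>m d d)"
    then show "M $$ (i, j) = 0\<^sub>m d d $$ (i, j)"
      using that(2) arg_cong[OF that(1), of "\<lambda>M. M $$ (i, j)"] by (simp add: eq_neg_iff_add_eq_0)
  qed (use that in auto)
  \<comment> \<open>Inverting h g h' = g gives a relation of sign -1 for g^-1 as well, so both
    compressions vanish.\<close>
  have "inv (h \<otimes> g \<otimes> h') = inv h' \<otimes> inv g \<otimes> inv h"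
    using h(1,2) g H_carrier by (simp add: G.inv_mult_group G.m_assoc)
  then have "compression (inv g) = (\<epsilon> (inv h') * \<epsilon> (inv h)) \<cdot>\<^sub>m compression (inv g)"
    using compression_double_coset[of "inv g" "inv h'" "inv h"] g h subgroup.m_inv_closed[OF sub] by simp
  then have "compression (inv g) = 0\<^sub>m d d"
    using h by (intro zero compression_carrier) (auto simp: sign_inverse mult.commute g)
  moreover have "compression g = 0\<^sub>m d d"
    using compression_double_coset[OF g h(1,2)] h(3,4) by (intro zero compression_carrier) (auto simp: g)
  ultimately show ?thesis by simp
qed

text \<open>The two inner projections merge into one; expanding that one as an average over
  \<open>H\<close> leaves compressions of single group elements, to which
  \<open>compression_inv\<close> applies.\<close>

lemma compression_mult:
  assumes "g \<in> carrier G" "g' \<in> carrier G"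
  shows "compression g * compression g' = (1 / of_nat (card H)) \<cdot>\<^sub>m mat_sum d (\<lambda>h. \<epsilon> h \<cdot>\<^sub>m compression (g \<otimes> h \<otimes> g')) H"
proof -
  note c = rep_carrier[OF r] H_carrier
  have "compression g * compression g' = proj d \<rho> * \<rho> g * (proj d \<rho> * proj d \<rho>) * \<rho> g' * proj d \<rho>"
    using assms c by (simp add: mat_closed mat_assoc[of _ d])
  also have "\<dots> = ((proj d \<rho> * \<rho> g) * proj d \<rho>) * (\<rho> g' * proj d \<rho>)"
    unfolding proj_idem[OF r] using assms c by (simp add: mat_closed mat_assoc[of _ d])
  also have "\<dots> = (1 / of_nat (card H)) \<cdot>\<^sub>m mat_sum d (\<lambda>h. \<epsilon> h \<cdot>\<^sub>m (proj d \<rho> * \<rho> g * \<rho> h)) H * (\<rho> g' * proj d \<rho>)"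
    using assms c by (subst proj_mult_average[OF r]) (simp_all add: mat_closed)
  also have "\<dots> = (1 / of_nat (card H)) \<cdot>\<^sub>m (mat_sum d (\<lambda>h. \<epsilon> h \<cdot>\<^sub>m (proj d \<rho> * \<rho> g * \<rho> h)) H * (\<rho> g' * proj d \<rho>))"
    using assms c by (simp add: mat_smult[of _ d] mat_closed)
  also have "mat_sum d (\<lambda>h. \<epsilon> h \<cdot>\<^sub>m (proj d \<rho> * \<rho> g * \<rho> h)) H * (\<rho> g' * proj d \<rho>)
      = mat_sum d (\<lambda>h. (\<epsilon> h \<cdot>\<^sub>m (proj d \<rho> * \<rho> g * \<rho> h)) * (\<rho> g' * proj d \<rho>)) H"
    using assms c by (intro mat_sum_mult_right) (simp_all add: mat_closed)
  also have "\<dots> = mat_sum d (\<lambda>h. \<epsilon> h \<cdot>\<^sub>m compression (g \<otimes> h \<otimes> g')) H"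
    using assms c by (intro mat_sum_cong) (simp add: mat_closed mat_assoc[of _ d] rep_mult[OF r] mat_smult[of _ d])
  finally show ?thesis .
qed

lemma compression_commute:
  assumes sym: "\<And>g. g \<in> carrier G \<Longrightarrow> symmetric_double_coset g"
    and g: "g \<in> carrier G" "g' \<in> carrier G"
  shows "compression g * compression g' = compression g' * compression g"
proof -
  have "compression g' * compression g = compression (inv g') * compression (inv g)"
    using compression_inv sym g by simp
  also have "\<dots> = (1 / of_nat (card H)) \<cdot>\<^sub>m mat_sum d (\<lambda>h. \<epsilon> h \<cdot>\<^sub>m compression (inv g' \<otimes> h \<otimes> inv g)) H"
    using g by (intro compression_mult) auto
  \<comment> \<open>Replacing h by its inverse turns the argument into the inverse of g h g', and
    compressions are unchanged under inversion.\<close>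
  also have "mat_sum d (\<lambda>h. \<epsilon> h \<cdot>\<^sub>m compression (inv g' \<otimes> h \<otimes> inv g)) H =
      mat_sum d (\<lambda>h. \<epsilon> (inv h) \<cdot>\<^sub>m compression (inv g' \<otimes> inv h \<otimes> inv g)) H"
    by (rule mat_sum_reindex[OF bij_inv_H, symmetric])
  also have "\<dots> = mat_sum d (\<lambda>h. \<epsilon> h \<cdot>\<^sub>m compression (g \<otimes> h \<otimes> g')) H"
  proof (rule mat_sum_cong)
    fix h assume h: "h \<in> H"
    have "inv g' \<otimes> inv h \<otimes> inv g = inv (g \<otimes> h \<otimes> g')"
      using h g H_carrier by (simp add: G.inv_mult_group G.m_assoc)
    then show "\<epsilon> (inv h) \<cdot>\<^sub>m compression (inv g' \<otimes> inv h \<otimes> inv g) = \<epsilon> h \<cdot>\<^sub>m compression (g \<otimes> h \<otimes> g')"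
      using h g H_carrier compression_inv[OF _ sym, of "g \<otimes> h \<otimes> g'"] by (simp add: sign_inverse)
  qed
  also have "(1 / of_nat (card H)) \<cdot>\<^sub>m \<dots> = compression g * compression g'"
    using compression_mult[OF g] by simp
  finally show ?thesis by simp
qed

end

text \<open>
  The compressions commute, so the double sums of
  \<open>P \<rho>(g) P \<rho>(g') P \<rho>(g'\<^sup>-\<^sup>1) \<rho>(g\<^sup>-\<^sup>1)\<close> with the first two factors in either order agree.
  Schur orthogonality evaluates them to \<open>(tr P)\<^sup>2 P\<close> and \<open>P\<close>, up to the same scalar.
\<close>

lemma trace_proj_symmetric:
  assumes irr: "irreducible_representation G d \<rho>"
    and sym: "\<And>g. g \<in> carrier G \<Longrightarrow> symmetric_double_coset g"
  shows "trace (proj d \<rho>) \<in> {-1, 0, 1}"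
proof -
  have r: "representation G d \<rho>" and d: "d > 0"
    using irr by (auto simp: irreducible_representation_def)
  let ?P = "proj d \<rho>" and ?G = "carrier G"
  let ?c = "of_nat (card (carrier G)) / of_nat d :: complex"
  have c0: "?c \<noteq> 0" using d fin by (auto simp: card_eq_0_iff)
  let ?B = "\<lambda>g. ?P * \<rho> g * ?P"
  let ?T = "mat_sum d (\<lambda>g. mat_sum d (\<lambda>g'. (?B g * ?B g') * (\<rho> (inv g') * \<rho> (inv g))) ?G) ?G"
  note c = rep_carrier[OF r] and C = mat_closed mat_assoc[of _ d]
  have av: "mat_sum d (\<lambda>g. \<rho> g * M * \<rho> (inv g)) ?G = (?c * trace M) \<cdot>\<^sub>m 1\<^sub>m d"
    if "M \<in> carrier_mat d d" for M
    using schur_average[OF G.group_axioms fin irr that] by simp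
  have avl: "mat_sum d (\<lambda>g. A * (\<rho> g * M * \<rho> (inv g))) ?G = (?c * trace M) \<cdot>\<^sub>m A"
    if "M \<in> carrier_mat d d" "A \<in> carrier_mat d d" for M A
    using that c by (subst mat_sum_mult_left[symmetric]) (simp_all add: av C mat_smult[of _ d])
  have "?T
      = mat_sum d (\<lambda>g. (?c * trace ?P) \<cdot>\<^sub>m (?P * (\<rho> g * ?P * \<rho> (inv g)))) ?G"
  proof (rule mat_sum_cong)
    fix g assume g: "g \<in> ?G"
    have "mat_sum d (\<lambda>g'. (?B g * ?B g') * (\<rho> (inv g') * \<rho> (inv g))) ?G =
        mat_sum d (\<lambda>g'. (?B g * (\<rho> g' * ?P * \<rho> (inv g'))) * \<rho> (inv g)) ?G"
    proof (rule mat_sum_cong)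
      fix g' assume g': "g' \<in> ?G"
      have "?B g * ?B g' = ?P * \<rho> g * (?P * ?P) * \<rho> g' * ?P"
        using g g' c by (simp add: C)
      then show "(?B g * ?B g') * (\<rho> (inv g') * \<rho> (inv g)) =
          (?B g * (\<rho> g' * ?P * \<rho> (inv g'))) * \<rho> (inv g)"
        using g g' c by (simp add: C proj_idem[OF r])
    qed
    also have "\<dots> = mat_sum d (\<lambda>g'. ?B g * (\<rho> g' * ?P * \<rho> (inv g'))) ?G * \<rho> (inv g)"
      using g c by (intro mat_sum_mult_right[symmetric]) (simp_all add: mat_closed)
    also have "\<dots> = (?c * trace ?P) \<cdot>\<^sub>m ?B g * \<rho> (inv g)"
      using g c by (subst avl) (simp_all add: mat_closed)
    also have "\<dots> = (?c * trace ?P) \<cdot>\<^sub>m (?P * (\<rho> g * ?P * \<rho> (inv g)))"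
      using g c by (simp add: C mat_smult[of _ d])
    finally show "mat_sum d (\<lambda>g'. (?B g * ?B g') * (\<rho> (inv g') * \<rho> (inv g))) ?G =
        (?c * trace ?P) \<cdot>\<^sub>m (?P * (\<rho> g * ?P * \<rho> (inv g)))" .
  qed
  also have "\<dots> = (?c * trace ?P) \<cdot>\<^sub>m ((?c * trace ?P) \<cdot>\<^sub>m ?P)"
    using c by (subst mat_sum_smult) (simp_all add: mat_closed avl)
  finally have 1: "?T =
      (?c * trace ?P) \<cdot>\<^sub>m ((?c * trace ?P) \<cdot>\<^sub>m ?P)" .
  have "?T =
      mat_sum d (\<lambda>g. mat_sum d (\<lambda>g'. (?B g' * ?B g) * (\<rho> (inv g') * \<rho> (inv g))) ?G) ?G"
    by (intro mat_sum_cong) (simp add: compression_commute[OF r sym])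
  also have "\<dots> = mat_sum d (\<lambda>g'. mat_sum d (\<lambda>g. (?B g' * ?B g) * (\<rho> (inv g') * \<rho> (inv g))) ?G) ?G"
    by (rule mat_sum_swap)
  also have "\<dots> = mat_sum d (\<lambda>g'. ?P * (?c \<cdot>\<^sub>m (trace (?P * \<rho> (inv g')) \<cdot>\<^sub>m \<rho> g')) * ?P) ?G"
  proof (rule mat_sum_cong)
    fix g' assume g': "g' \<in> ?G"
    have "mat_sum d (\<lambda>g. (?B g' * ?B g) * (\<rho> (inv g') * \<rho> (inv g))) ?G =
        mat_sum d (\<lambda>g. ?B g' * (\<rho> g * (?P * \<rho> (inv g')) * \<rho> (inv g))) ?G"
    proof (rule mat_sum_cong)
      fix g assume g: "g \<in> ?G"
      have "?B g' * ?B g = ?P * \<rho> g' * (?P * ?P) * \<rho> g * ?P"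
        using g g' c by (simp add: C)
      then show "(?B g' * ?B g) * (\<rho> (inv g') * \<rho> (inv g)) =
          ?B g' * (\<rho> g * (?P * \<rho> (inv g')) * \<rho> (inv g))"
        using g g' c by (simp add: C proj_idem[OF r])
    qed
    also have "\<dots> = (?c * trace (?P * \<rho> (inv g'))) \<cdot>\<^sub>m ?B g'"
      using g' c by (intro avl) (simp_all add: mat_closed)
    also have "\<dots> = ?P * (?c \<cdot>\<^sub>m (trace (?P * \<rho> (inv g')) \<cdot>\<^sub>m \<rho> g')) * ?P"
      using g' c by (simp add: C smult_smult_times mat_smult[of _ d])
    finally show "mat_sum d (\<lambda>g. (?B g' * ?B g) * (\<rho> (inv g') * \<rho> (inv g))) ?G =
        ?P * (?c \<cdot>\<^sub>m (trace (?P * \<rho> (inv g')) \<cdot>\<^sub>m \<rho> g')) * ?P" .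
  qed
  also have "\<dots> = mat_sum d (\<lambda>g'. ?P * (?c \<cdot>\<^sub>m (trace (?P * \<rho> (inv g')) \<cdot>\<^sub>m \<rho> g'))) ?G * ?P"
    using c by (intro mat_sum_mult_right[symmetric]) (simp_all add: mat_closed)
  also have "mat_sum d (\<lambda>g'. ?P * (?c \<cdot>\<^sub>m (trace (?P * \<rho> (inv g')) \<cdot>\<^sub>m \<rho> g'))) ?G =
      ?P * mat_sum d (\<lambda>g'. ?c \<cdot>\<^sub>m (trace (?P * \<rho> (inv g')) \<cdot>\<^sub>m \<rho> g')) ?G"
    using c by (intro mat_sum_mult_left[symmetric]) (simp_all add: mat_closed)
  also have "mat_sum d (\<lambda>g'. ?c \<cdot>\<^sub>m (trace (?P * \<rho> (inv g')) \<cdot>\<^sub>m \<rho> g')) ?G = ?c \<cdot>\<^sub>m (?c \<cdot>\<^sub>m ?P)"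
    using c by (subst mat_sum_smult) (simp_all add: mat_closed inverse_fourier[OF G.group_axioms fin irr])
  also have "?P * (?c \<cdot>\<^sub>m (?c \<cdot>\<^sub>m ?P)) * ?P = (?c * ?c) \<cdot>\<^sub>m ?P"
    by (simp add: smult_smult_times mat_smult[of _ d]
        proj_idem[OF r])
  finally have "(?c * ?c) \<cdot>\<^sub>m ?P = (?c * trace ?P) \<cdot>\<^sub>m ((?c * trace ?P) \<cdot>\<^sub>m ?P)"
    using 1 by simp
  then have "trace ((?c * ?c) \<cdot>\<^sub>m ?P) = trace ((?c * trace ?P * (?c * trace ?P)) \<cdot>\<^sub>m ?P)"
    by (simp add: smult_smult_times)
  then have "?c * ?c * trace ?P = ?c * ?c * (trace ?P * trace ?P * trace ?P)"
    by (simp add: trace_smult[of _ d] algebra_simps)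
  \<comment> \<open>All three roots of t = t^3 are at most 1, which is what multiplicity-freeness
    asks.\<close>
  then have "trace ?P = trace ?P * trace ?P * trace ?P"
    using c0 by (metis mult_left_cancel mult_eq_0_iff)
  then have "trace ?P * (trace ?P - 1) * (trace ?P + 1) = 0"
    by (simp add: algebra_simps)
  then show ?thesis by (auto simp: eq_neg_iff_add_eq_0)
qed

theorem multiplicity_free_if_symmetric:
  assumes sym: "\<And>g. g \<in> carrier G \<Longrightarrow> symmetric_double_coset g"
    and \<phi>: "\<And>h. h \<in> H \<Longrightarrow> \<phi> h = \<epsilon> h"
  shows "multiplicity_free G (induced_char G H \<phi>)"
  unfolding multiplicity_free_def irreducible_character_def
proof (intro allI impI, elim exE conjE)
  fix \<chi> d \<rho>
  assume irr: "irreducible_representation G d \<rho>" and \<chi>: "\<forall>g\<in>carrier G. \<chi> g = trace (\<rho> g)"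
  then have "char_inner G (induced_char G H \<phi>) \<chi> = cnj (trace (proj d \<rho>))"
    using \<phi> by (intro char_inner_induced) (auto simp: irreducible_representation_def)
  then show "char_inner G (induced_char G H \<phi>) \<chi> \<le> 1"
    using trace_proj_symmetric[OF irr sym] by (auto simp: less_eq_complex_def)
qed

end

section \<open>Decomposition into irreducible characters\<close>

lemma mult_vec_in_subspace:
  fixes U :: "complex mat"
  assumes W: "VectorSpace.subspace class_ring W (module_vec TYPE(complex) d)"
    and U: "U \<in> carrier_mat d r" "\<And>j. j < r \<Longrightarrow> col U j \<in> W" and x: "x \<in> carrier_vec r"
  shows "U *\<^sub>v x \<in> W"
proof -
  note s = subspaceD[OF W]
  have "vec d (\<lambda>a. \<Sum>j<k. U $$ (a, j) * x $ j) \<in> W" if "k \<le> r" for k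
    using that
  proof (induction k)
    case 0
    have "vec d (\<lambda>a. \<Sum>j<0. U $$ (a, j) * x $ j) = 0\<^sub>v d" by (rule eq_vecI) auto
    then show ?case using s(2) by simp
  next
    case (Suc k)
    have "vec d (\<lambda>a. \<Sum>j<Suc k. U $$ (a, j) * x $ j) =
        vec d (\<lambda>a. \<Sum>j<k. U $$ (a, j) * x $ j) + x $ k \<cdot>\<^sub>v col U k"
      using Suc.prems U(1) by (intro eq_vecI) auto
    then show ?case using Suc U s(3,4) by simp
  qed
  from this[of r] show ?thesis
    using U(1) x by (simp add: mult_mat_vec_def scalar_prod_def atLeast0LessThan row_def)
qed

lemma index_mult_mat_vec_sum:
  "A \<in> carrier_mat n m \<Longrightarrow> x \<in> carrier_vec m \<Longrightarrow> i < n \<Longrightarrow>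
    (A *\<^sub>v x) $ i = (\<Sum>b<m. A $$ (i, b) * x $ b)"
  by (simp add: scalar_prod_def atLeast0LessThan)

text \<open>The matrix 1 - U V is idempotent of trace d - r, and by \<open>idempotent_trace\<close>
  the trace of an idempotent is a natural number.\<close>

lemma biorthogonal_rank_bound:
  fixes d r :: nat
  assumes "\<And>j k. j < r \<Longrightarrow> k < r \<Longrightarrow> (\<Sum>a<d. V j a * U a k) = (if j = k then 1 else 0 :: complex)"
  shows "r \<le> d"
proof -
  define P where "P a b = (if a = b then 1 else 0) - (\<Sum>j<r. U a j * V j b)" for a b
  have "(\<Sum>l<d. P a l * P l b) = P a b" if ab: "a < d" "b < d" for a b
  proof -
    have "(\<Sum>l<d. P a l * P l b) = (\<Sum>l<d. (if a = l then 1 else 0) * P l b)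
        - (\<Sum>l<d. \<Sum>j<r. U a j * V j l * P l b)"
      by (simp add: P_def[of a] algebra_simps sum_subtractf sum_distrib_left)
    also have "(\<Sum>l<d. (if a = l then 1 else 0) * P l b) = (\<Sum>l<d. if a = l then P l b else 0)"
      by (intro sum.cong) auto
    also have "\<dots> = P a b" using ab by (simp add: sum.delta)
    also have "(\<Sum>l<d. \<Sum>j<r. U a j * V j l * P l b) = (\<Sum>j<r. U a j * (\<Sum>l<d. V j l * P l b))"
      by (subst sum.swap) (simp add: sum_distrib_left mult.assoc)
    also have "(\<Sum>l<d. V j l * P l b) = 0" if j: "j < r" for j
    proof -
      have "(\<Sum>l<d. V j l * P l b) =
          (\<Sum>l<d. (if l = b then V j l else 0) - (\<Sum>k<r. V j l * U l k * V k b))"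
        by (intro sum.cong) (auto simp: P_def right_diff_distrib sum_distrib_left mult.assoc)
      also have "\<dots> = (\<Sum>l<d. if l = b then V j l else 0)
          - (\<Sum>l<d. \<Sum>k<r. V j l * U l k * V k b)"
        by (rule sum_subtractf)
      also have "(\<Sum>l<d. \<Sum>k<r. V j l * U l k * V k b) = (\<Sum>k<r. (\<Sum>l<d. V j l * U l k) * V k b)"
        by (subst sum.swap) (simp add: sum_distrib_right)
      also have "\<dots> = (\<Sum>k<r. if j = k then V k b else 0)"
        using assms j by (intro sum.cong) auto
      finally show ?thesis using ab j by (simp add: sum.delta)
    qed
    then have "(\<Sum>j<r. U a j * (\<Sum>l<d. V j l * P l b)) = 0" by simp
    finally show ?thesis by simp
  qed
  then obtain m :: nat where m: "(\<Sum>a<d. P a a) = of_nat m"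
    using idempotent_trace[of "{..<d}" P] by (metis finite_lessThan lessThan_iff)
  have "(\<Sum>a<d. P a a) = of_nat d - (\<Sum>j<r. \<Sum>a<d. V j a * U a j)"
    by (subst sum.swap) (simp add: P_def sum_subtractf mult.commute)
  also have "\<dots> = of_nat d - of_nat r" using assms by simp
  finally have "of_nat d = (of_nat (m + r) :: complex)" using m by simp
  then show ?thesis by (metis le_add2 of_nat_eq_iff)
qed

text \<open>The product \<open>U V\<close> is a projection onto \<open>W\<close>: take a biorthogonal pair of maximal size.\<close>

lemma subspace_factor:
  assumes W: "VectorSpace.subspace class_ring W (module_vec TYPE(complex) d)"
  shows "\<exists>r U V. U \<in> carrier_mat d r \<and> V \<in> carrier_mat r d \<and> V * U = 1\<^sub>m r \<and>
    (\<forall>j<r. col U j \<in> W) \<and> (\<forall>w\<in>W. U *\<^sub>v (V *\<^sub>v w) = w)"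
proof -
  note s = subspaceD[OF W]
  define R where "R r \<longleftrightarrow> (\<exists>U V. U \<in> carrier_mat d r \<and> V \<in> carrier_mat r d \<and> V * U = 1\<^sub>m r \<and>
    (\<forall>j<r. col U j \<in> W))" for r
  have bound: "r \<le> d" if Rr: "R r" for r
  proof -
    obtain U V :: "complex mat" where UV: "U \<in> carrier_mat d r" "V \<in> carrier_mat r d" "V * U = 1\<^sub>m r"
      using Rr by (auto simp: R_def)
    have "(\<Sum>a<d. V $$ (j, a) * U $$ (a, k)) = (if j = k then 1 else 0)" if "j < r" "k < r" for j k
      using index_mult_mat_sum[OF UV(2,1) that] that by (simp add: UV(3))
    then show ?thesis by (rule biorthogonal_rank_bound)
  qed
  have "R 0"
    unfolding R_def by (intro exI[of _ "mat d 0 (\<lambda>_. 0)"] exI[of _ "mat 0 d (\<lambda>_. 0)"]) auto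
  then have "R (GREATEST r. R r)" using bound by (rule GreatestI_nat)
  moreover have max: "\<not> R (Suc (GREATEST r. R r))"
    using Greatest_le_nat[of R _ d] bound by (metis Suc_n_not_le_n)
  ultimately obtain r U V where U: "U \<in> carrier_mat d r" "V \<in> carrier_mat r d" "V * U = 1\<^sub>m r"
    "\<And>j. j < r \<Longrightarrow> col U j \<in> W" and max: "\<not> R (Suc r)"
    unfolding R_def by blast
  have "U *\<^sub>v (V *\<^sub>v w) = w" if w: "w \<in> W" for w
  proof (rule ccontr)
    assume ne: "U *\<^sub>v (V *\<^sub>v w) \<noteq> w"
    have wd: "w \<in> carrier_vec d" using w s(1) by blast
    \<comment> \<open>\<open>u\<close> is a nonzero vector of \<open>W\<close> killed by
      \<open>V\<close>; it will become an extra column of \<open>U\<close>.\<close>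
    define u where "u = w + (-1) \<cdot>\<^sub>v (U *\<^sub>v (V *\<^sub>v w))"
    have ud: "u \<in> carrier_vec d" using wd U by (auto simp: u_def)
    have uW: "u \<in> W"
      unfolding u_def using U wd by (intro s(3,4) w mult_vec_in_subspace[OF W]) auto
    have Vu: "V *\<^sub>v u = 0\<^sub>v r"
    proof -
      have "V *\<^sub>v u = V *\<^sub>v w + (-1) \<cdot>\<^sub>v (V *\<^sub>v (U *\<^sub>v (V *\<^sub>v w)))"
        unfolding u_def using U wd
        by (simp add: mult_add_distrib_mat_vec[of _ r d] mult_mat_vec[of _ r d])
      also have "V *\<^sub>v (U *\<^sub>v (V *\<^sub>v w)) = V *\<^sub>v w"
        using U wd by (subst assoc_mult_mat_vec[symmetric, of _ r d _ r]) auto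
      finally show ?thesis using U wd by (auto intro!: eq_vecI)
    qed
    obtain i where i: "i < d" "u $ i \<noteq> 0"
    proof (rule ccontr)
      assume "\<not> thesis"
      then have "\<And>i. i < d \<Longrightarrow> u $ i = 0" using that by blast
      then have "w $ i = (U *\<^sub>v (V *\<^sub>v w)) $ i" if "i < d" for i
        using that U wd by (force simp: u_def)
      then have "U *\<^sub>v (V *\<^sub>v w) = w" using U wd by (intro eq_vecI) auto
      then show False using ne by simp
    qed
    \<comment> \<open>Row i of 1 - U V divided by \<open>u $ i\<close>: this functional vanishes on
      the columns of \<open>U\<close> and takes the value 1 at \<open>u\<close>, so it is the extra
      row of \<open>V\<close> that keeps the pair biorthogonal.\<close>
    define f where "f b = ((if i = b then 1 else 0) - (U * V) $$ (i, b)) / u $ i" for b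
    define U' where "U' = mat d (Suc r) (\<lambda>(a, j). if j < r then U $$ (a, j) else u $ a)"
    define V' where "V' = mat (Suc r) d (\<lambda>(j, b). if j < r then V $$ (j, b) else f b)"
    have c: "U' \<in> carrier_mat d (Suc r)" "V' \<in> carrier_mat (Suc r) d"
      by (auto simp: U'_def V'_def)
    have fx: "(\<Sum>b<d. f b * x $ b) = (x $ i - (U *\<^sub>v (V *\<^sub>v x)) $ i) / u $ i"
      if x: "x \<in> carrier_vec d" for x
    proof -
      have "(\<Sum>b<d. f b * x $ b) = ((\<Sum>b<d. if i = b then x $ b else 0)
          - (\<Sum>b<d. (U * V) $$ (i, b) * x $ b)) / u $ i"
        unfolding f_def sum_subtractf[symmetric] sum_divide_distrib
        by (intro sum.cong) (auto simp: diff_divide_distrib left_diff_distrib)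
      also have "(\<Sum>b<d. (U * V) $$ (i, b) * x $ b) = ((U * V) *\<^sub>v x) $ i"
        using U x i by (intro index_mult_mat_vec_sum[symmetric, of _ d d]) auto
      also have "(U * V) *\<^sub>v x = U *\<^sub>v (V *\<^sub>v x)"
        using U x by (intro assoc_mult_mat_vec) auto
      finally show ?thesis using i by (simp add: sum.delta)
    qed
    have "V' * U' = 1\<^sub>m (Suc r)"
    proof (rule eq_matI)
      fix j k assume "j < dim_row (1\<^sub>m (Suc r))" "k < dim_col (1\<^sub>m (Suc r))"
      then have jk: "j \<le> r" "k \<le> r" by auto
      have e: "(V' * U') $$ (j, k) = (\<Sum>a<d. V' $$ (j, a) * U' $$ (a, k))"
        using jk c by (intro index_mult_mat_sum) auto
      consider "j < r" "k < r" | "j < r" "k = r" | "j = r" "k < r" | "j = r" "k = r"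
        using jk by linarith
      then show "(V' * U') $$ (j, k) = 1\<^sub>m (Suc r) $$ (j, k)"
      proof cases
        case 1
        then have "(V' * U') $$ (j, k) = (V * U) $$ (j, k)"
          unfolding e index_mult_mat_sum[OF U(2,1) 1]
          by (intro sum.cong) (auto simp: V'_def U'_def)
        then show ?thesis using 1 by (simp add: U(3))
      next
        case 2
        then have "(V' * U') $$ (j, k) = (V *\<^sub>v u) $ j"
          unfolding e using U ud
          by (auto simp: V'_def U'_def scalar_prod_def atLeast0LessThan intro!: sum.cong)
        then show ?thesis using 2 by (simp add: Vu)
      next
        case 3
        have "(V' * U') $$ (j, k) = (\<Sum>b<d. f b * col U k $ b)"
          unfolding e using U 3 by (auto simp: V'_def U'_def intro!: sum.cong)
        also have "V *\<^sub>v col U k = unit_vec r k"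
        proof (rule eq_vecI)
          fix l assume "l < dim_vec (unit_vec r k)"
          then have l: "l < r" by simp
          have "(V *\<^sub>v col U k) $ l = (V * U) $$ (l, k)" using U(1,2) l 3 by simp
          then show "(V *\<^sub>v col U k) $ l = unit_vec r k $ l" using l 3 by (simp add: U(3) unit_vec_def)
        qed (use U in auto)
        then have "U *\<^sub>v (V *\<^sub>v col U k) = col U k"
          using U(1) 3 by (auto intro!: eq_vecI)
        then have "(\<Sum>b<d. f b * col U k $ b) = 0" using U 3 i by (subst fx) auto
        finally show ?thesis using 3 by simp
      next
        case 4
        have "(V' * U') $$ (j, k) = (\<Sum>b<d. f b * u $ b)"
          unfolding e using U 4 by (auto simp: V'_def U'_def intro!: sum.cong)
        also have "\<dots> = 1" using ud U i by (subst fx) (auto simp: Vu)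
        finally show ?thesis using 4 by simp
      qed
    qed (use c in auto)
    moreover have "col U' j \<in> W" if "j < Suc r" for j
    proof (cases "j < r")
      case True
      then have "col U' j = col U j" using U by (auto simp: U'_def intro!: eq_vecI)
      then show ?thesis using U(4)[OF True] by simp
    next
      case False
      then have "col U' j = u" using that ud by (auto simp: U'_def intro!: eq_vecI)
      then show ?thesis using uW by simp
    qed
    ultimately have "R (Suc r)" unfolding R_def using c by blast
    then show False using max by blast
  qed
  then show ?thesis using U by blast
qed

context
  fixes G :: "('g, 'm) monoid_scheme" (structure)
  assumes G: "group G"
begin

text \<open>The complement K = ker Q of \<open>W\<close> is not claimed to be invariant;
  \<open>\<rho>2\<close> is the quotient representation transported to K. In a basis adapted to W
  and K the matrices are block triangular, which suffices for additivity of traces.\<close>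

lemma invariant_subspace_split:
  assumes r: "representation G d \<rho>"
    and W: "VectorSpace.subspace class_ring W (module_vec TYPE(complex) d)"
    and inv: "\<And>g w. g \<in> carrier G \<Longrightarrow> w \<in> W \<Longrightarrow> \<rho> g *\<^sub>v w \<in> W"
    and ne: "W \<noteq> {0\<^sub>v d}" "W \<noteq> carrier_vec d"
  shows "\<exists>d1 d2 \<rho>1 \<rho>2. d1 < d \<and> d2 < d \<and> representation G d1 \<rho>1 \<and> representation G d2 \<rho>2 \<and>
    (\<forall>g\<in>carrier G. trace (\<rho> g) = trace (\<rho>1 g) + trace (\<rho>2 g))"
proof -
  interpret G: group G by (rule G)
  note s = subspaceD[OF W]
  note c = representationD(1)[OF G r] and m = representationD(2)[OF G r]
    and o = representationD(3)[OF G r]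
  from subspace_factor[OF W] obtain d1 U V where U: "U \<in> carrier_mat d d1" "V \<in> carrier_mat d1 d"
    "V * U = 1\<^sub>m d1" "\<And>j. j < d1 \<Longrightarrow> col U j \<in> W" "\<And>w. w \<in> W \<Longrightarrow> U *\<^sub>v (V *\<^sub>v w) = w"
    by blast
  define Q where "Q = U * V"
  have Q: "Q \<in> carrier_mat d d" using U by (simp add: Q_def)
  have Qv: "Q *\<^sub>v w = U *\<^sub>v (V *\<^sub>v w)" if "w \<in> carrier_vec d" for w
    unfolding Q_def using U that by (intro assoc_mult_mat_vec) auto
  define K where "K = {v \<in> carrier_vec d. Q *\<^sub>v v = 0\<^sub>v d}"
  have "VectorSpace.subspace class_ring K (module_vec TYPE(complex) d)"
  proof (rule subspaceI)
    show "K \<subseteq> carrier_vec d" "0\<^sub>v d \<in> K" using Q by (auto simp: K_def)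
    show "v + w \<in> K" if "v \<in> K" "w \<in> K" for v w
      using that Q by (simp add: K_def mult_add_distrib_mat_vec[of _ d d])
    have "a \<cdot>\<^sub>v 0\<^sub>v d = 0\<^sub>v d" for a :: complex by (rule eq_vecI) auto
    then show "a \<cdot>\<^sub>v v \<in> K" if "v \<in> K" for a v
      using that Q by (simp add: K_def mult_mat_vec[of _ d d])
  qed
  from subspace_factor[OF this] obtain d2 U2 V2 where U2: "U2 \<in> carrier_mat d d2" "V2 \<in> carrier_mat d2 d"
    "V2 * U2 = 1\<^sub>m d2" "\<And>j. j < d2 \<Longrightarrow> col U2 j \<in> K" "\<And>w. w \<in> K \<Longrightarrow> U2 *\<^sub>v (V2 *\<^sub>v w) = w"
    by blast
  have mat_eqI: "A = B" if "A \<in> carrier_mat a b" "B \<in> carrier_mat a b"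
    "\<And>j. j < b \<Longrightarrow> col A j = col B j" for A B :: "complex mat" and a b
    using that by (intro mat_col_eqI) auto
  have col_mult: "col (A * B) j = A *\<^sub>v col B j" if "A \<in> carrier_mat a d" "B \<in> carrier_mat d b" "j < b"
    for A B :: "complex mat" and a b j
    using that by (intro eq_vecI) auto
  have cW: "col A j \<in> carrier_vec d" if "A \<in> carrier_mat d b" for A :: "complex mat" and b j
    using that by auto
  have fixW: "Q * A = A" if "A \<in> carrier_mat d b" "\<And>j. j < b \<Longrightarrow> col A j \<in> W"
    for A :: "complex mat" and b
  proof (rule mat_eqI[of _ d b])
    fix j assume j: "j < b"
    have "col (Q * A) j = Q *\<^sub>v col A j" using Q that(1) j by (rule col_mult)
    also have "\<dots> = col A j" using Qv[OF cW[OF that(1)]] U(5)[OF that(2)[OF j]] by simp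
    finally show "col (Q * A) j = col A j" .
  qed (use that Q in auto)
  have QU: "Q * U = U" using U by (intro fixW)
  define R where "R = 1\<^sub>m d - Q"
  have R: "R \<in> carrier_mat d d" unfolding R_def using Q by (rule minus_carrier_mat)
  have minus_zero: "A - 0\<^sub>m a b = A" if "A \<in> carrier_mat a b" for A :: "complex mat" and a b
    using that by (intro eq_matI) auto
  have RA: "R * A = A - Q * A" if "A \<in> carrier_mat d b" for A :: "complex mat" and b
    using that Q by (simp add: R_def minus_mult_distrib_mat[of _ d d _ _ b])
  have AR: "A * R = A - A * Q" if "A \<in> carrier_mat b d" for A :: "complex mat" and b
    using that Q by (simp add: R_def mult_minus_distrib_mat[of _ b d _ d])
  have QQ: "Q * Q = Q"
    using QU U Q assoc_mult_mat[OF Q U(1) U(2)] by (simp add: Q_def)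
  have QU2: "Q * U2 = 0\<^sub>m d d2"
  proof (rule mat_eqI[of _ d d2])
    fix j assume j: "j < d2"
    have "col (Q * U2) j = Q *\<^sub>v col U2 j" using Q U2(1) j by (rule col_mult)
    then show "col (Q * U2) j = col (0\<^sub>m d d2) j" using U2(4)[OF j] j by (simp add: K_def)
  qed (use U2 Q in auto)
  have colR: "col R j \<in> K" if "j < d" for j
  proof -
    have "Q * R = 0\<^sub>m d d" using AR[OF Q] QQ Q by simp
    then have "Q *\<^sub>v col R j = col (0\<^sub>m d d) j" using col_mult[OF Q R that] by simp
    then show ?thesis using R that by (auto simp: K_def)
  qed
  \<comment> \<open>\<open>R\<close> projects onto K along W, so V' gives coordinates on K and is
    zero on W.\<close>
  define V' where "V' = V2 * R"
  have V': "V' \<in> carrier_mat d2 d" using U2 R by (simp add: V'_def)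
  have V'U2: "V' * U2 = 1\<^sub>m d2"
  proof -
    have "V' * U2 = V2 * (R * U2)" unfolding V'_def using U2 R by (intro assoc_mult_mat)
    also have "R * U2 = U2" using RA[OF U2(1)] U2(1) by (simp add: QU2 minus_zero)
    finally show ?thesis using U2 by simp
  qed
  have U2V': "U2 * V' = R"
  proof -
    have "U2 * V' = (U2 * V2) * R" unfolding V'_def using U2 R by (intro assoc_mult_mat[symmetric])
    also have "\<dots> = R"
    proof (rule mat_eqI[of _ d d])
      fix j assume j: "j < d"
      have "col (U2 * V2 * R) j = (U2 * V2) *\<^sub>v col R j"
        using U2 R j by (intro col_mult[of _ d _ d]) auto
      also have "\<dots> = U2 *\<^sub>v (V2 *\<^sub>v col R j)"
        using U2 R j by (intro assoc_mult_mat_vec) auto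
      also have "\<dots> = col R j" using colR[OF j] U2 by simp
      finally show "col (U2 * V2 * R) j = col R j" .
    qed (use U2 R in auto)
    finally show ?thesis .
  qed
  have inv_Q: "Q * (\<rho> g * U) = \<rho> g * U" if g: "g \<in> carrier G" for g
  proof (rule fixW)
    show "\<rho> g * U \<in> carrier_mat d d1" using c[OF g] U by auto
    show "col (\<rho> g * U) j \<in> W" if "j < d1" for j
      using col_mult[OF c[OF g] U(1) that] inv[OF g U(4)[OF that]] by simp
  qed
  \<comment> \<open>The vanishing lower left block: \<open>\<rho> g\<close> maps W into W, where V'
    is zero. This makes \<open>\<rho>2\<close> multiplicative.\<close>
  have inv_R: "V' * (\<rho> g * Q) = 0\<^sub>m d2 d" if g: "g \<in> carrier G" for g
  proof -
    have e: "\<rho> g * Q = \<rho> g * U * V"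
      unfolding Q_def using c[OF g] U by (intro assoc_mult_mat[symmetric]) auto
    have "V' * (\<rho> g * Q) = V2 * (R * (\<rho> g * Q))"
      unfolding V'_def using U2 R c[OF g] Q by (intro assoc_mult_mat) auto
    also have "R * (\<rho> g * Q) = (R * (\<rho> g * U)) * V"
      unfolding e using R c[OF g] U by (intro assoc_mult_mat[symmetric]) auto
    also have "R * (\<rho> g * U) = 0\<^sub>m d d1"
      using c[OF g] U RA[of "\<rho> g * U" d1] by (simp add: inv_Q[OF g] minus_r_inv_mat[of _ d d1])
    also have "0\<^sub>m d d1 * V = 0\<^sub>m d d" using U by simp
    also have "V2 * 0\<^sub>m d d = 0\<^sub>m d2 d" using U2 by simp
    finally show ?thesis .
  qed
  define \<rho>1 where "\<rho>1 g = V * (\<rho> g * U)" for g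
  define \<rho>2 where "\<rho>2 g = V' * (\<rho> g * U2)" for g
  have r1: "representation G d1 \<rho>1"
  proof (rule representationI[OF G])
    show "\<rho>1 g \<in> carrier_mat d1 d1" if "g \<in> carrier G" for g
      using c[OF that] U by (auto simp: \<rho>1_def)
    show "\<rho>1 \<one> = 1\<^sub>m d1" using U by (simp add: \<rho>1_def o)
    fix g h assume g: "g \<in> carrier G" and h: "h \<in> carrier G"
    have "\<rho>1 g * \<rho>1 h = V * (\<rho> g * U * \<rho>1 h)"
      unfolding \<rho>1_def using U c[OF g] c[OF h] by (intro assoc_mult_mat) auto
    also have "\<rho> g * U * \<rho>1 h = \<rho> g * (U * \<rho>1 h)"
      using U c[OF g] c[OF h] by (intro assoc_mult_mat) (auto simp: \<rho>1_def)
    also have "U * \<rho>1 h = Q * (\<rho> h * U)"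
      unfolding \<rho>1_def Q_def using U c[OF h] by (intro assoc_mult_mat[symmetric]) auto
    also have "\<dots> = \<rho> h * U" by (rule inv_Q[OF h])
    also have "\<rho> g * (\<rho> h * U) = \<rho> (g \<otimes> h) * U"
      unfolding m[OF g h] using U c[OF g] c[OF h] by (intro assoc_mult_mat[symmetric])
    finally show "\<rho>1 (g \<otimes> h) = \<rho>1 g * \<rho>1 h" by (simp add: \<rho>1_def)
  qed
  have r2: "representation G d2 \<rho>2"
  proof (rule representationI[OF G])
    show "\<rho>2 g \<in> carrier_mat d2 d2" if "g \<in> carrier G" for g
      using c[OF that] U2 V' by (auto simp: \<rho>2_def)
    show "\<rho>2 \<one> = 1\<^sub>m d2" using U2 V'U2 by (simp add: \<rho>2_def o)
    fix g h assume g: "g \<in> carrier G" and h: "h \<in> carrier G"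
    have "\<rho>2 g * \<rho>2 h = V' * (\<rho> g * U2 * \<rho>2 h)"
      unfolding \<rho>2_def using U2 V' c[OF g] c[OF h] by (intro assoc_mult_mat) auto
    also have "\<rho> g * U2 * \<rho>2 h = \<rho> g * (U2 * \<rho>2 h)"
      using U2 V' c[OF g] c[OF h] by (intro assoc_mult_mat) (auto simp: \<rho>2_def)
    also have "U2 * \<rho>2 h = R * (\<rho> h * U2)"
      unfolding \<rho>2_def U2V'[symmetric] using U2 V' c[OF h] by (intro assoc_mult_mat[symmetric]) auto
    also have "\<rho> g * (R * (\<rho> h * U2)) = (\<rho> g * R) * (\<rho> h * U2)"
      using U2 R c[OF g] c[OF h] by (intro assoc_mult_mat[symmetric]) auto
    also have "V' * ((\<rho> g * R) * (\<rho> h * U2)) = (V' * (\<rho> g * R)) * (\<rho> h * U2)"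
      using U2 V' R c[OF g] c[OF h] by (intro assoc_mult_mat[symmetric]) auto
    also have "V' * (\<rho> g * R) = V' * \<rho> g - V' * (\<rho> g * Q)"
      using V' c[OF g] Q by (subst AR[of _ d]) (auto simp: mult_minus_distrib_mat[of _ d2 d])
    also have "\<dots> = V' * \<rho> g" unfolding inv_R[OF g] using V' c[OF g] by (intro minus_zero) auto
    also have "V' * \<rho> g * (\<rho> h * U2) = V' * (\<rho> g * (\<rho> h * U2))"
      using U2 V' c[OF g] c[OF h] by (intro assoc_mult_mat) auto
    also have "\<rho> g * (\<rho> h * U2) = \<rho> (g \<otimes> h) * U2"
      unfolding m[OF g h] using U2 c[OF g] c[OF h] by (intro assoc_mult_mat[symmetric])
    finally show "\<rho>2 (g \<otimes> h) = \<rho>2 g * \<rho>2 h" by (simp add: \<rho>2_def)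
  qed
  have tr: "trace (\<rho> g) = trace (\<rho>1 g) + trace (\<rho>2 g)" if g: "g \<in> carrier G" for g
  proof -
    have "trace (\<rho>1 g) = trace (\<rho> g * U * V)"
      unfolding \<rho>1_def using U c[OF g] by (intro trace_mult_commute[of _ d1 d]) auto
    also have "\<rho> g * U * V = \<rho> g * Q" unfolding Q_def using U c[OF g] by (intro assoc_mult_mat)
    finally have 1: "trace (\<rho>1 g) = trace (\<rho> g * Q)" .
    have "trace (\<rho>2 g) = trace (\<rho> g * U2 * V')"
      unfolding \<rho>2_def using U2 V' c[OF g] by (intro trace_mult_commute[of _ d2 d]) auto
    also have "\<rho> g * U2 * V' = \<rho> g * R"
      unfolding U2V'[symmetric] using U2 V' c[OF g] by (intro assoc_mult_mat)
    also have "\<dots> = \<rho> g - \<rho> g * Q" using AR[OF c[OF g]] .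
    also have "trace \<dots> = trace (\<rho> g) - trace (\<rho> g * Q)"
      using c[OF g] Q
      by (simp add: trace_eq_sum[of _ d] minus_carrier_mat mat_closed sum_subtractf del: index_mult_mat(1))
    finally show ?thesis using 1 by simp
  qed
  \<comment> \<open>The traces at the identity add the degrees, so both parts are proper as soon as
    both are nonzero.\<close>
  have "of_nat d = (of_nat d1 + of_nat d2 :: complex)"
    using tr[of \<one>] o representationD(3)[OF G r1] representationD(3)[OF G r2] by (simp add: trace_one)
  then have sum: "d = d1 + d2" by (metis of_nat_add of_nat_eq_iff)
  have "d1 \<noteq> 0"
  proof
    assume "d1 = 0"
    have "w = 0\<^sub>v d" if "w \<in> W" for w
    proof (rule eq_vecI)
      fix i assume "i < dim_vec (0\<^sub>v d)"
      then have "(U *\<^sub>v (V *\<^sub>v w)) $ i = 0"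
        using U(1,2) \<open>d1 = 0\<close> by (simp add: scalar_prod_def)
      then show "w $ i = 0\<^sub>v d $ i" using U(5)[OF that] \<open>i < dim_vec (0\<^sub>v d)\<close> by simp
    qed (use that s(1) in auto)
    then show False using ne s(2) by blast
  qed
  moreover have "d2 \<noteq> 0"
  proof
    assume "d2 = 0"
    then have "R = 0\<^sub>m d d" using U2V' U2 V' by (auto intro!: eq_matI simp: scalar_prod_def)
    then have Q1: "Q *\<^sub>v w = w" if "w \<in> carrier_vec d" for w
    proof -
      assume R0: "R = 0\<^sub>m d d"
      have "R *\<^sub>v w = w - Q *\<^sub>v w"
        using that Q by (simp add: R_def minus_mult_distrib_mat_vec[of _ d d])
      moreover have "R *\<^sub>v w = 0\<^sub>v d" unfolding R0 using that by (intro eq_vecI) auto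
      ultimately have e: "w - Q *\<^sub>v w = 0\<^sub>v d" by simp
      show ?thesis
      proof (rule eq_vecI)
        fix i assume "i < dim_vec w"
        then have i: "i < d" using that by simp
        have "(w - Q *\<^sub>v w) $ i = 0" using e i by simp
        then show "(Q *\<^sub>v w) $ i = w $ i" using i that Q by simp
      qed (use Q that in auto)
    qed
    have "w \<in> W" if w: "w \<in> carrier_vec d" for w
      using mult_vec_in_subspace[OF W U(1,4), of "V *\<^sub>v w"] Q1[OF w] Qv[OF w] U w by auto
    then show False using ne s(1) by blast
  qed
  ultimately show ?thesis using sum r1 r2 tr by (intro exI[of _ d1] exI[of _ d2]) auto
qed

lemma character_sum_irreducible:
  assumes "representation G d \<rho>"
  shows "\<exists>cs. (\<forall>\<chi>\<in>set cs. irreducible_character G \<chi>) \<and>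
    (\<forall>g\<in>carrier G. trace (\<rho> g) = (\<Sum>\<chi>\<leftarrow>cs. \<chi> g))"
  using assms
proof (induction d arbitrary: \<rho> rule: less_induct)
  case (less d)
  consider "d = 0" | "irreducible_representation G d \<rho>" | W where
    "VectorSpace.subspace class_ring W (module_vec TYPE(complex) d)"
    "\<forall>g\<in>carrier G. \<forall>w\<in>W. \<rho> g *\<^sub>v w \<in> W" "W \<noteq> {0\<^sub>v d}" "W \<noteq> carrier_vec d"
    using less.prems unfolding irreducible_representation_def by blast
  then show ?case
  proof cases
    case 1
    then show ?thesis
      using representationD(1)[OF G less.prems] by (intro exI[of _ "[]"]) (auto simp: trace_eq_sum[of _ 0])
  next
    case 2
    then show ?thesis
      by (intro exI[of _ "[\<lambda>g. trace (\<rho> g)]"]) (auto simp: irreducible_character_def)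
  next
    case 3
    have inv: "\<And>g w. g \<in> carrier G \<Longrightarrow> w \<in> W \<Longrightarrow> \<rho> g *\<^sub>v w \<in> W" using 3(2) by blast
    from invariant_subspace_split[OF less.prems 3(1) inv 3(3,4)] obtain d1 d2 \<rho>1 \<rho>2
      where s: "d1 < d" "d2 < d" "representation G d1 \<rho>1" "representation G d2 \<rho>2"
        "\<forall>g\<in>carrier G. trace (\<rho> g) = trace (\<rho>1 g) + trace (\<rho>2 g)" by blast
    from less.IH[OF s(1,3)] obtain cs1 where "\<forall>\<chi>\<in>set cs1. irreducible_character G \<chi>"
      "\<forall>g\<in>carrier G. trace (\<rho>1 g) = (\<Sum>\<chi>\<leftarrow>cs1. \<chi> g)" by blast
    moreover from less.IH[OF s(2,4)] obtain cs2 where "\<forall>\<chi>\<in>set cs2. irreducible_character G \<chi>"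
      "\<forall>g\<in>carrier G. trace (\<rho>2 g) = (\<Sum>\<chi>\<leftarrow>cs2. \<chi> g)" by blast
    ultimately show ?thesis using s(5) by (intro exI[of _ "cs1 @ cs2"]) auto
  qed
qed

lemma regular_representation:
  assumes fin: "finite (carrier G)"
  shows "\<exists>\<rho>. representation G (card (carrier G)) \<rho> \<and>
    (\<forall>g\<in>carrier G. trace (\<rho> g) = (if g = \<one> then of_nat (card (carrier G)) else 0))"
proof -
  interpret G: group G by (rule G)
  let ?d = "card (carrier G)"
  obtain b where b: "bij_betw b {..<?d} (carrier G)"
    using ex_bij_betw_nat_finite[OF fin] by (auto simp: atLeast0LessThan)
  have bc: "b i \<in> carrier G" if "i < ?d" for i using b that by (auto simp: bij_betw_def)
  define \<rho> where "\<rho> g = mat ?d ?d (\<lambda>(i, j). if g \<otimes> b j = b i then 1 else 0 :: complex)" for g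
  have "representation G ?d \<rho>"
  proof (rule representationI[OF G])
    fix g h assume g: "g \<in> carrier G" and h: "h \<in> carrier G"
    show "\<rho> (g \<otimes> h) = \<rho> g * \<rho> h"
    proof (rule eq_matI)
      fix i j assume "i < dim_row (\<rho> g * \<rho> h)" "j < dim_col (\<rho> g * \<rho> h)"
      then have ij: "i < ?d" "j < ?d" by (auto simp: \<rho>_def)
      have "h \<otimes> b j \<in> b ` {..<?d}" using b h bc[OF ij(2)] by (simp add: bij_betw_def)
      then obtain l where l: "l < ?d" "b l = h \<otimes> b j" by auto
      have u: "h \<otimes> b j = b k \<longleftrightarrow> k = l" if "k < ?d" for k
        using l that b by (metis bij_betw_def inj_on_eq_iff lessThan_iff)
      have "(\<rho> g * \<rho> h) $$ (i, j) = (\<Sum>k<?d. \<rho> g $$ (i, k) * \<rho> h $$ (k, j))"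
        using ij by (intro index_mult_mat_sum[of _ ?d ?d _ ?d]) (auto simp: \<rho>_def)
      also have "\<dots> = (\<Sum>k<?d. if k = l then \<rho> g $$ (i, l) else 0)"
        using ij u by (intro sum.cong) (auto simp: \<rho>_def)
      also have "\<dots> = \<rho> g $$ (i, l)" using l by (simp add: sum.delta)
      also have "\<dots> = \<rho> (g \<otimes> h) $$ (i, j)"
        using ij l g h bc by (simp add: \<rho>_def G.m_assoc)
      finally show "\<rho> (g \<otimes> h) $$ (i, j) = (\<rho> g * \<rho> h) $$ (i, j)" by simp
    qed (auto simp: \<rho>_def)
  next
    show "\<rho> \<one> = 1\<^sub>m ?d"
    proof (rule eq_matI)
      fix i j assume "i < dim_row (1\<^sub>m ?d)" "j < dim_col (1\<^sub>m ?d)"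
      then show "\<rho> \<one> $$ (i, j) = 1\<^sub>m ?d $$ (i, j)"
        using bc b by (auto simp: \<rho>_def bij_betw_def inj_on_def)
    qed (auto simp: \<rho>_def)
  qed (auto simp: \<rho>_def)
  moreover have "trace (\<rho> g) = (if g = \<one> then of_nat ?d else 0)" if g: "g \<in> carrier G" for g
  proof -
    have "g \<otimes> b i = b i \<longleftrightarrow> g = \<one>" if "i < ?d" for i
      using bc[OF that] g by (metis G.l_one G.one_closed G.right_cancel)
    then show ?thesis by (simp add: trace_eq_sum[of _ ?d] \<rho>_def)
  qed
  ultimately show ?thesis by blast
qed

text \<open>The regular character, a multiple of the indicator of \<open>\<one>\<close>, is a sum of irreducible ones.\<close>

lemma irreducible_characters_detect_one:
  assumes fin: "finite (carrier G)" and A: "finite A" "\<And>a. a \<in> A \<Longrightarrow> u a \<in> carrier G"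
    and zero: "\<And>\<chi>. irreducible_character G \<chi> \<Longrightarrow> (\<Sum>a\<in>A. c a * \<chi> (u a)) = 0"
  shows "(\<Sum>a\<in>A. if u a = \<one> then c a else 0) = (0 :: complex)"
proof -
  interpret G: group G by (rule G)
  from regular_representation[OF fin] obtain \<rho> where r: "representation G (card (carrier G)) \<rho>"
    and tr: "\<And>g. g \<in> carrier G \<Longrightarrow> trace (\<rho> g) = (if g = \<one> then of_nat (card (carrier G)) else 0)"
    by blast
  from character_sum_irreducible[OF r] obtain cs where cs: "\<forall>\<chi>\<in>set cs. irreducible_character G \<chi>"
    "\<And>g. g \<in> carrier G \<Longrightarrow> trace (\<rho> g) = (\<Sum>\<chi>\<leftarrow>cs. \<chi> g)" by blast
  have n: "of_nat (card (carrier G)) \<noteq> (0 :: complex)" using fin by (auto simp: card_eq_0_iff)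
  have swap: "(\<Sum>a\<in>A. c a * (\<Sum>\<chi>\<leftarrow>xs. \<chi> (u a))) = (\<Sum>\<chi>\<leftarrow>xs. \<Sum>a\<in>A. c a * \<chi> (u a))" for xs
    by (induction xs) (simp_all add: distrib_left sum.distrib)
  have "(\<Sum>a\<in>A. if u a = \<one> then c a else 0) * of_nat (card (carrier G)) =
      (\<Sum>a\<in>A. c a * trace (\<rho> (u a)))"
    unfolding sum_distrib_right using A by (intro sum.cong) (auto simp: tr)
  also have "\<dots> = (\<Sum>\<chi>\<leftarrow>cs. \<Sum>a\<in>A. c a * \<chi> (u a))"
    using A by (simp add: cs(2) swap)
  also have "\<dots> = (\<Sum>\<chi>\<leftarrow>cs. 0)"
    using cs(1) zero by (intro arg_cong[of _ _ sum_list] map_cong) auto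
  finally show ?thesis using n by simp
qed

end

section \<open>The double coset criterion\<close>

text \<open>For P = u v^T both sides are (v^T M u)(v^T N u). The vanishing of the minors allows the
  row indices of the two factors P to be exchanged, without choosing u and v.\<close>

lemma trace_rank_one:
  fixes P :: "complex mat"
  assumes c: "P \<in> carrier_mat d d" "M \<in> carrier_mat d d" "N \<in> carrier_mat d d"
    and rank: "\<And>a b i j. a < d \<Longrightarrow> b < d \<Longrightarrow> i < d \<Longrightarrow> j < d \<Longrightarrow>
      P $$ (a, b) * P $$ (i, j) = P $$ (a, j) * P $$ (i, b)"
  shows "trace (P * M * (P * N)) = trace (P * M) * trace (P * N)"
proof -
  have t: "trace (A * B) = (\<Sum>a<d. \<Sum>b<d. A $$ (a, b) * B $$ (b, a))"
    if "A \<in> carrier_mat d d" "B \<in> carrier_mat d d" for A B :: "complex mat"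
    using that by (subst trace_eq_sum[of _ d])
      (auto simp: mat_closed index_mult_mat_sum[of _ d d _ d] simp del: index_mult_mat)
  have "trace (P * M * (P * N)) = (\<Sum>a<d. \<Sum>b<d. \<Sum>k<d. \<Sum>l<d.
      P $$ (a, k) * M $$ (k, b) * (P $$ (b, l) * N $$ (l, a)))"
    using c by (simp add: t mat_closed index_mult_mat_sum[of _ d d _ d] sum_product del: index_mult_mat)
  also have "\<dots> = (\<Sum>a<d. \<Sum>b<d. \<Sum>k<d. \<Sum>l<d.
      P $$ (b, k) * M $$ (k, b) * (P $$ (a, l) * N $$ (l, a)))"
  proof (intro sum.cong refl)
    fix a b k l assume "a \<in> {..<d}" "b \<in> {..<d}" "k \<in> {..<d}" "l \<in> {..<d}"
    then have "P $$ (a, k) * P $$ (b, l) = P $$ (a, l) * P $$ (b, k)" using rank by simp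
    then show "P $$ (a, k) * M $$ (k, b) * (P $$ (b, l) * N $$ (l, a)) =
        P $$ (b, k) * M $$ (k, b) * (P $$ (a, l) * N $$ (l, a))"
      by (simp add: ac_simps)
  qed
  also have "\<dots> = (\<Sum>a<d. \<Sum>b<d. (\<Sum>k<d. P $$ (b, k) * M $$ (k, b)) * (\<Sum>l<d. P $$ (a, l) * N $$ (l, a)))"
    by (simp add: sum_product)
  also have "\<dots> = trace (P * M) * trace (P * N)"
    using c by (simp add: t sum_distrib_left[symmetric] sum_distrib_right[symmetric])
  finally show ?thesis .
qed

context sign_character
begin

text \<open>Cycling the trace brings each projection in turn to the right end, where it is expanded
  as an average over \<open>H\<close>. This turns traces of compressions into sums of character
  values.\<close>

lemma trace_double_average:
  assumes r: "representation G d \<rho>" and xy: "x \<in> carrier G" "y \<in> carrier G"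
  shows "(\<Sum>h\<in>H. \<Sum>h'\<in>H. \<epsilon> h * \<epsilon> h' * trace (\<rho> (h \<otimes> x \<otimes> h' \<otimes> y))) =
    of_nat (card H) * of_nat (card H) * trace (proj d \<rho> * \<rho> x * (proj d \<rho> * \<rho> y))"
proof -
  let ?P = "proj d \<rho>" and ?n = "of_nat (card H) :: complex"
  have n: "?n \<noteq> 0" using card_H by simp
  note c = rep_carrier[OF r] H_carrier and m = rep_mult[OF r]
  have av: "?n * trace (M * ?P) = (\<Sum>h\<in>H. \<epsilon> h * trace (M * \<rho> h))" if "M \<in> carrier_mat d d" for M
    using that n by (simp add: trace_proj_mult[OF r])
  have "?n * (?n * trace (?P * \<rho> x * (?P * \<rho> y))) = ?n * (?n * trace ((\<rho> y * ?P * \<rho> x) * ?P))"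
    using xy c trace_mult_commute[of "?P * \<rho> x * ?P" d d "\<rho> y"] by (simp add: mat_closed mat_assoc[of _ d])
  also have "\<dots> = ?n * (\<Sum>h'\<in>H. \<epsilon> h' * trace ((\<rho> y * ?P * \<rho> x) * \<rho> h'))"
    using xy c by (subst av) (simp_all add: mat_closed)
  also have "\<dots> = (\<Sum>h'\<in>H. \<epsilon> h' * (?n * trace ((\<rho> x * \<rho> h' * \<rho> y) * ?P)))"
    unfolding sum_distrib_left
  proof (rule sum.cong)
    fix h' assume "h' \<in> H"
    then show "?n * (\<epsilon> h' * trace ((\<rho> y * ?P * \<rho> x) * \<rho> h')) =
        \<epsilon> h' * (?n * trace ((\<rho> x * \<rho> h' * \<rho> y) * ?P))"
      using xy c trace_mult_commute[of "\<rho> y * ?P" d d "\<rho> x * \<rho> h'"]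
      by (simp add: mat_closed mat_assoc[of _ d])
  qed simp
  also have "\<dots> = (\<Sum>h'\<in>H. \<epsilon> h' * (\<Sum>h\<in>H. \<epsilon> h * trace ((\<rho> x * \<rho> h' * \<rho> y) * \<rho> h)))"
    using xy c by (intro sum.cong refl) (simp add: av mat_closed)
  also have "\<dots> = (\<Sum>h'\<in>H. \<Sum>h\<in>H. \<epsilon> h * \<epsilon> h' * trace (\<rho> (h \<otimes> x \<otimes> h' \<otimes> y)))"
    unfolding sum_distrib_left
  proof (intro sum.cong refl)
    fix h h' assume "h \<in> H" "h' \<in> H"
    then show "\<epsilon> h' * (\<epsilon> h * trace ((\<rho> x * \<rho> h' * \<rho> y) * \<rho> h)) =
        \<epsilon> h * \<epsilon> h' * trace (\<rho> (h \<otimes> x \<otimes> h' \<otimes> y))"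
      using xy c trace_mult_commute[of "\<rho> x * \<rho> h' * \<rho> y" d d "\<rho> h"]
      by (simp add: mat_closed mat_assoc[of _ d] m)
  qed
  finally show ?thesis by (subst sum.swap) (simp add: mult.assoc)
qed

text \<open>The trace is an average of character values at g h with h in \<open>H\<close>. By
  ambivalence a character agrees on g h and its inverse, and h \<mapsto> h^-1 preserves the
  average.\<close>

lemma trace_proj_inv:
  assumes r: "representation G d \<rho>" and g: "g \<in> carrier G"
    and ambivalent: "\<And>g. g \<in> carrier G \<Longrightarrow> \<exists>t\<in>carrier G. inv g = inv t \<otimes> g \<otimes> t"
  shows "trace (proj d \<rho> * \<rho> (inv g)) = trace (proj d \<rho> * \<rho> g)"
proof -
  note c = rep_carrier[OF r] H_carrier and m = rep_mult[OF r]
  have av: "trace (proj d \<rho> * \<rho> x) = (\<Sum>h\<in>H. \<epsilon> h * trace (\<rho> (x \<otimes> h))) / of_nat (card H)"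
    if "x \<in> carrier G" for x
    using that c trace_mult_commute[of "proj d \<rho>" d d "\<rho> x"]
    by (simp add: trace_proj_mult[OF r] m)
  have amb: "trace (\<rho> (inv x)) = trace (\<rho> x)" if "x \<in> carrier G" for x
    using ambivalent[OF that] trace_conj[OF G.group_axioms r that] by metis
  have "(\<Sum>h\<in>H. \<epsilon> h * trace (\<rho> (inv g \<otimes> h))) = (\<Sum>h\<in>H. \<epsilon> (inv h) * trace (\<rho> (inv g \<otimes> inv h)))"
    by (rule sum.reindex_bij_betw[OF bij_inv_H, symmetric])
  also have "\<dots> = (\<Sum>h\<in>H. \<epsilon> h * trace (\<rho> (g \<otimes> h)))"
  proof (rule sum.cong)
    fix h assume h: "h \<in> H"
    have "trace (\<rho> (inv g \<otimes> inv h)) = trace (\<rho> (inv (h \<otimes> g)))"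
      using g h H_carrier by (simp add: G.inv_mult_group)
    also have "\<dots> = trace (\<rho> (g \<otimes> h))"
      using g h H_carrier amb[of "h \<otimes> g"] trace_commute[OF G.group_axioms r, of h g] by simp
    finally show "\<epsilon> (inv h) * trace (\<rho> (inv g \<otimes> inv h)) = \<epsilon> h * trace (\<rho> (g \<otimes> h))"
      using h by (simp add: sign_inverse)
  qed simp
  finally show ?thesis using g by (simp add: av)
qed

text \<open>For P of rank at most one, tr(P g P g) = tr(P g)^2 = tr(P g^-1) tr(P g) = tr(P g^-1 P
  g). Hence the signed sum of all h g h' g minus that of all h g^-1 h' g is killed by every
  irreducible character, and its coefficient at the identity is zero. For an asymmetric g all
  contributions to that coefficient would be -1.\<close>

theorem symmetric_if_multiplicity_free:
  assumes mf: "multiplicity_free G (induced_char G H \<phi>)"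
    and \<phi>: "\<And>h. h \<in> H \<Longrightarrow> \<phi> h = \<epsilon> h"
    and ambivalent: "\<And>g. g \<in> carrier G \<Longrightarrow> \<exists>t\<in>carrier G. inv g = inv t \<otimes> g \<otimes> t"
    and g: "g \<in> carrier G"
  shows "symmetric_double_coset g"
proof (rule ccontr)
  assume nsym: "\<not> symmetric_double_coset g"
  define A where "A = H \<times> H \<times> (UNIV :: bool set)"
  define x where "x b = (if b then g else inv g)" for b
  define u where "u = (\<lambda>(h, h', b). h \<otimes> x b \<otimes> h' \<otimes> g)"
  define c :: "'g \<times> 'g \<times> bool \<Rightarrow> complex"
    where "c = (\<lambda>(h, h', b). (if b then 1 else -1) * (\<epsilon> h * \<epsilon> h'))"
  have xc: "x b \<in> carrier G" for b using g by (simp add: x_def)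
  have A: "finite A" "\<And>a. a \<in> A \<Longrightarrow> u a \<in> carrier G"
    using finH H_carrier g xc by (auto simp: A_def u_def)
  have zero: "(\<Sum>a\<in>A. c a * \<chi> (u a)) = 0" if irr: "irreducible_character G \<chi>" for \<chi>
  proof -
    from irr obtain d \<rho> where ir: "irreducible_representation G d \<rho>"
      and \<chi>: "\<And>g. g \<in> carrier G \<Longrightarrow> \<chi> g = trace (\<rho> g)"
      unfolding irreducible_character_def by blast
    then have r: "representation G d \<rho>" by (simp add: irreducible_representation_def)
    let ?P = "proj d \<rho>"
    have "cnj (trace ?P) \<le> 1"
      using mf irr char_inner_induced[OF r \<chi> \<phi>] unfolding multiplicity_free_def by metis
    then have tr: "Re (trace ?P) \<le> 1" by (simp add: less_eq_complex_def)
    have "(\<Sum>l<d. ?P $$ (a, l) * ?P $$ (l, b)) = ?P $$ (a, b)" if "a < d" "b < d" for a b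
      using index_mult_mat_sum[of ?P d d ?P d a b] that by (simp add: proj_idem[OF r])
    then obtain m :: nat where m: "trace ?P = of_nat m"
      "m = 0 \<longrightarrow> (\<forall>a<d. \<forall>b<d. ?P $$ (a, b) = 0)"
      "m = 1 \<longrightarrow> (\<forall>a<d. \<forall>b<d. \<forall>i<d. \<forall>j<d. ?P $$ (a, b) * ?P $$ (i, j) = ?P $$ (a, j) * ?P $$ (i, b))"
      using idempotent_trace[of "{..<d}" "\<lambda>a b. ?P $$ (a, b)"]
      by (auto simp: trace_eq_sum[of ?P d] Ball_def)
    have "m \<le> 1" using tr m(1) by simp
    then have rank: "?P $$ (a, b) * ?P $$ (i, j) = ?P $$ (a, j) * ?P $$ (i, b)"
      if "a < d" "b < d" "i < d" "j < d" for a b i j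
      using m(2,3) that by (cases "m = 0") auto
    have split: "trace (?P * \<rho> y * (?P * \<rho> g)) = trace (?P * \<rho> y) * trace (?P * \<rho> g)"
      if "y \<in> carrier G" for y
      using that g rep_carrier[OF r] by (intro trace_rank_one rank) auto
    have "(\<Sum>a\<in>A. c a * \<chi> (u a)) =
        (\<Sum>h\<in>H. \<Sum>h'\<in>H. \<Sum>b\<in>UNIV. (if b then 1 else -1) * (\<epsilon> h * \<epsilon> h') * \<chi> (h \<otimes> x b \<otimes> h' \<otimes> g))"
      by (simp add: A_def c_def u_def sum.cartesian_product split_def)
    also have "\<dots> = (\<Sum>h\<in>H. \<Sum>h'\<in>H. \<epsilon> h * \<epsilon> h' * trace (\<rho> (h \<otimes> g \<otimes> h' \<otimes> g)))
        - (\<Sum>h\<in>H. \<Sum>h'\<in>H. \<epsilon> h * \<epsilon> h' * trace (\<rho> (h \<otimes> inv g \<otimes> h' \<otimes> g)))"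
      using g H_carrier by (simp add: UNIV_bool x_def \<chi> sum_subtractf)
    also have "\<dots> = 0"
      using g by (simp add: trace_double_average[OF r] split trace_proj_inv[OF r g ambivalent])
    finally show ?thesis .
  qed
  have sum0: "(\<Sum>a\<in>A. if u a = \<one> then c a else 0) = 0"
    using irreducible_characters_detect_one[OF G.group_axioms fin A(1), of u c] A(2) zero by blast
  have one: "\<one> \<in> H" "\<epsilon> \<one> = 1"
    using subgroup.one_closed[OF sub] mult[of \<one> \<one>] sign_values[of \<one>] by auto
  \<comment> \<open>A term equals the identity iff h (x b) h' = g^-1. If b holds, sign 1 would be
    the second alternative of symmetry; otherwise inversion gives h'^-1 g h^-1 = g, and sign -1
    would be the first.\<close>
  have neg: "Re (c a) = -1" if a: "a \<in> A" "u a = \<one>" for a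
  proof -
    obtain h h' b where abc: "a = (h, h', b)" "h \<in> H" "h' \<in> H" using a by (auto simp: A_def)
    have hc: "h \<in> carrier G" "h' \<in> carrier G" using abc H_carrier by auto
    have "h \<otimes> x b \<otimes> h' = inv g"
      using a(2) abc hc xc g by (intro G.inv_equality[symmetric]) (auto simp: u_def)
    then have eq: "h \<otimes> x b \<otimes> h' = inv g" .
    show ?thesis
    proof (cases b)
      case True
      then have "\<epsilon> h * \<epsilon> h' \<noteq> 1"
        using nsym eq abc by (auto simp: symmetric_double_coset_def x_def)
      then have "\<epsilon> h * \<epsilon> h' = -1" using sign_values[of h] sign_values[of h'] abc by auto
      then show ?thesis using True by (simp add: c_def abc)
    next
      case False
      have "inv h' \<otimes> g \<otimes> inv h = inv (h \<otimes> inv g \<otimes> h')"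
        using hc g by (simp add: G.inv_mult_group G.m_assoc)
      also have "\<dots> = g" using eq False g by (simp add: x_def)
      finally have "\<epsilon> (inv h') * \<epsilon> (inv h) \<noteq> -1"
        using nsym abc subgroup.m_inv_closed[OF sub] by (auto simp: symmetric_double_coset_def)
      then have "\<epsilon> h * \<epsilon> h' = 1" using sign_values[of h] sign_values[of h'] abc by (auto simp: sign_inverse)
      then show ?thesis using False by (simp add: c_def abc)
    qed
  qed
  \<comment> \<open>The trivial pair contributes g^-1 g = 1 with coefficient -1, so the coefficient
    at the identity is strictly negative.\<close>
  let ?a = "(\<one>, \<one>, False)"
  have a: "?a \<in> A" "u ?a = \<one>" using one g by (auto simp: A_def u_def x_def)
  have "Re (\<Sum>a\<in>A. if u a = \<one> then c a else 0) = (\<Sum>a\<in>A. Re (if u a = \<one> then c a else 0))"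
    by simp
  also have "\<dots> = Re (if u ?a = \<one> then c ?a else 0) + (\<Sum>a\<in>A - {?a}. Re (if u a = \<one> then c a else 0))"
    using A(1) a(1) by (rule sum.remove)
  also have "\<dots> \<le> -1 + 0"
    using a neg by (intro add_mono sum_nonpos) auto
  finally show False using sum0 by simp
qed

end

section \<open>Permutations inverted or interchanged by an involution\<close>

lemma involution_permutes:
  assumes "\<And>w. w \<notin> A \<Longrightarrow> t w = w" "\<And>w. t (t w) = w"
  shows "t permutes A"
  unfolding permutes_def using assms by metis

text \<open>By induction on the cardinality a piece K is split off and the involution on the
  remainder extended by that on K. Since \<open>step\<close> is available for every nonempty
  invariant B, it may pick whichever orbit is convenient.\<close>

lemma glue_orbits:
  assumes fin: "finite A"
    and inj: "inj_on x A" "inj_on y A" and cl: "x ` A \<subseteq> A" "y ` A \<subseteq> A"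
    and step: "\<And>B. B \<subseteq> A \<Longrightarrow> B \<noteq> {} \<Longrightarrow> x ` B \<subseteq> B \<Longrightarrow> y ` B \<subseteq> B \<Longrightarrow>
      \<exists>K t. K \<subseteq> B \<and> K \<noteq> {} \<and> x ` K = K \<and> y ` K = K \<and> t ` K \<subseteq> K \<and>
        (\<forall>w\<in>K. t (t w) = w \<and> t (x w) = y (t w))"
  shows "\<exists>t. t permutes A \<and> (\<forall>w. t (t w) = w) \<and> (\<forall>w\<in>A. t (x w) = y (t w))"
proof -
  have "\<exists>t. (\<forall>w. w \<notin> B \<longrightarrow> t w = w) \<and> (\<forall>w. t (t w) = w) \<and> (\<forall>w\<in>B. t (x w) = y (t w))"
    if "B \<subseteq> A" "x ` B \<subseteq> B" "y ` B \<subseteq> B" for B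
    using that
  proof (induction "card B" arbitrary: B rule: less_induct)
    case less
    show ?case
    proof (cases "B = {}")
      case True
      then show ?thesis by (intro exI[of _ "\<lambda>w. w"]) auto
    next
      case False
      from step[OF less.prems(1) False less.prems(2,3)] obtain K t where K: "K \<subseteq> B" "K \<noteq> {}"
        "x ` K = K" "y ` K = K" "t ` K \<subseteq> K" "\<forall>w\<in>K. t (t w) = w \<and> t (x w) = y (t w)"
        by (elim exE conjE) (rule that)
      \<comment> \<open>An injective map that sends K onto itself can send nothing else into
        K.\<close>
      have invariant: "f ` (B - K) \<subseteq> B - K" if f: "inj_on f A" "f ` B \<subseteq> B" "f ` K = K" for f
      proof
        fix u assume "u \<in> f ` (B - K)"
        then obtain w where w: "w \<in> B" "w \<notin> K" "u = f w" by blast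
        have "u \<notin> K"
        proof
          assume "u \<in> K"
          then have "f w \<in> f ` K" using f(3) w(3) by simp
          then obtain w' where w': "w' \<in> K" "f w = f w'" by (rule imageE) blast
          have "w \<in> A" "w' \<in> A" using w w' less.prems(1) K(1) by auto
          then have "w = w'" using f(1) w'(2) by (simp add: inj_on_eq_iff)
          then show False using w w' by simp
        qed
        then show "u \<in> B - K" using w f(2) by blast
      qed
      have "x ` (B - K) \<subseteq> B - K" using inj(1) less.prems(2) K(3) by (rule invariant)
      moreover have "y ` (B - K) \<subseteq> B - K" using inj(2) less.prems(3) K(4) by (rule invariant)
      moreover have "card (B - K) < card B"
        using K(1,2) fin less.prems(1) by (intro psubset_card_mono) (auto dest: finite_subset)
      moreover have "B - K \<subseteq> A" using less.prems(1) by blast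
      ultimately have "\<exists>t. (\<forall>w. w \<notin> B - K \<longrightarrow> t w = w) \<and> (\<forall>w. t (t w) = w) \<and>
          (\<forall>w\<in>B - K. t (x w) = y (t w))"
        by (intro less.hyps)
      then obtain t' where t': "\<forall>w. w \<notin> B - K \<longrightarrow> t' w = w" "\<forall>w. t' (t' w) = w"
        "\<forall>w\<in>B - K. t' (x w) = y (t' w)"
        by (elim exE conjE) (rule that)
      define s where "s w = (if w \<in> K then t w else t' w)" for w
      have t'K: "t' w \<notin> K" if "w \<notin> K" for w
        using t'(1,2) that by (metis DiffD2)
      have xK: "x w \<notin> K" "x w \<in> B" if "w \<in> B" "w \<notin> K" for w
        using \<open>x ` (B - K) \<subseteq> B - K\<close> that by (metis DiffD1 DiffD2 DiffI image_subset_iff)+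
      have "\<forall>w. w \<notin> B \<longrightarrow> s w = w" using t'(1) K(1) by (auto simp: s_def)
      moreover have "s (s w) = w" for w
      proof (cases "w \<in> K")
        case True
        then have "t w \<in> K" using K(5) by blast
        then show ?thesis using True K(6) by (simp add: s_def)
      qed (simp add: s_def t'K t'(2))
      moreover have "s (x w) = y (s w)" if "w \<in> B" for w
      proof (cases "w \<in> K")
        case True
        then have "x w \<in> K" using K(3) by blast
        then show ?thesis using True K(6) by (simp add: s_def)
      next
        case False
        then show ?thesis using xK(1)[OF that False] t'(3) that by (simp add: s_def)
      qed
      ultimately show ?thesis by (intro exI[of _ s]) simp
    qed
  qed
  from this[of A] cl obtain t where "\<forall>w. w \<notin> A \<longrightarrow> t w = w" "\<forall>w. t (t w) = w"
    "\<forall>w\<in>A. t (x w) = y (t w)" by blast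
  then show ?thesis using involution_permutes[of A t] by blast
qed

text \<open>Integer powers of z, where N is any positive exponent with z^N = id. Negative exponents
  allow a cycle to be parametrized by integers and reflected by k \<mapsto> c - k.\<close>

definition ipow :: "nat \<Rightarrow> ('a \<Rightarrow> 'a) \<Rightarrow> int \<Rightarrow> 'a \<Rightarrow> 'a"
  where "ipow N z k = z ^^ nat (k mod int N)"

context
  fixes N :: nat and z :: "'a \<Rightarrow> 'a"
  assumes N: "N > 0" "z ^^ N = id"
begin

lemma ipow_of_nat: "ipow N z (int m) = z ^^ m"
proof
  fix w
  have "(z ^^ N) w = w" using N by simp
  then show "ipow N z (int m) w = (z ^^ m) w"
    by (simp add: ipow_def zmod_int[symmetric] funpow_mod_eq)
qed

lemma ipow_add: "ipow N z (k + l) w = ipow N z k (ipow N z l w)"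
proof -
  let ?a = "nat (k mod int N)" and ?b = "nat (l mod int N)"
  have "ipow N z (k + l) = ipow N z (int (?a + ?b))"
    using N(1) by (simp add: ipow_def mod_simps)
  then show ?thesis by (simp only: ipow_of_nat) (simp add: ipow_def funpow_add)
qed

lemma ipow_0: "ipow N z 0 w = w" by (simp add: ipow_def)

lemma ipow_1: "ipow N z 1 w = z w" using ipow_of_nat[of 1] by simp

lemma ipow_minus: "ipow N z (- k) (ipow N z k w) = w" "ipow N z k (ipow N z (- k) w) = w"
  using ipow_add[of "-k" k w] ipow_add[of k "-k" w] by (simp_all add: ipow_0)

lemma ipow_closed:
  assumes "z ` B \<subseteq> B" "w \<in> B"
  shows "ipow N z k w \<in> B"
proof -
  have "(z ^^ m) w \<in> B" for m using assms by (induction m) auto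
  then show ?thesis by (simp add: ipow_def)
qed

text \<open>Well-definedness is the point: if z^k v = z^l v, applying z^(c-k-l) yields z^(c-l) v =
  z^(c-k) v.\<close>

lemma ipow_reflection:
  "\<exists>t. \<forall>k. t (ipow N z k v) = ipow N z (c - k) v"
proof -
  have "ipow N z (c - k) v = ipow N z (c - l) v" if "ipow N z k v = ipow N z l v" for k l
  proof -
    have "ipow N z (c - k - l) (ipow N z k v) = ipow N z (c - k - l) (ipow N z l v)" using that by simp
    then show ?thesis by (simp add: ipow_add[symmetric])
  qed
  then have "ipow N z (c - (SOME l. ipow N z l v = ipow N z k v)) v = ipow N z (c - k) v" for k
    by (metis (mono_tags, lifting) someI)
  then show ?thesis by (intro exI[of _ "\<lambda>w. ipow N z (c - (SOME l. ipow N z l v = w)) v"] allI)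
qed

lemma ipow_orbit_image: "ipow N z l ` range (\<lambda>k. ipow N z k v) = range (\<lambda>k. ipow N z k v)"
proof (intro equalityI subsetI)
  fix w assume "w \<in> ipow N z l ` range (\<lambda>k. ipow N z k v)"
  then obtain k where "w = ipow N z (l + k) v" by (auto simp: ipow_add)
  then show "w \<in> range (\<lambda>k. ipow N z k v)" by simp
next
  fix w assume "w \<in> range (\<lambda>k. ipow N z k v)"
  then obtain k where "w = ipow N z k v" by blast
  then have "w = ipow N z l (ipow N z (k - l) v)" by (simp add: ipow_add[symmetric])
  then show "w \<in> ipow N z l ` range (\<lambda>k. ipow N z k v)" by simp
qed

end

lemma permutes_finite_order:
  assumes "p permutes A" "finite A"
  shows "\<exists>n>0. p ^^ n = id"
  using permutation_is_nilpotent[of p] assms permutation_permutes by metis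

text \<open>Each cycle is reflected about one of its points, k \<mapsto> -k. This supplies the
  ambivalence of the symmetric group.\<close>

lemma permutes_inv_conjugate:
  assumes p: "p permutes A" and fin: "finite A"
  shows "\<exists>t. t permutes A \<and> (\<forall>w. t (t w) = w) \<and> (\<forall>w. t (p w) = inv' p (t w))"
proof -
  obtain N where N: "N > 0" "p ^^ N = id"
    using permutes_finite_order[OF p fin] by blast
  have inv_p: "inv' p w = ipow N p (-1) w" for w
    using ipow_minus(2)[OF N, of 1 w] ipow_1[OF N] permutes_inverses[OF p] by metis
  have "\<exists>t. t permutes A \<and> (\<forall>w. t (t w) = w) \<and> (\<forall>w\<in>A. t (p w) = inv' p (t w))"
  proof (rule glue_orbits[OF fin])
    show "inj_on p A" "inj_on (inv' p) A" "p ` A \<subseteq> A" "inv' p ` A \<subseteq> A"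
      using p permutes_inv[OF p] by (auto simp: permutes_inj_on permutes_image)
    fix B assume B: "B \<subseteq> A" "B \<noteq> {}" "p ` B \<subseteq> B"
    then obtain v where v: "v \<in> B" by blast
    let ?z = "ipow N p"
    let ?K = "range (\<lambda>k. ?z k v)"
    obtain t where t: "\<And>k. t (?z k v) = ?z (0 - k) v" using ipow_reflection[OF N, of v 0] by blast
    have "?K \<subseteq> B" using ipow_closed[OF N B(3) v] by blast
    moreover have "p ` ?K = ?K"
      using ipow_orbit_image[OF N, of 1 v] ipow_1[OF N] by (metis image_cong)
    moreover have "inv' p ` ?K = ?K"
      using ipow_orbit_image[OF N, of "-1" v] inv_p by (metis image_cong)
    moreover have "t ` ?K \<subseteq> ?K" using t by auto
    moreover have "t (t w) = w \<and> t (p w) = inv' p (t w)" if w: "w \<in> ?K" for w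
    proof -
      obtain k where k: "w = ?z k v" using w by blast
      have "t (t w) = w" using t[of k] t[of "-k"] by (simp add: k)
      moreover have "p w = ?z (1 + k) v" using ipow_1[OF N] ipow_add[OF N, of 1 k v] by (simp add: k)
      then have "t (p w) = inv' p (t w)"
        using t[of "1 + k"] t[of k] ipow_add[OF N, of "-1" "-k" v] by (simp add: k inv_p)
      ultimately show ?thesis by blast
    qed
    ultimately show "\<exists>K t. K \<subseteq> B \<and> K \<noteq> {} \<and> p ` K = K \<and> inv' p ` K = K \<and> t ` K \<subseteq> K \<and>
        (\<forall>w\<in>K. t (t w) = w \<and> t (p w) = inv' p (t w))"
      by (intro exI[of _ ?K] exI[of _ t]) auto
  qed
  then obtain t where t: "t permutes A" "\<forall>w. t (t w) = w" "\<forall>w\<in>A. t (p w) = inv' p (t w)" by blast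
  have "t (p w) = inv' p (t w)" if "w \<notin> A" for w
    using that t(1) p permutes_inv[OF p] by (simp add: permutes_not_in)
  then show ?thesis using t by blast
qed

text \<open>
  For \<open>y = g x g\<^sup>-\<^sup>1\<close> such an \<open>s\<close> fixes the double coset representative \<open>g\<close> with sign \<open>-1\<close>.
\<close>

definition sign_obstruction :: "'a set \<Rightarrow> ('a \<Rightarrow> 'a) \<Rightarrow> ('a \<Rightarrow> 'a) \<Rightarrow> bool"
  where "sign_obstruction A x y \<longleftrightarrow> (\<exists>s v u. s permutes A \<and> s \<circ> x = x \<circ> s \<and> s \<circ> y = y \<circ> s \<and>
    v \<in> A \<and> u \<in> A \<and> v \<noteq> u \<and> x v = v \<and> x u = u \<and>
    (\<forall>w. x w = w \<longrightarrow> s w = transpose v u w) \<and> (\<forall>w. y w = w \<longrightarrow> s w = w))"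

section \<open>Dihedral orbits of a pair of involutions\<close>

locale involution_pair =
  fixes A :: "'a set" and x y :: "'a \<Rightarrow> 'a"
  assumes fin: "finite A" and xA: "x permutes A" and yA: "y permutes A"
    and xx: "x (x w) = w" and yy: "y (y w) = w"
begin

lemma swapped: "involution_pair A y x"
  by (unfold_locales) (auto simp: fin xA yA xx yy)

definition z :: "'a \<Rightarrow> 'a" where "z = x \<circ> y"

lemma zA: "z permutes A" unfolding z_def by (rule permutes_compose[OF yA xA])

definition N where "N = (SOME n. n > 0 \<and> z ^^ n = id)"

lemma N: "N > 0" "z ^^ N = id"
proof -
  have "\<exists>n. n > 0 \<and> z ^^ n = id"
    using permutes_finite_order[OF zA fin] .
  then show "N > 0" "z ^^ N = id" unfolding N_def by (metis (mono_tags, lifting) someI_ex)+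
qed

abbreviation zp where "zp \<equiv> ipow N z"

lemmas zp_add = ipow_add[OF N] and zp_0 = ipow_0[OF N] and zp_1 = ipow_1[OF N]

text \<open>The dihedral relation: iterate z x z = x, then pass to negative exponents.\<close>

lemma x_zp: "x (zp k w) = zp (- k) (x w)"
proof -
  have step: "z (x (z u)) = x u" for u by (simp add: z_def xx yy)
  have nat: "x (zp (int m) w) = zp (- int m) (x w)" for m w
  proof (induction m)
    case 0
    then show ?case by (simp add: zp_0)
  next
    case (Suc m)
    have "zp (int (Suc m)) (x (zp (int (Suc m)) w)) = zp (int m) (z (x (z (zp (int m) w))))"
      by (simp add: zp_1[symmetric] zp_add[symmetric]) (simp add: add.commute)
    also have "\<dots> = zp (int m) (x (zp (int m) w))" by (simp only: step)
    also have "\<dots> = x w" unfolding Suc.IH by (simp add: ipow_minus[OF N])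
    finally show ?case by (metis ipow_minus(1)[OF N])
  qed
  show ?thesis
  proof (cases "k \<ge> 0")
    case True
    then show ?thesis using nat[of "nat k" w] by simp
  next
    case False
    have "zp k (x w) = zp k (x (zp (- k) (zp k w)))" by (simp add: ipow_minus[OF N])
    also have "x (zp (- k) (zp k w)) = zp k (x (zp k w))"
      using False nat[of "nat (-k)" "zp k w"] by simp
    finally have "zp k (x w) = zp k (zp k (x (zp k w)))" .
    then have "x w = zp k (x (zp k w))" by (metis ipow_minus(1)[OF N])
    then show ?thesis by (metis ipow_minus(1)[OF N])
  qed
qed

text \<open>The shift by one relative to \<open>x_zp\<close> comes from y = x z.\<close>

lemma y_zp: "y (zp k w) = zp (- k - 1) (x w)"
proof -
  have "zp (1 + k) w = x (y (zp k w))" using zp_add[of 1 k w] zp_1[of "zp k w"] by (simp add: z_def)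
  then have "y (zp k w) = x (zp (1 + k) w)" by (simp add: xx)
  also have "\<dots> = zp (- (1 + k)) (x w)" by (rule x_zp)
  also have "- (1 + k) = - k - 1" by simp
  finally show ?thesis .
qed

text \<open>
  Here the orbit of \<open>v\<close> under \<open>x\<close> and \<open>y\<close> is a single cycle of \<open>z = x y\<close>. If its length is odd, a
  reflection of this cycle interchanges \<open>x\<close> and \<open>y\<close>; if it is even, the rotation by half the length
  is an obstruction.
\<close>

lemma orbit_with_fixed_point:
  assumes nobs: "\<not> sign_obstruction A x y"
    and B: "B \<subseteq> A" "x ` B \<subseteq> B" "y ` B \<subseteq> B" and v: "v \<in> B" "x v = v"
  shows "\<exists>K t. K \<subseteq> B \<and> K \<noteq> {} \<and> x ` K = K \<and> y ` K = K \<and> t ` K \<subseteq> K \<and>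
        (\<forall>w\<in>K. t (t w) = w \<and> t (x w) = y (t w))"
proof -
  define K where "K = range (\<lambda>k. zp k v)"
  have zB: "z ` B \<subseteq> B" using B unfolding z_def by (metis image_comp image_mono subset_trans)
  have KB: "K \<subseteq> B" using ipow_closed[OF N zB v(1)] by (auto simp: K_def)
  have xk: "x (zp k v) = zp (- k) v" and yk: "y (zp k v) = zp (- k - 1) v" for k
    by (simp_all add: x_zp y_zp v)
  have xK: "x ` K \<subseteq> K" and yK: "y ` K \<subseteq> K" using xk yk by (auto simp: K_def)
  have "x ` K = K" using xK xx by (auto simp: image_iff) (metis image_subset_iff)
  moreover have "y ` K = K" using yK yy by (auto simp: image_iff) (metis image_subset_iff)
  moreover have "K \<noteq> {}" by (auto simp: K_def)
  moreover have "\<exists>t. t ` K \<subseteq> K \<and> (\<forall>w\<in>K. t (t w) = w \<and> t (x w) = y (t w))"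
  proof -
    \<comment> \<open>The length of the z-cycle through v: by \<open>dvd\<close> and
      \<open>zpeq\<close> below, \<open>zp k v\<close> depends exactly on k modulo m.\<close>
    define m where "m = (LEAST m. m > 0 \<and> zp (int m) v = v)"
    have ex: "N > 0 \<and> zp (int N) v = v" using N by (simp add: ipow_def)
    then have m: "m > 0" "zp (int m) v = v"
      unfolding m_def using LeastI[of "\<lambda>m. m > 0 \<and> zp (int m) v = v" N] by auto
    have least: "m \<le> j" if "j > 0" "zp (int j) v = v" for j
      unfolding m_def using that by (intro Least_le) auto
    have mult: "zp (int m * i) v = v" for i
    proof (induction i rule: int_induct[where k = 0])
      case base
      then show ?case by (simp add: zp_0)
    next
      case (step1 i)
      then show ?case using zp_add[of "int m * i" "int m" v] m(2) by (simp add: algebra_simps)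
    next
      case (step2 i)
      have "zp (int m * i) v = zp (int m * (i - 1)) (zp (int m) v)"
        by (simp add: zp_add[symmetric] algebra_simps)
      then show ?case using step2 m(2) by simp
    qed
    have dvd: "int m dvd k" if "zp k v = v" for k
    proof -
      have "zp (k mod int m) v = zp (k mod int m) (zp (int m * (k div int m)) v)" by (simp add: mult)
      also have "\<dots> = v" using that by (simp add: zp_add[symmetric])
      finally have "zp (int (nat (k mod int m))) v = v" using m(1) by simp
      then have "\<not> nat (k mod int m) > 0" using least[of "nat (k mod int m)"] m(1)
        by (metis nat_less_iff not_le of_nat_0_less_iff pos_mod_bound pos_mod_sign)
      moreover have "k mod int m \<ge> 0" using m(1) by simp
      ultimately show ?thesis by (simp add: dvd_eq_mod_eq_0)
    qed
    have zpeq: "zp k v = zp l v" if "int m dvd k - l" for k l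
    proof -
      obtain i where i: "k - l = int m * i" using \<open>int m dvd k - l\<close> by blast
      then have "k = l + int m * i" by simp
      then show ?thesis by (simp add: zp_add mult)
    qed
    show ?thesis
    proof (cases "odd m")
      case True
      then obtain c where c: "m = 2 * c + 1" by (auto elim: oddE)
      \<comment> \<open>On exponents x is k \<mapsto> -k and y is k \<mapsto> -k - 1. The reflection
        k \<mapsto> c - k carries one to the other because c + k and k - c - 1 differ by 2 c + 1 =
        m.\<close>
      obtain t where t: "\<And>k. t (zp k v) = zp (int c - k) v" using ipow_reflection[OF N, of v "int c"] by blast
      have "t (t w) = w \<and> t (x w) = y (t w)" if w: "w \<in> K" for w
      proof -
        obtain k where k: "w = zp k v" using w by (auto simp: K_def)
        have "zp (int c + k) v = zp (k - int c - 1) v" by (rule zpeq) (simp add: c add.commute)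
        then show ?thesis by (simp add: k t xk yk)
      qed
      moreover have "t ` K \<subseteq> K" by (auto simp: K_def t)
      ultimately show ?thesis by blast
    next
      case False
      then obtain M where M: "m = 2 * M" by (auto elim: evenE)
      then have M0: "M > 0" using m(1) by simp
      \<comment> \<open>Rotation by half the length commutes with both reflections since M and -M
        agree modulo m. On K, x fixes the exponents with 2 k = 0 modulo m, namely 0 and M, which s
        exchanges; y fixes nothing there, since 2 k + 1 is odd and m even.\<close>
      define s where "s w = (if w \<in> K then zp (int M) w else w)" for w
      have sk: "s (zp k v) = zp (int M + k) v" for k by (auto simp: s_def K_def zp_add)
      have sK: "s w \<in> K" if "w \<in> K" for w using that sk by (auto simp: K_def)
      have "s (s w) = w" for w
      proof (cases "w \<in> K")
        case True
        then obtain k where "w = zp k v" by (auto simp: K_def)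
        moreover have "zp (int M + (int M + k)) v = zp k v" by (rule zpeq) (simp add: M)
        ultimately show ?thesis by (simp add: sk)
      qed (simp add: s_def)
      then have "s permutes A" using KB B(1) by (intro involution_permutes) (auto simp: s_def)
      moreover have "s (x w) = x (s w)" for w
      proof (cases "w \<in> K")
        case True
        then obtain k where "w = zp k v" by (auto simp: K_def)
        moreover have "zp (int M - k) v = zp (- int M - k) v" by (rule zpeq) (simp add: M)
        ultimately show ?thesis by (simp add: sk xk)
      next
        case False
        then have "x w \<notin> K" using xK xx by (metis image_subset_iff)
        then show ?thesis using False by (simp add: s_def)
      qed
      then have "s \<circ> x = x \<circ> s" by auto
      moreover have "s (y w) = y (s w)" for w
      proof (cases "w \<in> K")
        case True
        then obtain k where "w = zp k v" by (auto simp: K_def)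
        moreover have "zp (int M + (- k - 1)) v = zp (- (int M + k) - 1) v" by (rule zpeq) (simp add: M)
        ultimately show ?thesis by (simp add: sk yk)
      next
        case False
        then have "y w \<notin> K" using yK yy by (metis image_subset_iff)
        then show ?thesis using False by (simp add: s_def)
      qed
      then have "s \<circ> y = y \<circ> s" by auto
      moreover have "zp (int M) v \<noteq> v" using dvd[of "int M"] M0 by (auto simp: M dest: zdvd_imp_le)
      moreover have "x (zp (int M) v) = zp (int M) v" unfolding xk by (rule zpeq) (simp add: M)
      moreover have "s w = transpose v (zp (int M) v) w" if "x w = w" for w
      proof (cases "w \<in> K")
        case True
        then obtain k where k: "w = zp k v" by (auto simp: K_def)
        then have "zp k (zp k v) = zp k (zp (- k) v)" using that xk by simp
        then have "zp (k + k) v = v" by (simp only: zp_add ipow_minus[OF N])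
        then have "int m dvd k + k" by (rule dvd)
        then have "int M dvd k" using M0 by (auto simp: M dvd_def)
        then obtain i where i: "k = int M * i" by blast
        show ?thesis
        proof (cases "even i")
          case True
          then have "zp k v = zp 0 v" using i by (intro zpeq) (auto simp: M elim!: evenE)
          then show ?thesis using k sk[of 0] by (simp add: zp_0)
        next
          case False
          then obtain j where j: "i = 2 * j + 1" by (auto elim: oddE)
          have "zp k v = zp (int M) v" by (rule zpeq) (simp add: i j M algebra_simps)
          moreover have "zp (int M + int M) v = zp 0 v" by (rule zpeq) (simp add: M)
          ultimately show ?thesis using k sk[of "int M"] by (simp add: zp_0)
        qed
      next
        case False
        moreover have "zp 0 v \<in> K" "zp (int M) v \<in> K" unfolding K_def by blast+
        ultimately show ?thesis by (auto simp: s_def zp_0 transpose_def)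
      qed
      moreover have "s w = w" if "y w = w" for w
      proof (cases "w \<in> K")
        case True
        then obtain k where k: "w = zp k v" by (auto simp: K_def)
        then have "zp (k + 1) (zp k v) = zp (k + 1) (zp (- k - 1) v)" using that yk by simp
        then have "zp (2 * k + 1) v = v" by (simp add: zp_add[symmetric] zp_0 algebra_simps)
        then have "int m dvd 2 * k + 1" by (rule dvd)
        then have "even (2 * k + 1)" by (metis M dvd_mult_left int_dvd_int_iff of_nat_mult of_nat_numeral)
        then show ?thesis by simp
      qed (simp add: s_def)
      moreover have "v \<in> A" "zp (int M) v \<in> A" using v B(1) KB by (auto simp: K_def)
      ultimately have "sign_obstruction A x y"
        unfolding sign_obstruction_def using v(2) by metis
      then show ?thesis using nobs by blast
    qed
  qed
  ultimately show ?thesis using KB by blast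
qed

text \<open>The orbit consists of two z-cycles interchanged by x and by y. Were they equal, x v
  would be z^i v for some i, and then x (i even) or y (i odd) would fix a point halfway
  between.\<close>

lemma orbit_without_fixed_point:
  assumes B: "x ` B \<subseteq> B" "y ` B \<subseteq> B" and v: "v \<in> B"
    and nofix: "\<And>w. w \<in> B \<Longrightarrow> x w \<noteq> w" "\<And>w. w \<in> B \<Longrightarrow> y w \<noteq> w"
  shows "\<exists>K t. K \<subseteq> B \<and> K \<noteq> {} \<and> x ` K = K \<and> y ` K = K \<and> t ` K \<subseteq> K \<and>
        (\<forall>w\<in>K. t (t w) = w \<and> t (x w) = y (t w))"
proof -
  define K1 where "K1 = range (\<lambda>k. zp k v)"
  define K2 where "K2 = range (\<lambda>k. zp k (x v))"
  have zB: "z ` B \<subseteq> B" using B unfolding z_def by (metis image_comp image_mono subset_trans)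
  have zpB: "zp k w \<in> B" if "w \<in> B" for k w using ipow_closed[OF N zB that] .
  have KB: "K1 \<union> K2 \<subseteq> B" using zpB v B by (auto simp: K1_def K2_def)
  have disj: "K1 \<inter> K2 = {}"
  proof (rule ccontr)
    assume "K1 \<inter> K2 \<noteq> {}"
    then obtain k l where "zp k v = zp l (x v)" by (auto simp: K1_def K2_def)
    then have "zp (- l) (zp k v) = x v" by (simp add: ipow_minus[OF N])
    then have *: "x v = zp (k - l) v" by (simp add: zp_add[symmetric])
    obtain j where "k - l = 2 * j \<or> k - l = 2 * j + 1" by (metis evenE oddE)
    then show False
    proof
      assume "k - l = 2 * j"
      then have "x (zp j v) = zp j v" using * by (simp add: x_zp zp_add[symmetric])
      then show False using nofix(1)[OF zpB[OF v]] by blast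
    next
      assume "k - l = 2 * j + 1"
      then have "y (zp j v) = zp j v" using * by (simp add: y_zp zp_add[symmetric])
      then show False using nofix(2)[OF zpB[OF v]] by blast
    qed
  qed
  obtain t1 where t1: "\<And>k. t1 (zp k v) = zp (0 - k) v" using ipow_reflection[OF N, of v 0] by blast
  \<comment> \<open>With k \<mapsto> -k on the first cycle, the intertwining relation forces k
    \<mapsto> -1 - k on the second.\<close>
  obtain t2 where t2: "\<And>k. t2 (zp k (x v)) = zp (-1 - k) (x v)" using ipow_reflection[OF N, of "x v" "-1"] by blast
  define t where "t w = (if w \<in> K1 then t1 w else t2 w)" for w
  have T1: "t (zp k v) = zp (- k) v" for k using t1 by (auto simp: t_def K1_def)
  have T2: "t (zp k (x v)) = zp (-1 - k) (x v)" for k using t2 disj by (auto simp: t_def K2_def)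
  have x1: "x (zp k v) = zp (- k) (x v)" and x2: "x (zp k (x v)) = zp (- k) v"
    and y1: "y (zp k v) = zp (- k - 1) (x v)" and y2: "y (zp k (x v)) = zp (- k - 1) v" for k
    by (simp_all add: x_zp y_zp xx)
  have xK: "x ` (K1 \<union> K2) \<subseteq> K1 \<union> K2" and yK: "y ` (K1 \<union> K2) \<subseteq> K1 \<union> K2"
    and tK: "t ` (K1 \<union> K2) \<subseteq> K1 \<union> K2"
    by (auto simp: K1_def K2_def x1 x2 y1 y2 T1 T2)
  have "x ` (K1 \<union> K2) = K1 \<union> K2"
    using xK xx by (metis (no_types, opaque_lifting) image_eqI image_subset_iff subsetI subset_antisym)
  moreover have "y ` (K1 \<union> K2) = K1 \<union> K2"
    using yK yy by (metis (no_types, opaque_lifting) image_eqI image_subset_iff subsetI subset_antisym)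
  moreover have "\<forall>w\<in>K1 \<union> K2. t (t w) = w \<and> t (x w) = y (t w)"
    by (auto simp: K1_def K2_def x1 x2 y1 y2 T1 T2)
  moreover have "K1 \<union> K2 \<noteq> {}" by (auto simp: K1_def)
  ultimately show ?thesis using KB tK by blast
qed

theorem swapping_involution:
  assumes nobs: "\<not> sign_obstruction A x y" "\<not> sign_obstruction A y x"
  shows "\<exists>t. t permutes A \<and> (\<forall>w. t (t w) = w) \<and> (\<forall>w. t (x w) = y (t w))"
proof -
  have "\<exists>t. t permutes A \<and> (\<forall>w. t (t w) = w) \<and> (\<forall>w\<in>A. t (x w) = y (t w))"
  proof (rule glue_orbits[OF fin])
    show "inj_on x A" "inj_on y A" "x ` A \<subseteq> A" "y ` A \<subseteq> A"
      using xA yA by (auto simp: permutes_inj_on permutes_image)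
    fix B assume B: "B \<subseteq> A" "B \<noteq> {}" "x ` B \<subseteq> B" "y ` B \<subseteq> B"
    consider v where "v \<in> B" "x v = v" | v where "v \<in> B" "y v = v"
      | v where "v \<in> B" "\<And>w. w \<in> B \<Longrightarrow> x w \<noteq> w" "\<And>w. w \<in> B \<Longrightarrow> y w \<noteq> w"
      using B(2) by (meson ex_in_conv)
    then show "\<exists>K t. K \<subseteq> B \<and> K \<noteq> {} \<and> x ` K = K \<and> y ` K = K \<and> t ` K \<subseteq> K \<and>
        (\<forall>w\<in>K. t (t w) = w \<and> t (x w) = y (t w))"
    proof cases
      case 1
      then show ?thesis by (rule orbit_with_fixed_point[OF nobs(1) B(1,3,4)])
    next
      case 2
      from involution_pair.orbit_with_fixed_point[OF swapped nobs(2) B(1,4,3) 2]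
      obtain K t where K: "K \<subseteq> B" "K \<noteq> {}" "y ` K = K" "x ` K = K" "t ` K \<subseteq> K"
        "\<forall>w\<in>K. t (t w) = w \<and> t (y w) = x (t w)" by (elim exE conjE) (rule that)
      \<comment> \<open>The roles were exchanged, so t is known to carry y to x; being an involution
        on K, it also carries x to y.\<close>
      have "t (x w) = y (t w)" if "w \<in> K" for w
      proof -
        have tw: "t w \<in> K" using K(5) that by blast
        then have e: "t (y (t w)) = x w" using K(6) that by simp
        have "y (t w) \<in> K" using K(3) tw by blast
        then have "t (t (y (t w))) = y (t w)" using K(6) by simp
        then show ?thesis by (simp add: e)
      qed
      then show ?thesis using K by (intro exI[of _ K] exI[of _ t]) simp
    next
      case 3
      then show ?thesis by (rule orbit_without_fixed_point[OF B(3,4)])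
    qed
  qed
  then obtain t where t: "t permutes A" "\<forall>w. t (t w) = w" "\<forall>w\<in>A. t (x w) = y (t w)" by blast
  have "t (x w) = y (t w)" if "w \<notin> A" for w
    using that t(1) xA yA by (simp add: permutes_not_in)
  then show ?thesis using t by blast
qed

end

section \<open>Pairs of permutations that cannot be interchanged\<close>

text \<open>What remains of "g^-1 lies in H g H" when signs are forgotten. Injectivity of t is
  enough to transport both equations and inequations between x and y.\<close>

definition swappable :: "('a \<Rightarrow> 'a) \<Rightarrow> ('a \<Rightarrow> 'a) \<Rightarrow> bool"
  where "swappable x y \<longleftrightarrow> (\<exists>t. inj t \<and> (\<forall>w. t (x w) = y (t w)) \<and> (\<forall>w. t (y w) = x (t w)))"

text \<open>
  In each of the next four lemmas a property of the pair \<open>(x, y)\<close> that is invariant under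
  relabelling holds for \<open>(x, y)\<close> but fails for \<open>(y, x)\<close>. Here: some fixed point of \<open>x\<close> is moved
  by \<open>y\<close> to another one.
\<close>

lemma not_swappable_two_fixed_points:
  assumes x: "inj x" and fixed: "x p = p" "x q = q" "p \<noteq> q"
    and id: "x i \<noteq> i" "x d \<noteq> d" "d \<noteq> i" "x i \<noteq> d" "x d \<noteq> i"
    and g: "g = transpose i p \<circ> (transpose d q \<circ> transpose d (x i))"
    and y: "\<And>w. y (g w) = g (x w)"
  shows "\<not> swappable x y"
proof
  assume "swappable x y"
  then obtain t where t: "inj t" "\<And>w. t (x w) = y (t w)" "\<And>w. t (y w) = x (t w)"
    by (auto simp: swappable_def)
  have dist: "p \<noteq> i" "p \<noteq> d" "q \<noteq> i" "q \<noteq> d" "p \<noteq> x i" "q \<noteq> x i"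
    using fixed id x by (auto dest: injD)
  have g_pts: "g i = p" "g p = i" "g d = x i" "g (x i) = q" "g q = d"
    using dist fixed id by (auto simp: g transpose_def)
  have g_id: "g w = w" if "w \<noteq> i" "w \<noteq> p" "w \<noteq> d" "w \<noteq> q" "w \<noteq> x i" for w
    using that by (simp add: g transpose_def)
  have "inj g" unfolding g by (intro inj_compose inj_transpose)
  have surj: "\<exists>w. u = g w" for u
    using g_pts g_id by metis
  \<comment> \<open>The fixed points of y are the g-images of those of x, and g maps p to i and q to
    d.\<close>
  have fixy: "u = i \<or> u = d \<or> x u = u" if yu: "y u = u" for u
  proof -
    obtain w where w: "u = g w" using surj by blast
    then have "g (x w) = g w" using yu y by simp
    then have "x w = w" using \<open>inj g\<close> by (simp add: inj_eq)
    then show ?thesis using w g_pts g_id[of w] id fixed x by (metis injD)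
  qed
  have "y p = q" using y[of i] g_pts by simp
  \<comment> \<open>Transported by t, the property says that u and x u are both fixed by y and moved
    by x. So both lie in {i, d}, although neither x i = d nor x d = i.\<close>
  define u where "u = t p"
  have 1: "y u = u" using t(2)[of p] fixed by (simp add: u_def)
  have xu: "x u = t q" using t(3)[of p] \<open>y p = q\<close> by (simp add: u_def)
  then have 2: "x u \<noteq> u" using \<open>p \<noteq> q\<close> t(1) by (simp add: u_def inj_eq)
  have 3: "y (x u) = x u" using t(2)[of q] fixed by (simp add: xu)
  have "x u = i \<or> x u = d \<or> x (x u) = x u" by (rule fixy[OF 3])
  moreover have "x (x u) \<noteq> x u" using 2 x by (simp add: inj_eq)
  ultimately show False using fixy[OF 1] 2 id by metis
qed

text \<open>Here: some \<open>u\<close> satisfies \<open>y u = x\<^sup>2 u\<close> and \<open>x (y u) \<noteq> y (y u)\<close>, namely \<open>u = b\<close>.\<close>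

lemma not_swappable_long_cycle:
  assumes x: "inj x" and c: "x c = b" "x b = a" "x a = a1" "x a1 = a2" "x a2 = a3"
    and long: "a1 \<noteq> a" "a2 \<noteq> a" "a3 \<noteq> a"
    and f: "f \<noteq> c" "f \<noteq> b" "f \<noteq> a" "f \<noteq> a1" "f \<noteq> a2" "f \<noteq> a3"
    and g: "g = transpose a f \<circ> transpose a a1"
    and y: "\<And>w. y (g w) = g (x w)"
  shows "\<not> swappable x y"
proof
  assume "swappable x y"
  then obtain t where t: "inj t" "\<And>w. t (x w) = y (t w)" "\<And>w. t (y w) = x (t w)"
    by (auto simp: swappable_def)
  have xx: "x v = x w \<longleftrightarrow> v = w" for v w using x by (simp add: inj_eq)
  have d: "b \<noteq> a" "b \<noteq> a1" "b \<noteq> a2" "a1 \<noteq> a2" "a1 \<noteq> a3" "a2 \<noteq> a3" "c \<noteq> b" "c \<noteq> a" "c \<noteq> a1"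
    using c long by (metis xx)+
  have g_pts: "g a = a1" "g a1 = f" "g f = a" using f long by (auto simp: g transpose_def)
  have g_id: "g w = w" if "w \<noteq> a" "w \<noteq> a1" "w \<noteq> f" for w using that by (simp add: g transpose_def)
  have "inj g" unfolding g by (intro inj_compose inj_transpose)
  have "inj y"
  proof (rule injI)
    fix v w assume e: "y v = y w"
    obtain v' w' where vw: "v = g v'" "w = g w'" using g_pts g_id by metis
    then have "g (x v') = g (x w')" using e y by simp
    then show "v = w" using vw \<open>inj g\<close> x by (simp add: inj_eq)
  qed
  then have yy: "y v = y w \<longleftrightarrow> v = w" for v w by (simp add: inj_eq)
  have y_b: "y b = a1" using y[of b] g_id[of b] d f g_pts c by simp
  have y_a1: "y a1 = f" using y[of a] g_pts c by simp
  have y_f: "y f = a2" using y[of a1] g_pts c g_id[of a2] long d f by simp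
  have y_a: "y a = (if x f = f then a else x f)"
    using y[of f] g_pts g_id[of "x f"] c f xx by metis
  have y_pre: "y w = a" if "x w = f" "w \<noteq> f" for w
    using y[of w] g_id[of w] that g_pts c f by metis
  have y_eq: "y w = x w" if "w \<noteq> b" "w \<noteq> a" "w \<noteq> a1" "w \<noteq> f" "x w \<noteq> f" for w
    using y[of w] g_id[of w] g_id[of "x w"] that c xx by metis
  define u where "u = t b"
  \<comment> \<open>Transporting the property of b exchanges the roles: x u = y (y u) and y (x u)
    \<noteq> x (x u).\<close>
  have e1: "x u = y (y u)" using t(3)[of b] t(2)[of b] t(2)[of a] y_b c by (simp add: u_def)
  have "x (y b) \<noteq> y (y b)" using y_b y_a1 c f by simp
  then have "t (x (y b)) \<noteq> t (y (y b))" using t(1) by (simp add: inj_eq)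
  then have e2: "y (x u) \<noteq> x (x u)" using t(2,3) by (simp add: u_def)
  \<comment> \<open>By \<open>y_eq\<close>, x and y can differ only at b, a, a1, f and the preimage
    of f under x; since they differ at x u, one of these is x u.\<close>
  consider "x u = a" | "x u = a1" | "x u = f" | "x u = b" | "x (x u) = f" "x u \<noteq> f"
    using e2 y_eq by metis
  then show False
  proof cases
    case 1
    then have "u = b" using c xx by metis
    then show False using e1 y_b y_a1 1 f by simp
  next
    case 2
    then have u: "u = a" using c xx by metis
    show False
    proof (cases "x f = f")
      case True
      then show False using e1 y_a u 2 long by simp
    next
      case False
      then have "y (x f) = y b" using e1 y_a u 2 y_b by simp
      then show False using yy c f xx by metis
    qed
  next
    case 3
    show False
    proof (cases "u = f")
      case True
      then have "y a2 = y a1" using e1 3 y_f y_a1 by simp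
      then show False using yy d by simp
    next
      case False
      then have "x f \<noteq> f" using 3 xx by metis
      then show False using e1 3 y_pre[OF 3 False] y_a by simp
    qed
  next
    case 4
    then have u: "u = c" using c xx by metis
    then have "y c = b" using y_eq[of c] c d f by simp
    then show False using e1 4 u y_b d by simp
  next
    case 5
    have na: "u \<noteq> a" "u \<noteq> a1" "u \<noteq> b" using 5 c f by auto
    show False
    proof (cases "u = f")
      case True
      have "y a2 = a3" using y_eq[of a2] c d f long by simp
      then show False using e1 True y_f c f xx by metis
    next
      case False
      then have "y u = x u" using y_eq na 5 by simp
      then have "x u = a" using e1 y_pre[OF 5] by simp
      then show False using 5 c f by simp
    qed
  qed
qed

text \<open>
  Here \<open>p\<close> is the only fixed point of \<open>x\<close> moved by \<open>y\<close>, and \<open>c\<close> the only one of \<open>y\<close> moved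
  by \<open>x\<close>, so a swap exchanges them; but \<open>x (y p) = c\<close> while \<open>y (x c) \<noteq> p\<close>.
\<close>

lemma not_swappable_fixed_point:
  assumes x: "inj x" and c: "x c = d" "x d = b" "x b = c" "c \<noteq> d"
    and p: "x p = p" and f: "x f \<noteq> f" "f \<noteq> b" "f \<noteq> c" "f \<noteq> d"
    and g: "g = (transpose f c \<circ> transpose f p) \<circ> transpose (x f) b"
    and y: "\<And>w. y (g w) = g (x w)"
  shows "\<not> swappable x y"
proof
  assume "swappable x y"
  then obtain t where t: "inj t" "\<And>w. t (x w) = y (t w)" "\<And>w. t (y w) = x (t w)"
    by (auto simp: swappable_def)
  have xx: "x v = x w \<longleftrightarrow> v = w" for v w using x by (simp add: inj_eq)
  have d: "b \<noteq> c" "b \<noteq> d" "p \<noteq> b" "p \<noteq> c" "p \<noteq> d" "p \<noteq> f" "x f \<noteq> b" "x f \<noteq> c" "x f \<noteq> d" "x f \<noteq> p"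
    using c p f by (metis xx)+
  have g_pts: "g f = p" "g p = c" "g c = f" "g (x f) = b" "g b = x f"
    using d f c by (auto simp: g transpose_def)
  have g_id: "g w = w" if "w \<noteq> f" "w \<noteq> p" "w \<noteq> c" "w \<noteq> x f" "w \<noteq> b" for w
    using that by (simp add: g transpose_def)
  have "inj g" unfolding g by (intro inj_compose inj_transpose)
  have fixy: "u = c \<or> x u = u" if yu: "y u = u" for u
  proof -
    obtain w where w: "u = g w" using g_pts g_id by metis
    then have "g (x w) = g w" using yu y by simp
    then have "x w = w" using \<open>inj g\<close> by (simp add: inj_eq)
    then show ?thesis using w g_pts g_id[of w] f c p xx by metis
  qed
  have yp: "y p = b" using y[of f] g_pts by simp
  have yc: "y c = c" using y[of p] g_pts p by simp
  have yd: "y d = x f" using y[of d] g_id[of d] d f c g_pts by simp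
  \<comment> \<open>t p is fixed by y and moved by x, which leaves only c. Following p \<mapsto> b
    under y and b \<mapsto> c under x gives t c = x f, and y c = c then makes x f a fixed point of
    x.\<close>
  have 1: "y (t p) = t p" using t(2)[of p] p by simp
  have 2: "x (t p) \<noteq> t p" using t(1) t(3)[of p] yp d(3) by (metis injD)
  have "t p = c" using fixy[OF 1] 2 by simp
  then have "t b = d" using t(3)[of p] yp c by simp
  then have "t c = x f" using t(2)[of b] c yd by simp
  then have "x (x f) = x f" using t(3)[of c] yc by simp
  then show False using f xx by simp
qed

text \<open>Here: \<open>x y x y x\<close> has a fixed point at which \<open>x\<close> and \<open>y\<close> differ.\<close>

lemma not_swappable_three_cycles:
  assumes x: "inj x" and a: "x a0 = a1" "x a1 = a2" "x a2 = a0"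
    and f: "x f0 = f1" "x f1 = f0 \<or> x f1 = f2 \<and> x f2 = f0 \<and> f2 \<noteq> f0 \<and> f2 \<noteq> f1"
    and h: "x h0 = h1" "x h1 = h0 \<or> x h1 = h2 \<and> x h2 = h0 \<and> h2 \<noteq> h0 \<and> h2 \<noteq> h1"
    and d: "distinct [a0, a1, a2, f0, f1, h0, h1]"
    and g: "g = transpose a0 h1 \<circ> (transpose a0 h0 \<circ> (transpose a0 f1 \<circ> (transpose a0 a1 \<circ> transpose a0 f0)))"
    and y: "\<And>w. y (g w) = g (x w)"
  shows "\<not> swappable x y"
proof
  assume "swappable x y"
  then obtain t where t: "inj t" "\<And>w. t (x w) = y (t w)" "\<And>w. t (y w) = x (t w)"
    by (auto simp: swappable_def)
  have xx: "x v = x w \<longleftrightarrow> v = w" for v w using x by (simp add: inj_eq)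
  \<comment> \<open>g is the six-cycle (a0 f0 a1 f1 h0 h1).\<close>
  have g_pts: "g a0 = f0" "g f0 = a1" "g a1 = f1" "g f1 = h0" "g h0 = h1" "g h1 = a0"
    using d by (auto simp: g transpose_def)
  have g_id: "g w = w" if "w \<notin> {a0, a1, f0, f1, h0, h1}" for w
    using that by (simp add: g transpose_def)
  have e: "y f0 = f1" "y f1 = a2" "y a2 = f0" "y a1 = h0" "y h1 = a0"
    using y[of a0] y[of a1] y[of a2] y[of f0] y[of h0] a f(1) h(1) g_pts g_id[of a2] d by auto
  have y_eq: "y w = x w" if "w \<notin> {a0, a1, a2, f0, f1, h0, h1}" "x w \<notin> {a0, a1, f0, f1, h0, h1}" for w
    using y[of w] g_id[of w] g_id[of "x w"] that by simp
  \<comment> \<open>The witness v for x y x y x becomes a witness q = t v for y x y x y. It is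
    instantiated with a2 if f0 lies on a 2-cycle and with f1 if it lies on a 3-cycle.\<close>
  have D: "\<exists>q. x q \<noteq> y q \<and> y (x (y (x (y q)))) = q" if "x v \<noteq> y v" "x (y (x (y (x v)))) = v" for v
  proof (intro exI conjI)
    show "x (t v) \<noteq> y (t v)" using t that(1) by (metis injD)
    show "y (x (y (x (y (t v))))) = t v" using t(2,3) that(2) by metis
  qed
  \<comment> \<open>The cycles of f0 and h0 have length two or three independently. In each case x
    and y agree outside the listed points, so finitely many q have to be refuted.\<close>
  consider "x f1 = f0" "x h1 = h0"
    | "x f1 = f0" "x h1 = h2" "x h2 = h0" "h2 \<noteq> h0" "h2 \<noteq> h1"
    | "x f1 = f2" "x f2 = f0" "f2 \<noteq> f0" "f2 \<noteq> f1" "x h1 = h0"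
    | "x f1 = f2" "x f2 = f0" "f2 \<noteq> f0" "f2 \<noteq> f1" "x h1 = h2" "x h2 = h0" "h2 \<noteq> h0" "h2 \<noteq> h1"
    using f(2) h(2) by blast
  then show False
  proof cases
    case 1
    note c = 1
    have Y: "y h0 = a1" "y a0 = h1"
      using y[of f1] y[of h1] a f(1) h(1) c g_pts d by auto
    note E = a f(1) h(1) c e Y
    obtain q where q: "x q \<noteq> y q" "y (x (y (x (y q)))) = q"
      using D[of a2] E d by auto
    have "q \<in> {a0, a1, a2, f0, f1, h0, h1}"
    proof (rule ccontr)
      assume n: "q \<notin> {a0, a1, a2, f0, f1, h0, h1}"
      then have "x q \<notin> {a0, a1, f0, f1, h0, h1}" using a f(1) h(1) c xx by (simp, metis)
      then show False using y_eq[of q] q(1) n by simp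
    qed
    then show False using q E d by auto
  next
    case 2
    note c = 2
    have nd: "h2 \<notin> {a0, a1, a2, f0, f1, h0, h1}"
      using a f(1) h(1) c d xx by simp_all metis+
    have Y: "y h0 = a1" "y a0 = h2" "y h2 = h1"
      using y[of f1] y[of h1] y[of h2] g_id[of h2] a f(1) h(1) c g_pts nd d by auto
    note E = a f(1) h(1) c e Y
    obtain q where q: "x q \<noteq> y q" "y (x (y (x (y q)))) = q"
      using D[of a2] E d nd by auto
    have "q \<in> {a0, a1, a2, f0, f1, h0, h1, h2}"
    proof (rule ccontr)
      assume n: "q \<notin> {a0, a1, a2, f0, f1, h0, h1, h2}"
      then have "x q \<notin> {a0, a1, f0, f1, h0, h1}" using a f(1) h(1) c xx by (simp, metis)
      then show False using y_eq[of q] q(1) n by simp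
    qed
    then show False using q E d nd by auto
  next
    case 3
    note c = 3
    have nd: "f2 \<notin> {a0, a1, a2, f0, f1, h0, h1}"
      using a f(1) h(1) c d xx by simp_all metis+
    have Y: "y h0 = f2" "y f2 = a1" "y a0 = h1"
      using y[of f1] y[of h1] y[of f2] g_id[of f2] a f(1) h(1) c g_pts nd d by auto
    note E = a f(1) h(1) c e Y
    obtain q where q: "x q \<noteq> y q" "y (x (y (x (y q)))) = q"
      using D[of f1] E d nd by auto
    have "q \<in> {a0, a1, a2, f0, f1, h0, h1, f2}"
    proof (rule ccontr)
      assume n: "q \<notin> {a0, a1, a2, f0, f1, h0, h1, f2}"
      then have "x q \<notin> {a0, a1, f0, f1, h0, h1}" using a f(1) h(1) c xx by (simp, metis)
      then show False using y_eq[of q] q(1) n by simp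
    qed
    then show False using q E d nd by auto
  next
    case 4
    note c = 4
    have nd: "f2 \<notin> {a0, a1, a2, f0, f1, h0, h1}" "h2 \<notin> {a0, a1, a2, f0, f1, h0, h1}" "f2 \<noteq> h2"
      using a f(1) h(1) c d xx by simp_all metis+
    have Y: "y h0 = f2" "y f2 = a1" "y a0 = h2" "y h2 = h1"
      using y[of f1] y[of h1] y[of f2] y[of h2] g_id[of f2] g_id[of h2] a f(1) h(1) c g_pts nd d by auto
    note E = a f(1) h(1) c e Y
    obtain q where q: "x q \<noteq> y q" "y (x (y (x (y q)))) = q"
      using D[of f1] E d nd by auto
    have "q \<in> {a0, a1, a2, f0, f1, h0, h1, f2, h2}"
    proof (rule ccontr)
      assume n: "q \<notin> {a0, a1, a2, f0, f1, h0, h1, f2, h2}"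
      then have "x q \<notin> {a0, a1, f0, f1, h0, h1}" using a f(1) h(1) c xx by (simp, metis)
      then show False using y_eq[of q] q(1) n by simp
    qed
    then show False using q E d nd by auto
  qed
qed

section \<open>Involutions interchanging two 3-cycles or two transpositions\<close>

lemma three_cycle_involution:
  fixes x y :: "'a \<Rightarrow> 'a"
  assumes x: "x a = b" "x b = c" "x c = a" "\<And>w. w \<notin> {a, b, c} \<Longrightarrow> x w = w"
    and y: "y d = e" "y e = f" "y f = d" "\<And>w. w \<notin> {d, e, f} \<Longrightarrow> y w = w"
    and dist: "distinct [a, b, c]" "distinct [d, e, f]"
    and A: "{a, b, c, d, e, f} \<subseteq> A"
  shows "\<exists>t. t permutes A \<and> (\<forall>w. t (t w) = w) \<and> (\<forall>w. t (x w) = y (t w))"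
proof -
  have main: "\<exists>t. t permutes A \<and> (\<forall>w. t (t w) = w) \<and> (\<forall>w. t (x w) = y (t w))"
    if y: "y d = e" "y e = f" "y f = d" "\<And>w. w \<notin> {d, e, f} \<Longrightarrow> y w = w"
      and dist: "distinct [d, e, f]" and A: "{a, b, c, d, e, f} \<subseteq> A"
      and compat: "a = e \<longleftrightarrow> b = d" "a = f \<longleftrightarrow> c = d" "b = f \<longleftrightarrow> c = e" for d e f
  proof -
    \<comment> \<open>\<open>compat\<close> expresses that no common point of the two triples is
      assigned two different partners.\<close>
    define t where "t w = (if w = a then d else if w = b then e else if w = c then f
      else if w = d then a else if w = e then b else if w = f then c else w)" for w
    have n: "a \<noteq> b" "a \<noteq> c" "b \<noteq> c" "d \<noteq> e" "d \<noteq> f" "e \<noteq> f"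
      using \<open>distinct [a, b, c]\<close> dist by simp_all
    have t_pts: "t a = d" "t b = e" "t c = f" using n by (simp_all add: t_def)
    have "t d = a" using compat by (cases "d = a"; cases "d = b"; cases "d = c") (simp_all add: t_def)
    moreover have "t e = b"
      using compat n by (cases "e = a"; cases "e = b"; cases "e = c") (simp_all add: t_def)
    moreover have "t f = c"
      using compat n by (cases "f = a"; cases "f = b"; cases "f = c") (simp_all add: t_def)
    ultimately have t_pts: "t a = d" "t b = e" "t c = f" "t d = a" "t e = b" "t f = c"
      using t_pts by simp_all
    have t_id: "t w = w" if "w \<notin> {a, b, c, d, e, f}" for w using that by (simp add: t_def)
    have "t (t w) = w" for w
    proof (cases "w \<in> {a, b, c, d, e, f}")
      case True
      then show ?thesis using t_pts by (elim insertE) simp_all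
    next
      case False
      then show ?thesis using t_id by metis
    qed
    moreover have "t (x w) = y (t w)" for w
    proof (cases "w \<in> {a, b, c}")
      case True
      then show ?thesis using x(1-3) y(1-3) t_pts by (elim insertE) simp_all
    next
      case False
      have "t w \<notin> {d, e, f}"
      proof
        assume "t w \<in> {d, e, f}"
        then have "t (t w) \<in> {a, b, c}" using t_pts by (elim insertE) simp_all
        then show False using False \<open>\<And>w. t (t w) = w\<close> by simp
      qed
      then show ?thesis using x(4)[OF False] y(4) by simp
    qed
    moreover have "t permutes A"
      using A t_id \<open>\<And>w. t (t w) = w\<close> by (intro involution_permutes) blast+
    ultimately show ?thesis by blast
  qed
  have n: "a \<noteq> b" "a \<noteq> c" "b \<noteq> c" "d \<noteq> e" "d \<noteq> f" "e \<noteq> f"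
    using dist by simp_all
  \<comment> \<open>The overlap is a partial injection between the positions of the two triples;
    some rotation of (d, e, f) makes it equal to its own inverse, which is compatibility.\<close>
  consider "(a = e \<longleftrightarrow> b = d) \<and> (a = f \<longleftrightarrow> c = d) \<and> (b = f \<longleftrightarrow> c = e)"
    | "(a = f \<longleftrightarrow> b = e) \<and> (a = d \<longleftrightarrow> c = e) \<and> (b = d \<longleftrightarrow> c = f)"
    | "(a = d \<longleftrightarrow> b = f) \<and> (a = e \<longleftrightarrow> c = f) \<and> (b = e \<longleftrightarrow> c = d)"
    using n by argo
  then show ?thesis
  proof cases
    case 1
    show ?thesis by (rule main[of d e f]) (use 1 y n A in simp_all)
  next
    case 2
    show ?thesis by (rule main[of e f d]) (use 2 y n A in simp_all)
  next
    case 3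
    show ?thesis by (rule main[of f d e]) (use 3 y n A in simp_all)
  qed
qed

lemma transposition_involution:
  fixes x y :: "'a \<Rightarrow> 'a"
  assumes x: "x a = b" "x b = a" "\<And>w. w \<notin> {a, b} \<Longrightarrow> x w = w"
    and y: "y d = e" "y e = d" "\<And>w. w \<notin> {d, e} \<Longrightarrow> y w = w"
    and dist: "a \<noteq> b" "d \<noteq> e"
    and A: "{a, b, d, e} \<subseteq> A"
  shows "\<exists>t. t permutes A \<and> (\<forall>w. t (t w) = w) \<and> (\<forall>w. t (x w) = y (t w))"
proof -
  have main: "\<exists>t. t permutes A \<and> (\<forall>w. t (t w) = w) \<and> (\<forall>w. t (x w) = y (t w))"
    if y: "y d = e" "y e = d" "\<And>w. w \<notin> {d, e} \<Longrightarrow> y w = w"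
      and dist: "d \<noteq> e" and A: "{a, b, d, e} \<subseteq> A" and compat: "a = e \<longleftrightarrow> b = d" for d e
  proof -
    define t where "t w = (if w = a then d else if w = b then e
      else if w = d then a else if w = e then b else w)" for w
    have t_pts: "t a = d" "t b = e" "t d = a" "t e = b"
    proof -
      show "t a = d" by (simp add: t_def)
      show "t b = e" using \<open>a \<noteq> b\<close> by (simp add: t_def)
      show "t d = a" using compat by (cases "d = a"; cases "d = b") (simp_all add: t_def)
      show "t e = b" using compat dist by (cases "e = a"; cases "e = b") (simp_all add: t_def)
    qed
    have t_id: "t w = w" if "w \<notin> {a, b, d, e}" for w using that by (simp add: t_def)
    have "t (t w) = w" for w
    proof (cases "w \<in> {a, b, d, e}")
      case True
      then show ?thesis using t_pts by (elim insertE) simp_all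
    next
      case False
      then show ?thesis using t_id by metis
    qed
    moreover have "t (x w) = y (t w)" for w
    proof (cases "w \<in> {a, b}")
      case True
      then show ?thesis using x(1,2) y(1,2) t_pts by (elim insertE) simp_all
    next
      case False
      have "t w \<notin> {d, e}"
      proof
        assume "t w \<in> {d, e}"
        then have "t (t w) \<in> {a, b}" using t_pts by (elim insertE) simp_all
        then show False using False \<open>\<And>w. t (t w) = w\<close> by simp
      qed
      then show ?thesis using x(3)[OF False] y(3) by simp
    qed
    moreover have "t permutes A"
      using A t_id \<open>\<And>w. t (t w) = w\<close> by (intro involution_permutes) blast+
    ultimately show ?thesis by blast
  qed
  consider "a = e \<longleftrightarrow> b = d" | "a = d \<longleftrightarrow> b = e" using dist by argo
  then show ?thesis
  proof cases
    case 1
    show ?thesis by (rule main[of d e]) (use 1 y dist A in simp_all)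
  next
    case 2
    show ?thesis by (rule main[of e d]) (use 2 y dist A in simp_all)
  qed
qed

section \<open>The centralizer of a fixed-point-free permutation\<close>

lemma sym_group_rest_group: "group (sym_group_rest k n)"
proof (rule groupI)
  show "\<And>p q. p \<in> carrier (sym_group_rest k n) \<Longrightarrow> q \<in> carrier (sym_group_rest k n) \<Longrightarrow>
      p \<otimes>\<^bsub>sym_group_rest k n\<^esub> q \<in> carrier (sym_group_rest k n)"
    by (simp add: sym_group_rest_def sym_group_mult permutes_compose)
  show "\<one>\<^bsub>sym_group_rest k n\<^esub> \<in> carrier (sym_group_rest k n)"
    by (simp add: sym_group_rest_def sym_group_one permutes_id)
  show "\<exists>q\<in>carrier (sym_group_rest k n). q \<otimes>\<^bsub>sym_group_rest k n\<^esub> p = \<one>\<^bsub>sym_group_rest k n\<^esub>"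
    if "p \<in> carrier (sym_group_rest k n)" for p
    using that by (intro bexI[of _ "inv' p"])
      (auto simp: sym_group_rest_def sym_group_mult sym_group_one permutes_inv permutes_inv_o(2))
qed (auto simp: sym_group_rest_def sym_group_mult sym_group_one comp_assoc)

text \<open>Transpositions are conjugate and square to the identity, so they share one value 1 or
  -1; they generate the group.\<close>

lemma multiplicative_on_permutations_cases:
  fixes \<theta> :: "('a \<Rightarrow> 'a) \<Rightarrow> complex"
  assumes fin: "finite X" and one: "\<theta> id = 1"
    and mult: "\<And>p q. p permutes X \<Longrightarrow> q permutes X \<Longrightarrow> \<theta> (p \<circ> q) = \<theta> p * \<theta> q"
  shows "(\<forall>p. p permutes X \<longrightarrow> \<theta> p = 1) \<or> (\<forall>p. p permutes X \<longrightarrow> \<theta> p = of_int (sign p))"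
proof -
  let ?t = "\<lambda>a b. \<theta> (transpose a b)"
  have sw: "transpose a b permutes X" if "a \<in> X" "b \<in> X" for a b
    using that by (rule permutes_swap_id)
  have sign_square: "?t a b * ?t a b = 1" if "a \<in> X" "b \<in> X" for a b
    using mult[OF sw[OF that] sw[OF that]] one by simp
  have step: "?t a b = ?t a c" if "a \<in> X" "b \<in> X" "c \<in> X" "a \<noteq> b" "a \<noteq> c" for a b c
  proof -
    have "transpose b c \<circ> transpose a b \<circ> transpose b c = transpose a c"
      using that by (auto simp: transpose_def fun_eq_iff)
    moreover have "\<theta> (transpose b c \<circ> transpose a b \<circ> transpose b c) = ?t b c * ?t a b * ?t b c"
      using that by (simp add: mult sw permutes_compose)
    ultimately show ?thesis using sign_square[of b c] that by (simp add: mult.assoc mult.left_commute)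
  qed
  have const: "?t a b = ?t c d" if "a \<in> X" "b \<in> X" "c \<in> X" "d \<in> X" "a \<noteq> b" "c \<noteq> d" for a b c d
    using step that by (metis transpose_commute)
  obtain e where e: "e = 1 \<or> e = -1" "\<And>a b. a \<in> X \<Longrightarrow> b \<in> X \<Longrightarrow> a \<noteq> b \<Longrightarrow> ?t a b = e"
  proof (cases "\<exists>a b. a \<in> X \<and> b \<in> X \<and> a \<noteq> b")
    case True
    then obtain a b where ab: "a \<in> X" "b \<in> X" "a \<noteq> b" by blast
    have "?t a b = 1 \<or> ?t a b = -1" using sign_square[OF ab(1,2)] by (simp add: square_eq_1_iff)
    then show ?thesis using that const ab by blast
  next
    case False
    then show ?thesis using that by blast
  qed
  have ind: "\<theta> p = (if e = 1 then 1 else of_int (sign p)) \<and> permutation p" if "p permutes X" for p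
    using that fin
  proof (induction p rule: permutes_induct)
    case id
    have "sign (id :: 'a \<Rightarrow> 'a) = 1" "permutation (id :: 'a \<Rightarrow> 'a)" by (rule sign_id, rule permutation_id)
    then show ?case unfolding one by simp
  next
    case (swap a b p)
    then have "sign (transpose a b \<circ> p) = - sign p"
      by (simp add: sign_compose sign_swap_id permutation_swap_id)
    moreover have "\<theta> (transpose a b \<circ> p) = e * \<theta> p"
      using mult[OF sw[OF swap(1,2)] swap(4)] e(2)[OF swap(1-3)] by simp
    moreover have "permutation (transpose a b \<circ> p)"
      using swap by (simp add: permutation_swap_id permutation_compose)
    ultimately show ?case using swap(5) e(1) by (auto simp del: comp_apply simp: comp_def[symmetric])
  qed
  then show ?thesis by (cases "e = 1") auto
qed

locale centralizer_character =
  fixes n k :: nat and x :: "nat \<Rightarrow> nat" and \<theta> :: "(nat \<Rightarrow> nat) \<Rightarrow> complex"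
  assumes kn: "k \<le> n" and xk: "x permutes {1..k}" and fpf: "\<And>i. i \<in> {1..k} \<Longrightarrow> x i \<noteq> i"
    and \<theta>: "character (sym_group_rest k n) 1 \<theta>"
begin

definition K where "K = {1..k}"

definition F where "F = {k+1..n}"

lemma K_F: "i \<in> {1..n} \<longleftrightarrow> i \<in> K \<or> i \<in> F" "i \<in> K \<Longrightarrow> i \<notin> F"
  using kn by (auto simp: K_def F_def)

lemma finite_F: "finite F" by (simp add: F_def)

abbreviation S where "S \<equiv> carrier (sym_group_rest k n)"

definition H where "H = centralizer (sym_group k) x <#>\<^bsub>sym_group n\<^esub> S"

text \<open>The factor in the symmetric group on F, extended by the identity, so that the inducing
  character is \<open>\<theta> (rest h)\<close> on H.\<close>

definition rest where "rest h i = (if i \<in> F then h i else i)" for h :: "nat \<Rightarrow> nat"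

lemma S_iff: "s \<in> S \<longleftrightarrow> s permutes F" by (simp add: sym_group_rest_def F_def)

lemma xK: "x permutes K" using xk by (simp add: K_def)

lemma permutes_n: "p permutes K \<Longrightarrow> p permutes {1..n}" "p permutes F \<Longrightarrow> p permutes {1..n}"
  using kn by (auto simp: K_def F_def elim!: permutes_subset)

lemma xn: "x permutes {1..n}" using xK by (rule permutes_n)

lemma inj_x: "inj x" using xK by (rule permutes_inj)

lemma xx: "x v = x w \<longleftrightarrow> v = w" using inj_x by (simp add: inj_eq)

lemma moved: "x i \<noteq> i \<longleftrightarrow> i \<in> K" using xK fpf by (metis K_def permutes_not_in)

lemma fixed: "i \<in> {1..n} \<Longrightarrow> x i = i \<longleftrightarrow> i \<in> F" using moved[of i] K_F[of i] by metis

text \<open>The single entry of a representation of degree one is multiplicative. Both alternatives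
  hold when F has at most one point.\<close>

lemma \<theta>_cases: "(\<forall>s\<in>S. \<theta> s = 1) \<or> (\<forall>s\<in>S. \<theta> s = of_int (sign s))"
proof -
  obtain \<rho> where r: "representation (sym_group_rest k n) 1 \<rho>" and t: "\<And>s. s \<in> S \<Longrightarrow> \<theta> s = trace (\<rho> s)"
    using \<theta> by (auto simp: character_def)
  note R = representationD[OF sym_group_rest_group r]
  have t': "\<theta> s = \<rho> s $$ (0, 0)" if "s \<in> S" for s
    using t[OF that] trace_eq_sum[OF R(1)[OF that]] by simp
  have "(\<forall>p. p permutes F \<longrightarrow> \<theta> p = 1) \<or> (\<forall>p. p permutes F \<longrightarrow> \<theta> p = of_int (sign p))"
  proof (rule multiplicative_on_permutations_cases)
    have "id \<in> S" by (simp add: S_iff permutes_id)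
    then show "\<theta> id = 1" using t' R(3) by (simp add: sym_group_rest_def sym_group_one)
    fix p q assume "p permutes F" "q permutes F"
    then have pq: "p \<in> S" "q \<in> S" "p \<circ> q \<in> S" by (simp_all add: S_iff permutes_compose)
    have "\<rho> (p \<circ> q) = \<rho> p * \<rho> q"
      using R(2)[OF pq(1,2)] by (simp add: sym_group_rest_def sym_group_mult)
    then show "\<theta> (p \<circ> q) = \<theta> p * \<theta> q"
      using t' pq R(1)[OF pq(1)] R(1)[OF pq(2)] by (simp add: scalar_prod_def)
  qed (rule finite_F)
  then show ?thesis unfolding Ball_def S_iff .
qed

lemma disjoint_permutations:
  assumes "p permutes K" "q permutes F"
  shows "p (q i) = (if i \<in> F then q i else p i)"
proof (cases "i \<in> F")
  case True
  then have "q i \<in> F" using assms(2) by (simp add: permutes_in_image)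
  then have "q i \<notin> K" using K_F by blast
  then show ?thesis using True assms(1) by (simp add: permutes_not_in)
next
  case False
  then show ?thesis using assms(2) by (simp add: permutes_not_in)
qed

lemma H_decompose:
  "h \<in> H \<longleftrightarrow> (\<exists>p q. p permutes K \<and> p \<circ> x = x \<circ> p \<and> q permutes F \<and> h = p \<circ> q)"
proof -
  have C: "p \<in> centralizer (sym_group k) x \<longleftrightarrow> p permutes K \<and> p \<circ> x = x \<circ> p" for p
    by (simp add: centralizer_def sym_group_carrier sym_group_mult K_def)
  show ?thesis
    unfolding H_def set_mult_def sym_group_mult using C S_iff by blast
qed

lemma commutes_iff:
  assumes "h permutes {1..n}" "h \<circ> x = x \<circ> h"
  shows "h i \<in> K \<longleftrightarrow> i \<in> K" "h i \<in> F \<longleftrightarrow> i \<in> F"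
proof -
  have "x (h i) = h (x i)" using assms(2) by (metis comp_apply)
  then show "h i \<in> K \<longleftrightarrow> i \<in> K"
    using moved permutes_inj[OF assms(1)] by (metis injD)
  then show "h i \<in> F \<longleftrightarrow> i \<in> F"
    using K_F permutes_in_image[OF assms(1), of i] by metis
qed

lemma permutes_restrict:
  assumes h: "h permutes A" and B: "\<And>i. h i \<in> B \<longleftrightarrow> i \<in> B"
  shows "(\<lambda>i. if i \<in> B then h i else i) permutes B"
  unfolding permutes_def
proof (intro conjI allI impI)
  let ?p = "\<lambda>i. if i \<in> B then h i else i"
  have inj: "h i = h j \<longleftrightarrow> i = j" for i j using permutes_inj[OF h] by (simp add: inj_eq)
  show "\<exists>!j. ?p j = i" for i
  proof (cases "i \<in> B")
    case True
    then obtain j where "h j = i" "j \<in> B" using permutes_surj[OF h] B by (metis surjD)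
    then show ?thesis using True inj by (intro ex1I[of _ j]) (auto split: if_splits)
  next
    case False
    then show ?thesis using B by (intro ex1I[of _ i]) (auto split: if_splits)
  qed
qed simp

text \<open>H is the full centralizer of x in the large group: as x moves exactly the points of K, a
  permutation commuting with x preserves K and F and splits accordingly.\<close>

lemma in_H: "h \<in> H \<longleftrightarrow> h permutes {1..n} \<and> h \<circ> x = x \<circ> h"
proof
  assume "h \<in> H"
  then obtain p q where pq: "p permutes K" "p \<circ> x = x \<circ> p" "q permutes F" "h = p \<circ> q"
    unfolding H_decompose by blast
  have "q \<circ> x = x \<circ> q"
  proof
    fix i
    show "(q \<circ> x) i = (x \<circ> q) i"
    proof (cases "i \<in> F")
      case True
      then have "x i = i" using moved K_F by blast
      then show ?thesis using True disjoint_permutations[OF xK pq(3), of i] by simp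
    next
      case False
      then have "x i \<notin> F" using moved[of i] permutes_in_image[OF xK, of i] K_F(2) by metis
      then show ?thesis using False pq(3) by (simp add: permutes_not_in)
    qed
  qed
  then have "h \<circ> x = x \<circ> h" using pq(2,4) by (metis comp_assoc)
  then show "h permutes {1..n} \<and> h \<circ> x = x \<circ> h"
    using pq permutes_compose[OF permutes_n(2) permutes_n(1)] by blast
next
  assume "h permutes {1..n} \<and> h \<circ> x = x \<circ> h"
  then have h: "h permutes {1..n}" "h \<circ> x = x \<circ> h" by auto
  note hKF = commutes_iff[OF h]
  define p where "p = (\<lambda>i. if i \<in> K then h i else i)"
  have "p permutes K" unfolding p_def using h(1) hKF(1) by (rule permutes_restrict)
  moreover have "rest h permutes F"
    using permutes_restrict[OF h(1) hKF(2)] by (simp add: rest_def[abs_def])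
  moreover have "p \<circ> x = x \<circ> p"
  proof
    fix i
    have "h (x i) = x (h i)" using h(2) by (metis comp_apply)
    then show "(p \<circ> x) i = (x \<circ> p) i" using permutes_in_image[OF xK, of i] by (simp add: p_def)
  qed
  moreover have "h = p \<circ> rest h"
  proof
    fix i
    show "h i = (p \<circ> rest h) i"
      using hKF[of i] K_F[of i] K_F(2)[of "h i"] permutes_not_in[OF h(1), of i]
      by (simp add: p_def rest_def) blast
  qed
  ultimately show "h \<in> H" unfolding H_decompose by blast
qed

lemma H_rest: assumes "h \<in> H" shows "rest h permutes F"
    and "product_char (sym_group n) (centralizer (sym_group k) x) S trivial_char \<theta> h = \<theta> (rest h)"
proof -
  obtain p q where pq: "p permutes K" "p \<circ> x = x \<circ> p" "q permutes F" "h = p \<circ> q"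
    using assms unfolding H_decompose by blast
  have r: "rest h = q"
  proof
    fix i
    show "rest h i = q i"
      using disjoint_permutations[OF pq(1,3), of i] permutes_not_in[OF pq(3), of i]
      by (simp add: rest_def pq(4))
  qed
  then show "rest h permutes F" using pq(3) by simp
  have "p \<in> centralizer (sym_group k) x" "q \<in> S"
    using pq by (simp_all add: centralizer_def sym_group_carrier sym_group_mult S_iff K_def)
  then show "product_char (sym_group n) (centralizer (sym_group k) x) S trivial_char \<theta> h = \<theta> (rest h)"
    unfolding r unfolding pq(4) by (subst product_char_sym[of _ k])
      (auto simp: centralizer_def trivial_char_def)
qed

lemma H_maps_F: "h \<in> H \<Longrightarrow> i \<in> F \<Longrightarrow> h i \<in> F"
  using permutes_in_image[OF H_rest(1), of h i] by (simp add: rest_def)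

lemma rest_comp: "h \<in> H \<Longrightarrow> h' \<in> H \<Longrightarrow> rest (h \<circ> h') = rest h \<circ> rest h'"
  using H_maps_F by (auto simp: rest_def fun_eq_iff)

sublocale sign_character "sym_group n" H "\<lambda>h. \<theta> (rest h)"
proof (intro sign_character.intro sign_character_axioms.intro)
  show "group (sym_group n)" by (rule sym_group_is_group)
  show "finite (carrier (sym_group n))"
    by (simp add: sym_group_def finite_permutations)
  show "subgroup H (sym_group n)"
  proof (rule group.subgroupI[OF sym_group_is_group])
    show "H \<subseteq> carrier (sym_group n)" using in_H sym_group_carrier by blast
    have "id \<in> H" unfolding in_H by (simp add: permutes_id)
    then show "H \<noteq> {}" by blast
    show "inv\<^bsub>sym_group n\<^esub> h \<in> H" if "h \<in> H" for h
    proof -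
      have h: "h permutes {1..n}" "h \<circ> x = x \<circ> h" using that by (simp_all add: in_H)
      have "inv' h (x w) = x (inv' h w)" for w
        using fun_cong[OF h(2), of "inv' h w"] permutes_inverses[OF h(1)] by (metis comp_apply)
      then have "inv' h \<circ> x = x \<circ> inv' h" by auto
      then have "inv' h \<in> H" using permutes_inv[OF h(1)] by (simp add: in_H)
      then show ?thesis using h(1) by (simp add: sym_group_carrier)
    qed
    show "h \<otimes>\<^bsub>sym_group n\<^esub> h' \<in> H" if "h \<in> H" "h' \<in> H" for h h'
    proof -
      have h: "h permutes {1..n}" "h \<circ> x = x \<circ> h" "h' permutes {1..n}" "h' \<circ> x = x \<circ> h'"
        using that by (simp_all add: in_H)
      have "(h \<circ> h') \<circ> x = x \<circ> (h \<circ> h')" using h(2,4) by (metis comp_assoc)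
      then show ?thesis using permutes_compose[OF h(3,1)] by (simp add: in_H sym_group_mult)
    qed
  qed
  show "\<theta> (rest h) = 1 \<or> \<theta> (rest h) = -1" if "h \<in> H" for h
    using \<theta>_cases H_rest(1)[OF that] S_iff[of "rest h"] by (cases "evenperm (rest h)") (auto simp: sign_def)
  show "\<theta> (rest (h \<otimes>\<^bsub>sym_group n\<^esub> h')) = \<theta> (rest h) * \<theta> (rest h')" if "h \<in> H" "h' \<in> H" for h h'
  proof -
    have p: "rest h permutes F" "rest h' permutes F" "rest h \<circ> rest h' permutes F"
      using H_rest(1)[OF that(1)] H_rest(1)[OF that(2)] permutes_compose by blast+
    moreover from this have "sign (rest h \<circ> rest h') = sign (rest h) * sign (rest h')"
      using finite_F by (metis permutation_permutes sign_compose)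
    ultimately show ?thesis
      using \<theta>_cases S_iff unfolding sym_group_mult rest_comp[OF that] by (metis mult_1 of_int_mult)
  qed
qed

end

section \<open>The double coset criterion for pairs of conjugate permutations\<close>

context centralizer_character
begin

abbreviation \<psi> where "\<psi> \<equiv> induced_char (sym_group n) H
  (product_char (sym_group n) (centralizer (sym_group k) x) S trivial_char \<theta>)"

lemma multiplicity_free_iff:
  "multiplicity_free (sym_group n) \<psi> \<longleftrightarrow> (\<forall>g. g permutes {1..n} \<longrightarrow> symmetric_double_coset g)"
proof
  assume mf: "multiplicity_free (sym_group n) \<psi>"
  show "\<forall>g. g permutes {1..n} \<longrightarrow> symmetric_double_coset g"
  proof (intro allI impI)
    fix g assume "g permutes {1..n}"
    then have g: "g \<in> carrier (sym_group n)" by (simp add: sym_group_carrier)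
    show "symmetric_double_coset g"
    proof (rule symmetric_if_multiplicity_free[OF mf H_rest(2) _ g])
      fix p assume "p \<in> carrier (sym_group n)"
      then have p: "p permutes {1..n}" by (simp add: sym_group_carrier)
      from permutes_inv_conjugate[OF p] obtain t where t: "t permutes {1..n}" "\<forall>w. t (t w) = w"
        "\<forall>w. t (p w) = inv' p (t w)" by auto
      have "t \<circ> t = id" using t(2) by (intro ext) simp
      then have "inv' t = t" using inv_unique_comp[of t t] by simp
      then have "inv' p = inv' t \<circ> p \<circ> t" using t(2,3) by (simp add: fun_eq_iff)
      then show "\<exists>t\<in>carrier (sym_group n). inv\<^bsub>sym_group n\<^esub> p =
          inv\<^bsub>sym_group n\<^esub> t \<otimes>\<^bsub>sym_group n\<^esub> p \<otimes>\<^bsub>sym_group n\<^esub> t"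
        using t(1) p by (intro bexI[of _ t]) (simp_all add: sym_group_carrier sym_group_mult)
    qed
  qed
next
  assume "\<forall>g. g permutes {1..n} \<longrightarrow> symmetric_double_coset g"
  then show "multiplicity_free (sym_group n) \<psi>"
    by (intro multiplicity_free_if_symmetric[OF _ H_rest(2)]) (simp_all add: sym_group_carrier)
qed

lemma symmetric_double_coset_iff:
  assumes "g permutes {1..n}"
  shows "symmetric_double_coset g \<longleftrightarrow>
    (\<exists>h\<in>H. \<exists>h'\<in>H. h \<circ> g \<circ> h' = g \<and> \<theta> (rest h) * \<theta> (rest h') = -1) \<or>
    (\<exists>h\<in>H. \<exists>h'\<in>H. h \<circ> g \<circ> h' = inv' g \<and> \<theta> (rest h) * \<theta> (rest h') = 1)"
  using assms by (simp add: symmetric_double_coset_def sym_group_mult sym_group_carrier)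

text \<open>Since t carries y back to x, t g commutes with x; h = g^-1 t therefore lies in H and h g
  h = g^-1. Using h on both sides makes the sign a square, whatever \<open>\<theta>\<close>
  is.\<close>

lemma symmetric_if_involution:
  assumes g: "g permutes {1..n}" and t: "t permutes {1..n}" "\<And>w. t (t w) = w"
    and tx: "\<And>w. t (x w) = y (t w)" and y: "\<And>w. y (g w) = g (x w)"
  shows "symmetric_double_coset g"
proof -
  have "t (y w) = x (t w)" for w using tx[of "t w"] t(2) by metis
  then have "t \<circ> g \<in> H"
    using y permutes_compose[OF g t(1)] by (auto simp: in_H fun_eq_iff) (metis)
  then have h: "inv' (t \<circ> g) \<in> H"
    using subgroup.m_inv_closed[OF sub] permutes_compose[OF g t(1)] by (simp add: sym_group_carrier flip: sym_group_inv_equality)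
  have "t \<circ> t = id" using t(2) by (intro ext) simp
  then have "inv' t = t" using inv_unique_comp[of t t] by simp
  then have e: "inv' (t \<circ> g) = inv' g \<circ> t"
    using g t(1) by (simp add: o_inv_distrib permutes_bij)
  have "inv' (t \<circ> g) \<circ> g \<circ> inv' (t \<circ> g) = inv' g"
    unfolding e using permutes_inverses[OF g] t(2) by (auto simp: fun_eq_iff)
  then show ?thesis
    unfolding symmetric_double_coset_iff[OF g] using h sign_square[OF h] by blast
qed

text \<open>
  The last assumption excludes that \<open>g\<close> is fixed with sign \<open>-1\<close>: at most one fixed point of \<open>x\<close> is
  not fixed by \<open>g x g\<^sup>-\<^sup>1\<close>, so an element centralizing both has the same sign on both sets of
  fixed points.
\<close>

lemma not_symmetric:
  assumes g: "g permutes {1..n}" and y: "\<And>w. y (g w) = g (x w)"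
    and nsw: "\<not> swappable x y"
    and triv: "(\<forall>s\<in>S. \<theta> s = 1) \<or> ((\<forall>w\<in>F. w \<noteq> p \<longrightarrow> g w = w) \<and> g p \<notin> F)"
  shows "\<not> symmetric_double_coset g"
proof
  assume "symmetric_double_coset g"
  then consider h h' where "h \<in> H" "h' \<in> H" "h \<circ> g \<circ> h' = g" "\<theta> (rest h) * \<theta> (rest h') = -1"
    | h h' where "h \<in> H" "h' \<in> H" "h \<circ> g \<circ> h' = inv' g"
    unfolding symmetric_double_coset_iff[OF g] by blast
  then show False
  proof cases
    case 1
    show False
    proof (cases "\<forall>s\<in>S. \<theta> s = 1")
      case True
      then show False using 1 H_rest(1) by (simp add: S_iff)
    next
      case False
      then have gF: "\<And>w. w \<in> F \<Longrightarrow> w \<noteq> p \<Longrightarrow> g w = w" "g p \<notin> F" using triv by auto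
      \<comment> \<open>The relation becomes g r = h g. Away from p, g is the identity on F, which
        forces r and h to agree there.\<close>
      define r where "r = inv' h'"
      have h': "h' permutes {1..n}" using 1 by (simp add: in_H)
      have r: "r \<in> H" "\<theta> (rest r) = \<theta> (rest h')"
        using subgroup.m_inv_closed[OF sub 1(2)] sign_inverse[OF 1(2)] h' by (simp_all add: r_def sym_group_carrier)
      have gr: "g (r w) = h (g w)" for w
        using fun_cong[OF 1(3), of "r w"] permutes_inverses(1)[OF h'] by (simp add: r_def)
      have agree: "r w = h w" if w: "w \<in> F" "w \<noteq> p" for w
      proof -
        have rw: "g (r w) = h w" using gr[of w] gF(1)[OF w] by simp
        have "r w \<noteq> p" using rw gF(2) H_maps_F[OF 1(1) w(1)] by auto
        then show ?thesis using rw gF(1) H_maps_F[OF r(1) w(1)] by simp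
      qed
      \<comment> \<open>Both permute F and agree off p, so they agree at p too; equal signs then
        contradict the product -1.\<close>
      have "r p = h p" if p: "p \<in> F"
      proof -
        have "r p \<in> F" using H_maps_F[OF r(1) p] .
        then obtain u where u: "u \<in> F" "rest h u = r p"
          using permutes_image[OF H_rest(1)[OF 1(1)]] by (metis imageE)
        then have hu: "h u = r p" by (simp add: rest_def)
        have "u = p"
        proof (rule ccontr)
          assume "u \<noteq> p"
          then have "r u = r p" using agree u hu by simp
          moreover have "inj r" using r(1) unfolding in_H by (blast intro: permutes_inj)
          ultimately show False using \<open>u \<noteq> p\<close> by (simp add: inj_eq)
        qed
        then show ?thesis using hu by simp
      qed
      then have "rest r = rest h" using agree by (auto simp: rest_def fun_eq_iff)
      then show False using 1(4) r(2) sign_square[OF 1(1)] by simp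
    qed
  next
    case 2
    \<comment> \<open>h' commutes with x, so g h' carries x to y; h g h' = g^-1 shows that it also
      carries y back to x.\<close>
    define t where "t = g \<circ> h'"
    have p: "h permutes {1..n}" "h' permutes {1..n}" and c: "\<And>w. h (x w) = x (h w)" "\<And>w. h' (x w) = x (h' w)"
      using 2 by (auto simp: in_H fun_eq_iff)
    have "inj t" unfolding t_def using p(2) g by (intro inj_compose permutes_inj)
    moreover have "t (x w) = y (t w)" for w by (simp add: t_def c y)
    moreover have "t (y w) = x (t w)" for w
    proof -
      obtain v where v: "w = g v" using permutes_surj[OF g] by (metis surjD)
      obtain u where u: "v = h' u" using permutes_surj[OF p(2)] by (metis surjD)
      have e: "h (g (h' u')) = inv' g u'" for u' using fun_cong[OF 2(3), of u'] by simp
      have hg: "h (t (g v')) = v'" for v' using e[of "g v'"] permutes_inverses(2)[OF g] by (simp add: t_def)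
      have "h (t (y w)) = x v" using hg[of "x v"] by (simp add: v y)
      also have "\<dots> = h (x (t w))" using hg[of v] by (simp add: c v)
      finally show ?thesis using permutes_inj[OF p(1)] by (simp add: inj_eq)
    qed
    ultimately show False using nsw by (auto simp: swappable_def)
  qed
qed

end

section \<open>The multiplicity-free families\<close>

context centralizer_character
begin

definition conj_x where "conj_x g = g \<circ> x \<circ> inv' g"

lemma conj_x: "g permutes {1..n} \<Longrightarrow> conj_x g (g w) = g (x w)"
  by (simp add: conj_x_def permutes_inverses)

lemma multiplicity_free_transposition:
  assumes k: "k = 2"
  shows "multiplicity_free (sym_group n) \<psi>"
  unfolding multiplicity_free_iff
proof (intro allI impI)
  fix g assume g: "g permutes {1..n}"
  have K: "K = {1, 2}" unfolding K_def unfolding k by auto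
  have "x 1 \<in> {1, 2}" "x 2 \<in> {1, 2}" "x 1 \<noteq> 1" "x 2 \<noteq> 2"
    using permutes_in_image[OF xK, of 1] permutes_in_image[OF xK, of 2] moved[of 1] moved[of 2]
    unfolding K by blast+
  then have x12: "x 1 = 2" "x 2 = 1" by blast+
  have x_id: "x w = w" if "w \<notin> {1, 2}" for w using that moved K by blast
  have g12: "g 1 \<noteq> g 2" using permutes_inj[OF g] by (metis injD one_eq_numeral_iff num.distinct(1))
  have y_id: "conj_x g w = w" if w: "w \<notin> {g 1, g 2}" for w
  proof -
    obtain v where v: "w = g v" using permutes_surj[OF g] by (metis surjD)
    then have "v \<notin> {1, 2}" using w by blast
    then have "x v = v" by (rule x_id)
    then show ?thesis using conj_x[OF g, of v] by (simp only: v)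
  qed
  have "1 \<in> {1..n}" "2 \<in> {1..n}" using kn k by simp_all
  then have A: "{1, 2, g 1, g 2} \<subseteq> {1..n}"
    using permutes_in_image[OF g, of 1] permutes_in_image[OF g, of 2] by blast
  have y12: "conj_x g (g 1) = g 2" "conj_x g (g 2) = g 1" using conj_x[OF g] x12 by metis+
  have "(1::nat) \<noteq> 2" by simp
  from transposition_involution[OF x12 x_id y12 y_id this g12 A]
  obtain t where t: "t permutes {1..n}" "\<forall>w. t (t w) = w" "\<forall>w. t (x w) = conj_x g (t w)"
    by blast
  show "symmetric_double_coset g"
    by (rule symmetric_if_involution[OF g t(1), of "conj_x g"]) (simp_all add: t conj_x[OF g])
qed

lemma three_points:
  assumes k: "k = 3"
  shows "\<exists>b c. x 1 = b \<and> x b = c \<and> x c = 1 \<and> distinct [1, b, c] \<and> K = {1, b, c}"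
proof -
  have K: "K = {1, 2, 3}" unfolding K_def unfolding k by auto
  define b where "b = x 1"
  define c where "c = x b"
  have K1: "1 \<in> K" by (simp add: K)
  have xb: "x 1 = b" "x b = c" by (simp_all add: b_def c_def)
  have mem: "b \<in> K" "c \<in> K" "x c \<in> K"
    using permutes_in_image[OF xK, of 1] permutes_in_image[OF xK, of b] permutes_in_image[OF xK, of c] K1
    unfolding xb by blast+
  have ne: "b \<noteq> 1" "c \<noteq> b" "x c \<noteq> c" using moved[of 1] moved[of b] moved[of c] mem K1
    unfolding xb by blast+
  have "b = 2 \<or> b = 3" using mem(1) ne(1) unfolding K by blast
  then have "\<exists>d. K = {1, b, d} \<and> d \<noteq> 1 \<and> d \<noteq> b"
  proof
    assume "b = 2"
    then show ?thesis unfolding K by (intro exI[of _ 3]) simp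
  next
    assume "b = 3"
    then show ?thesis unfolding K by (intro exI[of _ 2]) auto
  qed
  then obtain d where d: "K = {1, b, d}" "d \<noteq> 1" "d \<noteq> b" by blast
  have c1: "c \<noteq> 1"
  proof
    assume "c = 1"
    have "x d \<in> {1, b, d}" using permutes_in_image[OF xK, of d] d(1) by blast
    moreover have "x d \<noteq> d" using moved[of d] d(1) by blast
    moreover have "x d \<noteq> 1" using xx[of d b] d(3) \<open>c = 1\<close> by (simp add: c_def)
    moreover have "x d \<noteq> b" using xx[of d 1] d(2) by (simp add: b_def)
    ultimately show False by blast
  qed
  have "c = d" using mem(2) ne(2) c1 unfolding d(1) by blast
  then have Kbc: "K = {1, b, c}" using d(1) by simp
  have "x c \<noteq> b" "x c \<noteq> c" using xx[of c 1] c1 ne by (simp_all add: b_def)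
  then have xc: "x c = 1" using mem(3) Kbc by blast
  have dist: "distinct [1, b, c]" using ne c1 by auto
  show ?thesis using xb xc dist Kbc by blast
qed

lemma multiplicity_free_three_cycle:
  assumes k: "k = 3"
  shows "multiplicity_free (sym_group n) \<psi>"
  unfolding multiplicity_free_iff
proof (intro allI impI)
  fix g assume g: "g permutes {1..n}"
  from three_points[OF k] obtain b c where xb: "x 1 = b" "x b = c" and xc: "x c = 1"
    and dist: "distinct [1, b, c]" and Kbc: "K = {1, b, c}" by blast
  have x_id: "x w = w" if "w \<notin> {1, b, c}" for w using that moved Kbc by blast
  have gd: "distinct [g 1, g b, g c]" using permutes_inj[OF g] dist by (simp add: inj_eq)
  have y_id: "conj_x g w = w" if w: "w \<notin> {g 1, g b, g c}" for w
  proof -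
    obtain v where v: "w = g v" using permutes_surj[OF g] by (metis surjD)
    then have "v \<notin> {1, b, c}" using w by blast
    then have "x v = v" by (rule x_id)
    then show ?thesis using conj_x[OF g, of v] by (simp only: v)
  qed
  have "{1, b, c} \<subseteq> {1..n}" using Kbc K_F(1) by blast
  then have A: "{1, b, c, g 1, g b, g c} \<subseteq> {1..n}"
    using permutes_in_image[OF g, of 1] permutes_in_image[OF g, of b] permutes_in_image[OF g, of c]
    by blast
  have y: "conj_x g (g 1) = g b" "conj_x g (g b) = g c" "conj_x g (g c) = g 1"
    using conj_x[OF g] xb xc by metis+
  from three_cycle_involution[OF xb xc x_id y y_id dist gd A]
  obtain t where t: "t permutes {1..n}" "\<forall>w. t (t w) = w" "\<forall>w. t (x w) = conj_x g (t w)"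
    by blast
  show "symmetric_double_coset g"
    by (rule symmetric_if_involution[OF g t(1), of "conj_x g"]) (simp_all add: t conj_x[OF g])
qed

text \<open>An obstruction s lies in H, and so does g^-1 s^-1 g since s commutes with y; acting on
  the left and on the right they fix g. Their signs are read off on the fixed points of x and of y:
  one is that of a transposition, the other is trivial. If neither order has an obstruction,
  \<open>swapping_involution\<close> applies.\<close>

lemma multiplicity_free_involution:
  assumes inv: "x \<circ> x = id" and sgn: "\<forall>s\<in>S. \<theta> s = of_int (sign s)"
  shows "multiplicity_free (sym_group n) \<psi>"
  unfolding multiplicity_free_iff
proof (intro allI impI)
  fix g assume g: "g permutes {1..n}"
  let ?y = "conj_x g"
  note yg = conj_x[OF g]
  have x2: "x (x w) = w" for w using inv by (metis comp_apply id_apply)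
  have y2: "?y (?y w) = w" for w
    using permutes_inverses[OF g] by (simp add: conj_x_def x2)
  have yn: "?y permutes {1..n}"
    unfolding conj_x_def using g permutes_inv[OF g] xn by (intro permutes_compose)
  interpret P: involution_pair "{1..n}" x ?y
    by unfold_locales (auto simp: xn[simplified] yn[simplified] x2 y2)
  have fixy: "?y (g w) = g w \<longleftrightarrow> w \<notin> K" for w
    using yg[of w] moved[of w] permutes_inj[OF g] by (metis injD)
  have tr: "\<theta> (rest h) = -1" if h: "h \<in> H" and vu: "v \<in> F" "u \<in> F" "v \<noteq> u"
    "\<And>w. w \<in> F \<Longrightarrow> h w = transpose v u w" for h v u
  proof -
    have "rest h = transpose v u" using vu by (auto simp: rest_def fun_eq_iff transpose_def)
    then show ?thesis using sgn H_rest(1)[OF h] S_iff vu(3) by (simp add: sign_swap_id)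
  qed
  have id: "\<theta> (rest h) = 1" if h: "h \<in> H" "\<And>w. w \<in> F \<Longrightarrow> h w = w" for h
  proof -
    have "rest h = id" using h(2) by (auto simp: rest_def fun_eq_iff)
    moreover have "sign (id :: nat \<Rightarrow> nat) = 1" by (rule sign_id)
    ultimately show ?thesis using sgn H_rest(1)[OF h(1)] S_iff by simp
  qed
  have obstruction: "symmetric_double_coset g"
    if s: "s permutes {1..n}" "s \<circ> x = x \<circ> s" "s \<circ> ?y = ?y \<circ> s"
      and sign: "\<And>h h'. h \<in> H \<Longrightarrow> h' \<in> H \<Longrightarrow> h = s \<Longrightarrow> h' = inv' g \<circ> inv' s \<circ> g \<Longrightarrow> \<theta> (rest h) * \<theta> (rest h') = -1" for s
  proof -
    have sH: "s \<in> H" using s by (simp add: in_H)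
    define h where "h = inv' g \<circ> s \<circ> g"
    have hn: "h permutes {1..n}" unfolding h_def using g s(1) permutes_inv[OF g] by (intro permutes_compose)
    have "h (x w) = x (h w)" for w
    proof -
      have "g (h (x w)) = s (?y (g w))" using permutes_inverses[OF g] by (simp add: h_def yg)
      also have "\<dots> = ?y (s (g w))" using s(3) by (metis comp_apply)
      also have "s (g w) = g (h w)" using permutes_inverses[OF g] by (simp add: h_def)
      finally show ?thesis using permutes_inj[OF g] by (simp add: yg inj_eq)
    qed
    then have hH: "h \<in> H" using hn by (auto simp: in_H[simplified])
    have "inv' h = inv' g \<circ> inv' s \<circ> g"
      unfolding h_def using g s(1) permutes_inv[OF g] permutes_inv_inv[OF g]
      by (simp add: o_inv_distrib permutes_bij bij_comp comp_assoc)
    moreover have h'H: "inv' h \<in> H"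
      using subgroup.m_inv_closed[OF sub hH] hn by (simp add: sym_group_carrier)
    moreover have "s \<circ> g \<circ> inv' h = g"
      using calculation(1) permutes_inverses[OF g] permutes_inverses[OF s(1)] by (auto simp: fun_eq_iff)
    ultimately show ?thesis
      unfolding symmetric_double_coset_iff[OF g] using sign[OF sH h'H] sH by blast
  qed
  consider "sign_obstruction {1..n} x ?y" | "sign_obstruction {1..n} ?y x"
    | "\<not> sign_obstruction {1..n} x ?y" "\<not> sign_obstruction {1..n} ?y x" by blast
  then show "symmetric_double_coset g"
  proof cases
    case 1
    then obtain s v u where s: "s permutes {1..n}" "s \<circ> x = x \<circ> s" "s \<circ> ?y = ?y \<circ> s"
      and vu: "v \<in> {1..n}" "u \<in> {1..n}" "v \<noteq> u" "x v = v" "x u = u"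
        "\<forall>w. x w = w \<longrightarrow> s w = transpose v u w" "\<forall>w. ?y w = w \<longrightarrow> s w = w"
      unfolding sign_obstruction_def by blast
    show ?thesis
    proof (rule obstruction[OF s])
      fix h h' assume h: "h \<in> H" "h' \<in> H" "h = s" "h' = inv' g \<circ> inv' s \<circ> g"
      have "\<theta> (rest h) = -1"
      proof (rule tr[OF h(1) _ _ vu(3)])
        show "v \<in> F" "u \<in> F" using vu fixed by blast+
        show "h w = transpose v u w" if "w \<in> F" for w
          using vu(6) moved[of w] K_F(2)[of w] that h(3) by blast
      qed
      moreover have "\<theta> (rest h') = 1"
      proof (rule id[OF h(2)])
        fix w assume "w \<in> F"
        then have "s (g w) = g w" using vu(7) fixy K_F(2) by blast
        then have "inv' s (g w) = g w" using permutes_inverses(2)[OF s(1)] by metis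
        then show "h' w = w" using permutes_inverses(2)[OF g] by (simp add: h(4))
      qed
      ultimately show "\<theta> (rest h) * \<theta> (rest h') = -1" by simp
    qed
  next
    case 2
    then obtain s v u where s: "s permutes {1..n}" "s \<circ> ?y = ?y \<circ> s" "s \<circ> x = x \<circ> s"
      and vu: "v \<in> {1..n}" "u \<in> {1..n}" "v \<noteq> u" "?y v = v" "?y u = u"
        "\<forall>w. ?y w = w \<longrightarrow> s w = transpose v u w" "\<forall>w. x w = w \<longrightarrow> s w = w"
      unfolding sign_obstruction_def by blast
    show ?thesis
    proof (rule obstruction[OF s(1,3,2)])
      fix h h' assume h: "h \<in> H" "h' \<in> H" "h = s" "h' = inv' g \<circ> inv' s \<circ> g"
      have "\<theta> (rest h) = 1"
      proof (rule id[OF h(1)])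
        show "h w = w" if "w \<in> F" for w
          using vu(7) moved[of w] K_F(2)[of w] that h(3) by blast
      qed
      \<comment> \<open>g^-1 carries the fixed points of y to those of x, so the transposition of v
        and u becomes one on F.\<close>
      moreover have "\<theta> (rest h') = -1"
      proof (rule tr[OF h(2)])
        have gi: "g (inv' g w) = w" for w using permutes_inverses(1)[OF g] .
        have inF: "inv' g w \<in> F" if "w \<in> {1..n}" "?y w = w" for w
          using that fixy[of "inv' g w"] gi[of w] permutes_in_image[OF permutes_inv[OF g], of w] K_F(1) by metis
        show "inv' g v \<in> F" "inv' g u \<in> F" using inF vu by blast+
        show "inv' g v \<noteq> inv' g u" using vu(3) gi by metis
        fix w assume "w \<in> F"
        then have "?y (g w) = g w" using fixy K_F(2) by blast
        moreover then have "s (transpose v u (g w)) = g w"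
          using vu by (auto simp: transpose_def)
        ultimately have "inv' s (g w) = transpose v u (g w)"
          using permutes_inverses(2)[OF s(1)] by metis
        then show "h' w = transpose (inv' g v) (inv' g u) w"
          using permutes_inverses(2)[OF g] gi by (auto simp: h(4) transpose_def)
      qed
      ultimately show "\<theta> (rest h) * \<theta> (rest h') = -1" by simp
    qed
  next
    case 3
    from P.swapping_involution[OF 3] obtain t where t: "t permutes {1..n}" "\<forall>w. t (t w) = w"
      "\<forall>w. t (x w) = ?y (t w)" by blast
    show ?thesis
      by (rule symmetric_if_involution[OF g t(1), of ?y]) (simp_all add: t yg)
  qed
qed

end

section \<open>Failure in the remaining cases, and the characterization\<close>

lemma exists_not_in_smaller:
  assumes "finite A" "card A < card B" shows "\<exists>b\<in>B. b \<notin> A"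
  using assms by (meson card_mono leD subsetI)

context centralizer_character
begin

lemma not_multiplicity_free:
  assumes g: "g permutes {1..n}"
    and nsw: "\<And>y. (\<And>w. y (g w) = g (x w)) \<Longrightarrow> \<not> swappable x y"
    and triv: "(\<forall>s\<in>S. \<theta> s = 1) \<or> ((\<forall>w\<in>F. w \<noteq> p \<longrightarrow> g w = w) \<and> g p \<notin> F)"
  shows "\<not> multiplicity_free (sym_group n) \<psi>"
  using not_symmetric[OF g conj_x[OF g] nsw[OF conj_x[OF g]] triv] g
  unfolding multiplicity_free_iff by blast

lemma transpose_permutes: "a \<in> {1..n} \<Longrightarrow> b \<in> {1..n} \<Longrightarrow> transpose a b permutes {1..n}"
  by (rule permutes_swap_id)

lemma x_in_K: "i \<in> K \<Longrightarrow> x i \<in> K" using permutes_in_image[OF xK, of i] by blast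

lemma K_n: "i \<in> K \<Longrightarrow> i \<in> {1..n}" and F_n: "i \<in> F \<Longrightarrow> i \<in> {1..n}"
  using K_F(1) by blast+

lemma card_K: "card K = k" by (simp add: K_def)

text \<open>The points k + 1 and k + 2 serve as the two fixed points. The second moved point d must
  avoid i, its image and its preimage, which k >= 4 permits.\<close>

lemma not_multiplicity_free_trivial:
  assumes k: "k \<ge> 4" and m: "n \<ge> k + 2" and triv: "\<forall>s\<in>S. \<theta> s = 1"
  shows "\<not> multiplicity_free (sym_group n) \<psi>"
proof -
  have "1 \<in> K" using k by (simp add: K_def)
  then obtain i where i: "i \<in> K" by blast
  obtain j where j: "x j = i" using permutes_surj[OF xK] by (metis surjD)
  have "card {i, x i, j} \<le> 3" by (simp add: card_insert_if)
  then obtain d where d: "d \<in> K" "d \<notin> {i, x i, j}"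
    using exists_not_in_smaller[of "{i, x i, j}" K] k card_K by auto
  have pq: "k + 1 \<in> F" "k + 2 \<in> F" using m by (auto simp: F_def)
  let ?g = "transpose i (k + 1) \<circ> (transpose d (k + 2) \<circ> transpose d (x i))"
  have g: "?g permutes {1..n}"
    using i d pq by (intro permutes_compose transpose_permutes K_n F_n x_in_K)
  show ?thesis
  proof (rule not_multiplicity_free[OF g])
    fix y assume y: "\<And>w. y (?g w) = ?g (x w)"
    have fp: "x (k + 1) = k + 1" "x (k + 2) = k + 2" using pq moved K_F(2) by blast+
    have mv: "x i \<noteq> i" "x d \<noteq> d" using i d moved by blast+
    have ne: "d \<noteq> i" "x i \<noteq> d" "x d \<noteq> i" using d j xx[of d j] by auto
    show "\<not> swappable x y"
      by (rule not_swappable_two_fixed_points[OF inj_x fp _ mv ne refl y]) simp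
  qed (use triv in blast)
qed

text \<open>The point a lies on a cycle of length at least four. The auxiliary f is taken from F
  whenever possible, so that g moves just one point of F, and moves it into K; if F is empty, n >= 7
  gives a point outside the at most six listed ones.\<close>

lemma not_multiplicity_free_long:
  assumes a: "x (x a) \<noteq> a" "x (x (x a)) \<noteq> a" and n: "n = k \<longrightarrow> n \<ge> 7"
  shows "\<not> multiplicity_free (sym_group n) \<psi>"
proof -
  obtain b where b: "x b = a" using permutes_surj[OF xK] by (metis surjD)
  obtain c where c: "x c = b" using permutes_surj[OF xK] by (metis surjD)
  have a1: "x a \<noteq> a" using a by auto
  then have aK: "a \<in> K" using moved by blast
  have bcK: "b \<in> K" "c \<in> K" using aK b c permutes_in_image[OF xK, of b] permutes_in_image[OF xK, of c] by auto
  let ?A = "{c, b, a, x a, x (x a), x (x (x a))}"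
  have AK: "?A \<subseteq> K" using aK bcK x_in_K by blast
  obtain f where f: "f \<in> {1..n}" "f \<notin> ?A" "F \<noteq> {} \<longrightarrow> f \<in> F"
  proof (cases "F = {}")
    case True
    have "card ?A \<le> 6" by (simp add: card_insert_if)
    moreover have "n = k" using True kn by (auto simp: F_def)
    ultimately show ?thesis using that exists_not_in_smaller[of ?A "{1..n}"] n True by auto
  next
    case False
    then obtain f where "f \<in> F" by blast
    then show ?thesis using that AK K_F(2)[of f] F_n[of f] by blast
  qed
  let ?g = "transpose a f \<circ> transpose a (x a)"
  have g: "?g permutes {1..n}"
    using K_n[OF aK] K_n[OF x_in_K[OF aK]] f(1) by (intro permutes_compose transpose_permutes)
  show ?thesis
  proof (rule not_multiplicity_free[OF g])
    fix y assume y: "\<And>w. y (?g w) = ?g (x w)"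
    have f': "f \<noteq> c" "f \<noteq> b" "f \<noteq> a" "f \<noteq> x a" "f \<noteq> x (x a)" "f \<noteq> x (x (x a))" using f(2) by blast+
    show "\<not> swappable x y"
      by (rule not_swappable_long_cycle[OF inj_x c b refl refl refl a1 a f' refl y])
  next
    have "w \<noteq> a" "w \<noteq> x a" if "w \<in> F" for w using that aK x_in_K K_F(2) by blast+
    then show "(\<forall>s\<in>S. \<theta> s = 1) \<or> ((\<forall>w\<in>F. w \<noteq> f \<longrightarrow> ?g w = w) \<and> ?g f \<notin> F)"
      using f(2) aK K_F(2)[of a] by (simp add: transpose_def)
  qed
qed

text \<open>All cycles on K have length two or three and c lies on a 3-cycle. A fixed point of x is
  used if there is one; otherwise two further cycles are found inside K.\<close>

lemma not_multiplicity_free_short: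
  assumes cyc: "\<And>a. x (x a) = a \<or> x (x (x a)) = a" and c: "x (x c) \<noteq> c"
    and k: "k \<ge> 4" and n: "n = k \<longrightarrow> n \<ge> 7"
  shows "\<not> multiplicity_free (sym_group n) \<psi>"
proof -
  define d where "d = x c"
  define b where "b = x d"
  have x3: "x c = d" "x d = b" "x b = c" using cyc[of c] c by (auto simp: d_def b_def)
  have cd: "c \<noteq> d" using c x3 by auto
  then have cK: "c \<in> K" using moved[of c] x3 by simp
  then have dbK: "d \<in> K" "b \<in> K" using x_in_K x3 by metis+
  have bd: "b \<noteq> d" "b \<noteq> c" using cd x3 xx c by (metis)+
  show ?thesis
  proof (cases "n = k")
    case False
    then have p: "k + 1 \<in> F" using kn by (auto simp: F_def)
    let ?p = "k + 1"
    have "card {b, c, d} \<le> 3" by (simp add: card_insert_if)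
    then obtain f where f: "f \<in> K" "f \<notin> {b, c, d}" using exists_not_in_smaller[of "{b, c, d}" K] k card_K by auto
    let ?g = "(transpose f c \<circ> transpose f ?p) \<circ> transpose (x f) b"
    have g: "?g permutes {1..n}"
      using f(1) cK dbK p by (intro permutes_compose transpose_permutes K_n F_n[OF p] x_in_K)
    have px: "x ?p = ?p" using p moved K_F(2) by blast
    show ?thesis
    proof (rule not_multiplicity_free[OF g])
      fix y assume y: "\<And>w. y (?g w) = ?g (x w)"
      have f': "x f \<noteq> f" "f \<noteq> b" "f \<noteq> c" "f \<noteq> d" using f moved by blast+
      show "\<not> swappable x y"
        by (rule not_swappable_fixed_point[OF inj_x x3 cd px f' refl y])
    next
      have ne: "w \<noteq> f" "w \<noteq> c" "w \<noteq> x f" "w \<noteq> b" if "w \<in> F" for w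
        using that f(1) cK dbK x_in_K[OF f(1)] K_F(2) by blast+
      have "?g ?p = c" using ne[OF p] by (simp add: transpose_def)
      moreover have "?g w = w" if "w \<in> F" "w \<noteq> ?p" for w using ne[OF that(1)] that(2) by (simp add: transpose_def)
      ultimately show "(\<forall>s\<in>S. \<theta> s = 1) \<or> ((\<forall>w\<in>F. w \<noteq> ?p \<longrightarrow> ?g w = w) \<and> ?g ?p \<notin> F)"
        using cK K_F(2)[of c] by metis
    qed
  next
    case True
    have F: "F = {}" unfolding F_def using True by simp
    have n7: "n \<ge> 7" using n True by blast
    have Kn: "K = {1..n}" using True by (simp add: K_def)
    let ?A = "{c, d, b}"
    have "card ?A \<le> 3" by (simp add: card_insert_if)
    then obtain f0 where f0: "f0 \<in> K" "f0 \<notin> ?A" using exists_not_in_smaller[of ?A K] k card_K by auto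
    define f1 where "f1 = x f0"
    define f2 where "f2 = x f1"
    \<comment> \<open>f2 is included so that h0 lies on a third cycle. Up to six points are
      excluded, hence the need for a seventh.\<close>
    let ?B = "{c, d, b, f0, f1, f2}"
    have "card ?B \<le> 6" by (simp add: card_insert_if)
    then obtain h0 where h0: "h0 \<in> K" "h0 \<notin> ?B" using exists_not_in_smaller[of ?B K] n7 True card_K by auto
    define h1 where "h1 = x h0"
    have f: "x f0 = f1" "x f1 = f0 \<or> x f1 = f2 \<and> x f2 = f0 \<and> f2 \<noteq> f0 \<and> f2 \<noteq> f1"
    proof -
      have "f0 \<noteq> f1" using moved f0(1) by (metis f1_def)
      then have "f1 \<noteq> f2" using xx[of f0 f1] by (simp add: f1_def f2_def)
      then show "x f0 = f1" "x f1 = f0 \<or> x f1 = f2 \<and> x f2 = f0 \<and> f2 \<noteq> f0 \<and> f2 \<noteq> f1"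
        using cyc[of f0] by (auto simp: f1_def f2_def)
    qed
    have h: "x h0 = h1" "x h1 = h0 \<or> x h1 = x h1 \<and> x (x h1) = h0 \<and> x h1 \<noteq> h0 \<and> x h1 \<noteq> h1"
    proof -
      have "h0 \<noteq> h1" using moved h0(1) by (metis h1_def)
      then have "h1 \<noteq> x h1" using xx[of h0 h1] by (simp add: h1_def)
      then show "x h0 = h1" "x h1 = h0 \<or> x h1 = x h1 \<and> x (x h1) = h0 \<and> x h1 \<noteq> h0 \<and> x h1 \<noteq> h1"
        using cyc[of h0] by (auto simp: h1_def)
    qed
    have dist: "distinct [c, d, b, f0, f1, h0, h1]"
    proof -
      have "f1 \<noteq> f0" "h1 \<noteq> h0" using moved f0(1) h0(1) by (metis f1_def, metis h1_def)
      moreover have "f1 \<noteq> c" "f1 \<noteq> d" "f1 \<noteq> b" using f0(2) x3 xx f(1) by (metis insertCI)+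
      moreover have "h1 \<noteq> c" "h1 \<noteq> d" "h1 \<noteq> b" using h0(2) x3 xx h(1) by (metis insertCI)+
      moreover have "h1 \<noteq> f0"
      proof
        assume "h1 = f0"
        then have "x h0 = x f1 \<or> x h0 = x f2" using f(2) h(1) by auto
        then show False using xx h0(2) by auto
      qed
      moreover have "h1 \<noteq> f1" using xx[of h0 f0] h0(2) by (simp add: f1_def h1_def)
      ultimately show ?thesis using cd bd f0(2) h0(2) by auto
    qed
    let ?g = "transpose c h1 \<circ> (transpose c h0 \<circ> (transpose c f1 \<circ> (transpose c d \<circ> transpose c f0)))"
    have "f1 \<in> K" "h1 \<in> K" using x_in_K f0 h0 by (auto simp: f1_def h1_def)
    then have g: "?g permutes {1..n}"
      using cK dbK f0 h0 by (intro permutes_compose transpose_permutes K_n)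
    show ?thesis
    proof (rule not_multiplicity_free[OF g])
      fix y assume y: "\<And>w. y (?g w) = ?g (x w)"
      show "\<not> swappable x y"
        by (rule not_swappable_three_cycles[OF inj_x x3 f h dist refl y])
    qed (simp add: F)
  qed
qed

lemma sign_eq_one_if_small:
  assumes "n < k + 2" "s \<in> S"
  shows "sign s = 1"
proof -
  have "s = id"
  proof
    fix i
    have s: "s permutes F" using assms(2) by (simp add: S_iff)
    show "s i = id i"
    proof (cases "i \<in> F")
      case True
      then have "s i \<in> F" using permutes_in_image[OF s, of i] by blast
      then show ?thesis using True assms(1) by (simp add: F_def)
    next
      case False
      then show ?thesis using permutes_not_in[OF s] by simp
    qed
  qed
  then show ?thesis using sign_id by simp
qed

theorem multiplicity_free_characterization:
  assumes n: "n \<ge> 7" and k: "k \<ge> 1"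
  shows "multiplicity_free (sym_group n) \<psi> \<longleftrightarrow>
    k = 2 \<or> k = 3 \<or> x \<circ> x = id \<and> (\<forall>s\<in>S. \<theta> s = of_int (sign s))"
proof
  assume mf: "multiplicity_free (sym_group n) \<psi>"
  have "k \<noteq> 1"
  proof
    assume "k = 1"
    then have "K = {1}" unfolding K_def by simp
    then show False using moved[of 1] x_in_K[of 1] by blast
  qed
  moreover have "x \<circ> x = id \<and> (\<forall>s\<in>S. \<theta> s = of_int (sign s))" if "k \<ge> 4"
  proof -
    have sgn: "\<forall>s\<in>S. \<theta> s = of_int (sign s)"
    proof (rule ccontr)
      assume no: "\<not> ?thesis"
      then have one: "\<forall>s\<in>S. \<theta> s = 1" using \<theta>_cases by blast
      \<comment> \<open>With at most one point in F the trivial and sign characters coincide, so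
        failure of the sign condition provides two fixed points.\<close>
      then have "n \<ge> k + 2" using no sign_eq_one_if_small by (metis not_le of_int_1)
      then show False using not_multiplicity_free_trivial[OF that _ one] mf by blast
    qed
    have "x \<circ> x = id"
    proof (rule ccontr)
      assume "x \<circ> x \<noteq> id"
      then obtain c where c: "x (x c) \<noteq> c" by (auto simp: fun_eq_iff)
      have "n = k \<longrightarrow> n \<ge> 7" using n by blast
      then have "\<And>a. x (x a) = a \<or> x (x (x a)) = a" using not_multiplicity_free_long mf by blast
      then show False using not_multiplicity_free_short[OF _ c that] n mf by blast
    qed
    then show ?thesis using sgn by blast
  qed
  ultimately show "k = 2 \<or> k = 3 \<or> x \<circ> x = id \<and> (\<forall>s\<in>S. \<theta> s = of_int (sign s))"
    using k by linarith
next
  assume "k = 2 \<or> k = 3 \<or> x \<circ> x = id \<and> (\<forall>s\<in>S. \<theta> s = of_int (sign s))"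
  then show "multiplicity_free (sym_group n) \<psi>"
    using multiplicity_free_transposition multiplicity_free_three_cycle multiplicity_free_involution
    by blast
qed

lemma is_cycle_2: assumes "k = 2" shows "is_cycle 2 x"
proof -
  have K: "K = {1, 2}" unfolding K_def unfolding assms by auto
  have x12: "x 1 = 2" "x 2 = 1"
    using x_in_K[of 1] x_in_K[of 2] moved[of 1] moved[of 2] unfolding K by blast+
  have "x = cycle_of_list [1, 2]"
  proof
    fix w
    consider "w = 1" | "w = 2" | "w \<notin> K" unfolding K by blast
    then show "x w = cycle_of_list [1, 2] w"
    proof cases
      case 3
      then have "x w = w" "w \<noteq> 1" "w \<noteq> 2" using moved unfolding K by blast+
      then show ?thesis by simp
    qed (use x12 in simp_all)
  qed
  then show ?thesis unfolding is_cycle_def by (intro exI[of _ "[1, 2]"]) simp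
qed

lemma is_cycle_3: assumes "k = 3" shows "is_cycle 3 x"
proof -
  from three_points[OF assms] obtain b c where x: "x 1 = b" "x b = c" "x c = 1"
    and d: "distinct [1, b, c]" and K: "K = {1, b, c}" by blast
  have "x = cycle_of_list [1, b, c]"
  proof
    fix w
    consider "w = 1" | "w = b" | "w = c" | "w \<notin> K" unfolding K by blast
    then show "x w = cycle_of_list [1, b, c] w"
    proof cases
      case 4
      then have "x w = w" "w \<noteq> 1" "w \<noteq> b" "w \<noteq> c" using moved unfolding K by blast+
      then show ?thesis by simp
    qed (use x d in simp_all)
  qed
  then show ?thesis unfolding is_cycle_def using d by (intro exI[of _ "[1, b, c]"]) simp
qed

end

theorem theorem1:
  fixes n k :: nat and x :: "nat \<Rightarrow> nat" and \<theta> :: "(nat \<Rightarrow> nat) \<Rightarrow> complex"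
  assumes "n \<ge> 7" and "1 \<le> k" and "k \<le> n"
    and "x \<in> carrier (sym_group k)"
    and "\<forall>i\<in>{1..k}. x i \<noteq> i"
    and "character (sym_group_rest k n) 1 \<theta>"
  defines "C \<equiv> centralizer (sym_group k) x"
    and "S \<equiv> carrier (sym_group_rest k n)"
  defines "\<psi> \<equiv> induced_char (sym_group n) (C <#>\<^bsub>sym_group n\<^esub> S)
                  (product_char (sym_group n) C S trivial_char \<theta>)"
  shows "multiplicity_free (sym_group n) \<psi> \<longleftrightarrow>
      (k = 2 \<and> is_cycle 2 x) \<or>
      (k = 3 \<and> is_cycle 3 x) \<or>
      (x \<noteq> id \<and> x \<circ> x = id \<and> (\<forall>s\<in>S. \<theta> s = of_int (sign s)))"
proof -
  interpret centralizer_character n k x \<theta>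
    using assms(3-6) by unfold_locales (auto simp: sym_group_carrier)
  have "x 1 \<noteq> 1" using assms(2,5) by simp
  then have "x \<noteq> id" by auto
  then show ?thesis
    using multiplicity_free_characterization[OF assms(1,2)] is_cycle_2 is_cycle_3
    unfolding H_def \<psi>_def C_def S_def by blast
qed

end
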